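(* There is no generic vanishing theorem for $\mathrm{Spin}(7)$ instantons, in the following sense: there exist $\mathrm{Spin}(7)$ instantons $(E_1,A_1)$ and $(E_2,A_2)$ over a flat 8-torus $T^8$ such that (i) the kernel of the Dirac operator $D$ of $E_1$, acting on $\Gamma(S\otimes E_1)$, is non-zero and $\ker D\subset \Gamma(S^+\otimes E_1)$; and (ii) the kernel of the Dirac operator $D$ of $E_2$, acting on $\Gamma(S\otimes E_2)$, is non-zero and $\ker D\subset\Gamma(S^-\otimes E_2)$.
   Context: The flat torus $T^8$ carries the constant-coefficient Cayley 4-form which, in linear oriented orthonormal coordinates $(x^1,\dots,x^8)$ and with $dx^{abcd}=dx^a\wedge dx^b\wedge dx^c\wedge dx^d$, is $$\Phi = dx^{1234}+dx^{1256}-dx^{1278}+dx^{1357}+dx^{1368}+dx^{1458}-dx^{1467}-dx^{2358}+dx^{2367}+dx^{2457}+dx^{2468}-dx^{3456}+dx^{3478}+dx^{5678}.$$ The operator $\star(\cdot\wedge\Phi)$ on 2-forms has eigenvalues $1$ and $-3$, of multiplicities $21$ and $7$. A $\mathrm{Spin}(7)$ instanton is a Hermitian vector bundle $E\to T^8$ with compatible (unitary) connection $A$ whose curvature $F_E$ satisfies $\star(F_E\wedge\Phi)=F_E$. $S=S^+\oplus S^-$ is the (trivial, flat) complex spinor bundle of $T^8$ split by chirality with respect to the orientation $dx^{12345678}$, each of $S^\pm$ having complex rank $8$; the chirality labelled $+$ is the one containing the $\mathrm{Spin}(7)$-invariant spinors. The Dirac operator of $(E,A)$ is the spin Dirac operator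 on $\Gamma(S\otimes E)$ twisted by $A$. *)

theory Defs
  imports "HOL-Analysis.Analysis"
begin

section \<open>Constant-coefficient forms on the oriented Euclidean space of dimension 8\<close>

text \<open>
  The coordinate functions are \<open>x $ 1, \<dots>, x $ 8\<close>. A form is represented by its coefficients:
  \<open>\<alpha> K\<close> is the coefficient of \<open>dx\<^sup>K\<close>, the wedge product of the \<open>dx\<^sup>k\<close> with \<open>k \<in> K\<close> taken in
  increasing order, for \<open>K \<subseteq> {1..8}\<close>. Coordinate labels are natural numbers because the library
  order on the type \<open>8\<close>, in which \<open>8 = 0\<close>, is not the order \<open>1 < \<dots> < 8\<close> of the orientation.
\<close>

type_synonym 'a form = "nat set \<Rightarrow> 'a"

definition dx :: "nat set \<Rightarrow> 'a::comm_ring_1 form" where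
  "dx I = (\<lambda>K. if K = I then 1 else 0)"

text \<open>For disjoint \<open>I\<close> and \<open>J\<close>: \<open>dx\<^sup>I \<and> dx\<^sup>J = shuffle_sign I J \<cdot> dx\<^bsup>I \<union> J\<^esup>\<close>.\<close>

definition shuffle_sign :: "nat set \<Rightarrow> nat set \<Rightarrow> 'a::comm_ring_1" where
  "shuffle_sign I J = (- 1) ^ card {(i, j). i \<in> I \<and> j \<in> J \<and> j < i}"

definition wedge :: "'a::comm_ring_1 form \<Rightarrow> 'a form \<Rightarrow> 'a form" where
  "wedge \<alpha> \<beta> = (\<lambda>K. \<Sum>I\<in>Pow K. shuffle_sign I (K - I) * \<alpha> I * \<beta> (K - I))"

text \<open>The Hodge star is determined by \<open>dx\<^sup>I \<and> \<star>dx\<^sup>I = dx\<^bsup>12345678\<^esup>\<close>.\<close>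

definition hodge :: "'a::comm_ring_1 form \<Rightarrow> 'a form" where
  "hodge \<alpha> = (\<lambda>J. if J \<subseteq> {1..8} then shuffle_sign ({1..8} - J) J * \<alpha> ({1..8} - J) else 0)"

definition cayley_form :: "'a::comm_ring_1 form" where
  "cayley_form K =
     dx {1,2,3,4} K + dx {1,2,5,6} K - dx {1,2,7,8} K + dx {1,3,5,7} K + dx {1,3,6,8} K
     + dx {1,4,5,8} K - dx {1,4,6,7} K - dx {2,3,5,8} K + dx {2,3,6,7} K + dx {2,4,5,7} K
     + dx {2,4,6,8} K - dx {3,4,5,6} K + dx {3,4,7,8} K + dx {5,6,7,8} K"

definition two_form :: "'a::comm_ring_1 form \<Rightarrow> bool" where
  "two_form \<omega> \<longleftrightarrow> (\<forall>K. \<omega> K \<noteq> 0 \<longrightarrow> K \<subseteq> {1..8} \<and> card K = 2)"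

text \<open>The form \<open>\<Sum>k<l. F k l dx\<^sup>k \<and> dx\<^sup>l\<close> of an antisymmetric array \<open>F\<close>.\<close>

definition two_form_of :: "(nat \<Rightarrow> nat \<Rightarrow> 'a::comm_ring_1) \<Rightarrow> 'a form" where
  "two_form_of F = (\<lambda>K. if K \<subseteq> {1..8} \<and> card K = 2 then F (Min K) (Max K) else 0)"


section \<open>Spinors in dimension 8\<close>

text \<open>
  The spinor module is the 16-dimensional tensor product of four copies of a two-dimensional
  space with basis \<open>False, True\<close>. For \<open>j = 0, \<dots>, 3\<close> the vectors \<open>e\<^bsub>2j+1\<^esub>, e\<^bsub>2j+2\<^esub>\<close> act by
  \<open>\<i> \<sigma>\<^sub>3 \<otimes> \<dots> \<otimes> \<sigma>\<^sub>3 \<otimes> \<sigma>\<^sub>q \<otimes> 1 \<otimes> \<dots> \<otimes> 1\<close> with \<open>q = 1, 2\<close> in position \<open>j\<close>, so that Clifford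
  multiplication satisfies \<open>c(v)\<^sup>2 = - |v|\<^sup>2\<close> and is skew-Hermitian on vectors.
\<close>

type_synonym spin_index = "bool \<times> bool \<times> bool \<times> bool"
type_synonym spinor = "complex ^ spin_index"

definition pauli :: "nat \<Rightarrow> bool \<Rightarrow> bool \<Rightarrow> complex" where
  "pauli q a b =
     (if q = 1 then (if a \<noteq> b then 1 else 0)
      else if q = 2 then (if a = b then 0 else if b then - \<i> else \<i>)
      else if q = 3 then (if a \<noteq> b then 0 else if a then - 1 else 1)
      else (if a = b then 1 else 0))"

definition pauli_tensor :: "nat \<Rightarrow> nat \<Rightarrow> nat \<Rightarrow> nat \<Rightarrow> complex ^ spin_index ^ spin_index" where
  "pauli_tensor q\<^sub>0 q\<^sub>1 q\<^sub>2 q\<^sub>3 =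
     (\<chi> a b. case (a, b) of ((a\<^sub>0, a\<^sub>1, a\<^sub>2, a\<^sub>3), (b\<^sub>0, b\<^sub>1, b\<^sub>2, b\<^sub>3)) \<Rightarrow>
        \<i> * pauli q\<^sub>0 a\<^sub>0 b\<^sub>0 * pauli q\<^sub>1 a\<^sub>1 b\<^sub>1 * pauli q\<^sub>2 a\<^sub>2 b\<^sub>2 * pauli q\<^sub>3 a\<^sub>3 b\<^sub>3)"

definition gamma :: "nat \<Rightarrow> complex ^ spin_index ^ spin_index" where
  "gamma k =
     (if k = 1 then pauli_tensor 1 0 0 0 else if k = 2 then pauli_tensor 2 0 0 0
      else if k = 3 then pauli_tensor 3 1 0 0 else if k = 4 then pauli_tensor 3 2 0 0
      else if k = 5 then pauli_tensor 3 3 1 0 else if k = 6 then pauli_tensor 3 3 2 0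
      else if k = 7 then pauli_tensor 3 3 3 1 else if k = 8 then pauli_tensor 3 3 3 2
      else 0)"

text \<open>The Clifford relations, checked factor by factor.\<close>

definition pauli_mult :: "nat \<Rightarrow> nat \<Rightarrow> bool \<Rightarrow> bool \<Rightarrow> complex" where
  "pauli_mult p q a b = pauli p a False * pauli q False b + pauli p a True * pauli q True b"

lemma pauli_mult_simps:
  "pauli_mult 0 q = pauli q" "pauli_mult p 0 = pauli p"
  "pauli_mult 1 1 = pauli 0" "pauli_mult 2 2 = pauli 0" "pauli_mult 3 3 = pauli 0"
  "pauli_mult 2 1 a b = - pauli_mult 1 2 a b" "pauli_mult 3 1 a b = - pauli_mult 1 3 a b"
  "pauli_mult 3 2 a b = - pauli_mult 2 3 a b"
  by (auto simp: fun_eq_iff pauli_mult_def pauli_def)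

lemma sum_spin_index:
  fixes f :: "spin_index \<Rightarrow> complex"
  shows "sum f UNIV = (\<Sum>a\<in>UNIV. \<Sum>b\<in>UNIV. \<Sum>c\<in>UNIV. \<Sum>d\<in>UNIV. f (a, b, c, d))"
  by (simp add: UNIV_Times_UNIV[symmetric] sum.cartesian_product split_def del: UNIV_Times_UNIV)

lemma pauli_tensor_mult:
  "(pauli_tensor p0 p1 p2 p3 ** pauli_tensor q0 q1 q2 q3) $ (a0, a1, a2, a3) $ (b0, b1, b2, b3)
   = - (pauli_mult p0 q0 a0 b0 * pauli_mult p1 q1 a1 b1 * pauli_mult p2 q2 a2 b2 * pauli_mult p3 q3 a3 b3)"
  by (simp add: matrix_matrix_mult_def pauli_tensor_def sum_spin_index UNIV_bool pauli_mult_def algebra_simps)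

lemma mat_one_spin_index:
  "mat 1 $ (a0, a1, a2, a3) $ (b0, b1, b2, b3) = pauli 0 a0 b0 * pauli 0 a1 b1 * pauli 0 a2 b2 * pauli 0 a3 b3"
  by (auto simp: mat_def pauli_def)

lemma gamma_clifford:
  assumes "k \<in> {1..8}" "l \<in> {1..8}"
  shows "gamma k ** gamma l + gamma l ** gamma k = (if k = l then - 2 *\<^sub>R mat 1 else 0)"
proof -
  have "k = 1 \<or> k = 2 \<or> k = 3 \<or> k = 4 \<or> k = 5 \<or> k = 6 \<or> k = 7 \<or> k = 8"
       "l = 1 \<or> l = 2 \<or> l = 3 \<or> l = 4 \<or> l = 5 \<or> l = 6 \<or> l = 7 \<or> l = 8"
    using assms by auto
  then show ?thesis
    by (elim disjE; simp add: vec_eq_iff split_paired_all gamma_def pauli_tensor_mult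
          pauli_mult_simps pauli_mult_simps[unfolded One_nat_def] mat_one_spin_index scaleR_conv_of_real)
qed

text \<open>Clifford multiplication by the volume form \<open>dx\<^bsup>12345678\<^esup>\<close>.\<close>

definition volume_element :: "complex ^ spin_index ^ spin_index" where
  "volume_element = gamma 1 ** gamma 2 ** gamma 3 ** gamma 4 ** gamma 5 ** gamma 6 ** gamma 7 ** gamma 8"

text \<open>
  Under the identification of \<open>\<Lambda>\<^sup>2\<close> with \<open>spin(8)\<close>, the Lie algebra of \<open>Spin(7)\<close> is the
  21-dimensional eigenspace of \<open>\<star>(\<cdot> \<and> \<Phi>)\<close> with eigenvalue 1, acting on spinors by Clifford
  multiplication up to a constant factor. As \<open>Spin(7)\<close> is connected, its invariant spinors are
  those annihilated by its Lie algebra.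
\<close>

definition spin7_invariant :: "spinor \<Rightarrow> bool" where
  "spin7_invariant \<eta> \<longleftrightarrow>
     (\<forall>\<omega> :: real form. two_form \<omega> \<and> hodge (wedge \<omega> cayley_form) = \<omega> \<longrightarrow>
        (\<Sum>(k, l)\<in>{(k, l). k \<in> {1..8} \<and> l \<in> {1..8} \<and> k < l}.
           complex_of_real (\<omega> {k, l}) *s (gamma k *v (gamma l *v \<eta>))) = 0)"

text \<open>
  The volume element squares to 1, and its two eigenspaces are the chirality summands. The \<open>+\<close> summand is the eigenspace that contains the \<open>Spin(7)\<close>-invariant spinors.
\<close>

definition invariant_chirality :: complex where
  "invariant_chirality =
     (THE \<epsilon>. \<exists>\<eta>. \<eta> \<noteq> 0 \<and> spin7_invariant \<eta> \<and> volume_element *v \<eta> = \<epsilon> *s \<eta>)"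

definition S_plus :: "spinor set" where
  "S_plus = {\<eta>. volume_element *v \<eta> = invariant_chirality *s \<eta>}"

definition S_minus :: "spinor set" where
  "S_minus = {\<eta>. volume_element *v \<eta> = (- invariant_chirality) *s \<eta>}"


section \<open>Flat tori\<close>

definition full_lattice :: "(real ^ 8) set \<Rightarrow> bool" where
  "full_lattice L \<longleftrightarrow>
     (\<exists>B. independent B \<and> span B = UNIV \<and> L = {\<Sum>b\<in>B. of_int (n b) *\<^sub>R b | n :: real ^ 8 \<Rightarrow> int. True})"

text \<open>Points of \<open>\<real>\<^sup>8 / L\<close> are cosets, so that \<open>x \<in> p\<close> says that \<open>x\<close> is a lift of the point \<open>p\<close>.\<close>

type_synonym torus_point = "(real ^ 8) set"

definition torus_proj :: "(real ^ 8) set \<Rightarrow> real ^ 8 \<Rightarrow> torus_point" where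
  "torus_proj L x = (\<lambda>l. x + l) ` L"

definition torus :: "(real ^ 8) set \<Rightarrow> torus_point set" where
  "torus L = range (torus_proj L)"

definition torus_open :: "(real ^ 8) set \<Rightarrow> torus_point set \<Rightarrow> bool" where
  "torus_open L U \<longleftrightarrow> U \<subseteq> torus L \<and> open (torus_proj L -` U)"

text \<open>Continuous differentiability to order \<open>n\<close>, and smoothness, on an open set.\<close>

fun C_diff_on :: "nat \<Rightarrow> 'a::real_normed_vector set \<Rightarrow> ('a \<Rightarrow> 'b::real_normed_vector) \<Rightarrow> bool" where
  "C_diff_on 0 S f \<longleftrightarrow> continuous_on S f"
| "C_diff_on (Suc n) S f \<longleftrightarrow>
     (\<forall>x\<in>S. f differentiable (at x)) \<and> (\<forall>v. C_diff_on n S (\<lambda>x. frechet_derivative f (at x) v))"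

definition smooth_on :: "'a::real_normed_vector set \<Rightarrow> ('a \<Rightarrow> 'b::real_normed_vector) \<Rightarrow> bool" where
  "smooth_on S f \<longleftrightarrow> (\<forall>n. C_diff_on n S f)"

definition torus_smooth_on :: "(real ^ 8) set \<Rightarrow> torus_point set \<Rightarrow> (torus_point \<Rightarrow> complex) \<Rightarrow> bool" where
  "torus_smooth_on L U f \<longleftrightarrow> smooth_on (torus_proj L -` U) (f \<circ> torus_proj L)"

text \<open>
  The derivative along the \<open>k\<close>-th coordinate vector field of the torus; it does not depend on
  the lift of \<open>p\<close>, because \<open>f \<circ> torus_proj L\<close> is \<open>L\<close>-periodic.
\<close>

definition torus_deriv :: "(real ^ 8) set \<Rightarrow> nat \<Rightarrow> (torus_point \<Rightarrow> complex) \<Rightarrow> torus_point \<Rightarrow> complex" where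
  "torus_deriv L k f p =
     frechet_derivative (f \<circ> torus_proj L) (at (SOME x. x \<in> p)) (axis (of_nat k) 1)"


section \<open>Hermitian vector bundles with unitary connection\<close>

text \<open>
  Vectors of \<open>\<complex>\<^sup>r\<close> are functions vanishing from \<open>r\<close> on; of a matrix only the entries with both
  indices below \<open>r\<close> matter.
\<close>

type_synonym cvector = "nat \<Rightarrow> complex"
type_synonym cmatrix = "nat \<Rightarrow> nat \<Rightarrow> complex"

definition cspace :: "nat \<Rightarrow> cvector set" where
  "cspace r = {v. \<forall>i\<ge>r. v i = 0}"

definition mat_mult :: "nat \<Rightarrow> cmatrix \<Rightarrow> cmatrix \<Rightarrow> cmatrix" where
  "mat_mult r M N = (\<lambda>i j. \<Sum>m<r. M i m * N m j)"

definition unitary_matrix :: "nat \<Rightarrow> cmatrix \<Rightarrow> bool" where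
  "unitary_matrix r M \<longleftrightarrow>
     (\<forall>i<r. \<forall>j<r. (\<Sum>m<r. M i m * cnj (M j m)) = (if i = j then 1 else 0))"

text \<open>
  A Hermitian vector bundle of rank \<open>r\<close> is given by its total space, its projection and an atlas of local
  unitary trivialisations: a chart is a pair \<open>(U, \<phi>)\<close> such that \<open>\<phi>\<close> maps each fibre over \<open>U\<close>
  bijectively to \<open>\<complex>\<^sup>r\<close>, and transition functions are smooth and \<open>U(r)\<close>-valued. The vector
  space structure and the Hermitian metric of the fibres are those transported from \<open>\<complex>\<^sup>r\<close> by
  the charts, and the smooth structure is that defined by the charts.
\<close>

type_synonym 'e chart = "torus_point set \<times> ('e \<Rightarrow> cvector)"

record 'e vbundle =
  total_space :: "'e set"
  bundle_proj :: "'e \<Rightarrow> torus_point"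
  bundle_rank :: nat
  bundle_atlas :: "'e chart set"

definition fibre :: "'e vbundle \<Rightarrow> torus_point \<Rightarrow> 'e set" where
  "fibre E p = {e \<in> total_space E. bundle_proj E e = p}"

text \<open>The matrix \<open>g\<close> with \<open>\<phi>' = g \<cdot> \<phi>\<close> on the fibre over \<open>p\<close>, for charts \<open>(U, \<phi>)\<close> and \<open>(U', \<phi>')\<close>.\<close>

definition transition :: "'e vbundle \<Rightarrow> 'e chart \<Rightarrow> 'e chart \<Rightarrow> torus_point \<Rightarrow> cmatrix" where
  "transition E c c' p =
     (\<lambda>i j. snd c' (inv_into (fibre E p) (snd c) (\<lambda>m. if m = j then 1 else 0)) i)"

definition hermitian_bundle :: "(real ^ 8) set \<Rightarrow> 'e vbundle \<Rightarrow> bool" where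
  "hermitian_bundle L E \<longleftrightarrow>
     (\<forall>e\<in>total_space E. bundle_proj E e \<in> torus L) \<and>
     (\<forall>c\<in>bundle_atlas E. torus_open L (fst c) \<and>
        (\<forall>p\<in>fst c. bij_betw (snd c) (fibre E p) (cspace (bundle_rank E)))) \<and>
     torus L = (\<Union>c\<in>bundle_atlas E. fst c) \<and>
     (\<forall>c\<in>bundle_atlas E. \<forall>c'\<in>bundle_atlas E.
        (\<forall>p\<in>fst c \<inter> fst c'.
           unitary_matrix (bundle_rank E) (transition E c c' p) \<and>
           (\<forall>e\<in>fibre E p. \<forall>i<bundle_rank E.
              snd c' e i = (\<Sum>j<bundle_rank E. transition E c c' p i j * snd c e j))) \<and>
        (\<forall>i<bundle_rank E. \<forall>j<bundle_rank E.
           torus_smooth_on L (fst c \<inter> fst c') (\<lambda>p. transition E c c' p i j)))"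

text \<open>
  A connection assigns to each chart \<open>c\<close> its connection form \<open>\<Sum>k. A c k dx\<^sup>k\<close>, so that the
  covariant derivative in the chart is \<open>\<partial>\<^sub>k + A c k\<close>. It is unitary when the forms are
  skew-Hermitian. The last condition, \<open>\<partial>\<^sub>k g + A' g = g A\<close>, expresses that the local covariant
  derivatives agree on overlaps.
\<close>

type_synonym 'e connection = "'e chart \<Rightarrow> nat \<Rightarrow> torus_point \<Rightarrow> cmatrix"

definition unitary_connection :: "(real ^ 8) set \<Rightarrow> 'e vbundle \<Rightarrow> 'e connection \<Rightarrow> bool" where
  "unitary_connection L E A \<longleftrightarrow>
     (\<forall>c\<in>bundle_atlas E. \<forall>k\<in>{1..8}. \<forall>i<bundle_rank E. \<forall>j<bundle_rank E.
        torus_smooth_on L (fst c) (\<lambda>p. A c k p i j) \<and>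
        (\<forall>p\<in>fst c. A c k p i j = - cnj (A c k p j i))) \<and>
     (\<forall>c\<in>bundle_atlas E. \<forall>c'\<in>bundle_atlas E. \<forall>p\<in>fst c \<inter> fst c'.
        \<forall>k\<in>{1..8}. \<forall>i<bundle_rank E. \<forall>j<bundle_rank E.
          torus_deriv L k (\<lambda>q. transition E c c' q i j) p
            + mat_mult (bundle_rank E) (A c' k p) (transition E c c' p) i j
          = mat_mult (bundle_rank E) (transition E c c' p) (A c k p) i j)"

text \<open>The components \<open>F\<^sub>k\<^sub>l = \<partial>\<^sub>k A\<^sub>l - \<partial>\<^sub>l A\<^sub>k + [A\<^sub>k, A\<^sub>l]\<close> of the curvature in a chart.\<close>

definition curvature ::
    "(real ^ 8) set \<Rightarrow> 'e vbundle \<Rightarrow> 'e connection \<Rightarrow> 'e chart \<Rightarrow> torus_point \<Rightarrow> nat \<Rightarrow> nat \<Rightarrow> cmatrix" where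
  "curvature L E A c p k l =
     (\<lambda>i j. torus_deriv L k (\<lambda>q. A c l q i j) p - torus_deriv L l (\<lambda>q. A c k q i j) p
        + mat_mult (bundle_rank E) (A c k p) (A c l p) i j
        - mat_mult (bundle_rank E) (A c l p) (A c k p) i j)"

definition spin7_instanton :: "(real ^ 8) set \<Rightarrow> 'e vbundle \<Rightarrow> 'e connection \<Rightarrow> bool" where
  "spin7_instanton L E A \<longleftrightarrow>
     hermitian_bundle L E \<and> unitary_connection L E A \<and>
     (\<forall>c\<in>bundle_atlas E. \<forall>p\<in>fst c. \<forall>i<bundle_rank E. \<forall>j<bundle_rank E.
        let F = two_form_of (\<lambda>k l. curvature L E A c p k l i j)
        in hodge (wedge F cayley_form) = F)"


section \<open>The twisted Dirac operator\<close>

text \<open>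
  As the spinor bundle is trivial with the constant frame indexed by \<^typ>\<open>spin_index\<close>, a section
  of \<open>S \<otimes> E\<close> is a family \<open>\<psi>\<close> of 16 sections of \<open>E\<close>, and lies in \<open>S\<^sup>+ \<otimes> E\<close> iff each of its
  components with respect to a frame of \<open>E\<close> is in \<open>S\<^sup>+\<close>.
\<close>

type_synonym 'e spinor_field = "spin_index \<Rightarrow> torus_point \<Rightarrow> 'e"

definition spinor_sections :: "(real ^ 8) set \<Rightarrow> 'e vbundle \<Rightarrow> 'e spinor_field set" where
  "spinor_sections L E =
     {\<psi>. (\<forall>b. \<psi> b \<in> (\<Pi>\<^sub>E p\<in>torus L. fibre E p)) \<and>
          (\<forall>c\<in>bundle_atlas E. \<forall>b. \<forall>i<bundle_rank E.
             torus_smooth_on L (fst c) (\<lambda>p. snd c (\<psi> b p) i))}"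

definition spinor_sections_in ::
    "spinor set \<Rightarrow> (real ^ 8) set \<Rightarrow> 'e vbundle \<Rightarrow> 'e spinor_field set" where
  "spinor_sections_in W L E =
     {\<psi> \<in> spinor_sections L E. \<forall>c\<in>bundle_atlas E. \<forall>p\<in>fst c. \<forall>i<bundle_rank E.
        (\<chi> b. snd c (\<psi> b p) i) \<in> W}"

text \<open>The element of the fibre over \<open>p\<close> whose coordinate vector in each chart \<open>c\<close> around \<open>p\<close> is \<open>v c\<close>.\<close>

definition fibre_element :: "'e vbundle \<Rightarrow> torus_point \<Rightarrow> ('e chart \<Rightarrow> cvector) \<Rightarrow> 'e" where
  "fibre_element E p v =
     (THE e. e \<in> fibre E p \<and> (\<forall>c\<in>bundle_atlas E. p \<in> fst c \<longrightarrow> (\<forall>i<bundle_rank E. snd c e i = v c i)))"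

definition zero_spinor_field :: "(real ^ 8) set \<Rightarrow> 'e vbundle \<Rightarrow> 'e spinor_field" where
  "zero_spinor_field L E = (\<lambda>b. \<lambda>p\<in>torus L. fibre_element E p (\<lambda>c i. 0))"

text \<open>The coordinate expression, in a chart of \<open>E\<close>, of the covariant derivative \<open>\<nabla>\<^sub>k \<psi>\<close>.\<close>

definition local_covariant_deriv ::
    "(real ^ 8) set \<Rightarrow> 'e vbundle \<Rightarrow> 'e connection \<Rightarrow> 'e chart \<Rightarrow> nat \<Rightarrow> 'e spinor_field
       \<Rightarrow> spin_index \<Rightarrow> torus_point \<Rightarrow> cvector" where
  "local_covariant_deriv L E A c k \<psi> b p =
     (\<lambda>i. torus_deriv L k (\<lambda>q. snd c (\<psi> b q) i) p
        + (\<Sum>j<bundle_rank E. A c k p i j * snd c (\<psi> b p) j))"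

text \<open>\<open>D \<psi> = \<Sum>k. e\<^sub>k \<cdot> \<nabla>\<^sub>k \<psi>\<close>\<close>

definition dirac ::
    "(real ^ 8) set \<Rightarrow> 'e vbundle \<Rightarrow> 'e connection \<Rightarrow> 'e spinor_field \<Rightarrow> 'e spinor_field" where
  "dirac L E A \<psi> =
     (\<lambda>b. \<lambda>p\<in>torus L. fibre_element E p
        (\<lambda>c i. \<Sum>k=1..8. \<Sum>d\<in>UNIV. gamma k $ b $ d * local_covariant_deriv L E A c k \<psi> d p i))"

definition dirac_kernel :: "(real ^ 8) set \<Rightarrow> 'e vbundle \<Rightarrow> 'e connection \<Rightarrow> 'e spinor_field set" where
  "dirac_kernel L E A = {\<psi> \<in> spinor_sections L E. dirac L E A \<psi> = zero_spinor_field L E}"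

text \<open>
  A type large enough to carry the total space of any Hermitian vector bundle over a torus, up
  to isomorphism.
\<close>

type_synonym total_point = "torus_point \<times> cvector"

end

theory Submission
  imports Defs "HOL-Complex_Analysis.Cauchy_Integral_Formula"
begin

text \<open>
  Take a line bundle over \<open>\<real>\<^sup>8 / \<int>\<^sup>8\<close> with constant curvature
  \<open>2\<pi>\<i> (d\<^sub>0 dx\<^sup>1\<^sup>2 + d\<^sub>1 dx\<^sup>3\<^sup>4 + d\<^sub>2 dx\<^sup>5\<^sup>6 + d\<^sub>3 dx\<^sup>7\<^sup>8)\<close>. It is an instanton iff
  \<open>d\<^sub>0 + d\<^sub>3 = d\<^sub>1 + d\<^sub>2\<close>. The square of the Dirac operator is diagonal in the standard basis of the
  spinor module: on the component with signs \<open>s\<^sub>j = \<plusminus>1\<close> it is the connection Laplacian shifted by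
  \<open>2\<pi> \<Sum>j. s\<^sub>j d\<^sub>j\<close>. The lowest eigenvalue of the Laplacian is \<open>2\<pi> \<Sum>j. \<bar>d\<^sub>j\<bar>\<close>, so only the component
  with \<open>s\<^sub>j = - sgn d\<^sub>j\<close> for all \<open>j\<close> can be non-zero in the kernel, and its chirality is the sign of
  \<open>d\<^sub>0 d\<^sub>1 d\<^sub>2 d\<^sub>3\<close>; a product of theta functions shows that it does occur. The bundles with
  \<open>d = (1, 1, 1, 1)\<close> and \<open>d = (3, 1, 1, -1)\<close> give the two signs.
  The eigenvalue bound needs no integration: an eigenfunction with negative eigenvalue vanishes by
  the maximum principle for its norm, and the ladder operators of the harmonic oscillator
  reduce the other eigenvalues to this case.
\<close>

subsection \<open>Smooth functions\<close>

text \<open>All the analysis takes place on \<open>\<real>^8\<close>: a section is a smooth function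
  with the transformation law of \<open>lsections\<close>, and the bundle given by charts repackages
  such functions. The transformation factors have modulus 1, so norms are periodic and attain their
  maxima; this is what lets a pointwise maximum principle replace integration by parts.

  The connection is written in Landau gauge, with the potential 2 pi i d_j x_(2j+1) dx^(2j+2) summed
  over j. The four coordinate planes then decouple into four Landau level problems, whose ground
  states are lattice superpositions of Gaussians in x_(2j+1), that is, theta functions.

  Every d_j has to be non-zero: in a plane with d_j = 0 both signs s_j have the same energy, so the
  kernel would not have a single chirality. The instanton condition says that d is orthogonal to (1,
  -1, -1, 1), which up to sign is the sign vector of the basis spinors that make up the invariant
  spinor.\<close>

lemma C_diff_on_Suc_imp: "C_diff_on (Suc n) S f \<Longrightarrow> C_diff_on n S f"
proof (induction n arbitrary: f)
  case 0
  then show ?case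
    by (auto intro!: differentiable_imp_continuous_on
        simp: differentiable_on_def differentiable_at_withinI)
next
  case (Suc n)
  then show ?case by (metis C_diff_on.simps(2))
qed

text \<open>\<open>frechet_derivative\<close> is a choice among all derivatives at the point.
  Functions that agree nearby have the same derivatives, so the choices coincide even where there is
  none.\<close>

lemma frechet_derivative_cong_open:
  assumes "open S" "x \<in> S" "\<And>y. y \<in> S \<Longrightarrow> f y = g y"
  shows "frechet_derivative f (at x) = frechet_derivative g (at x)"
proof -
  have "(f has_derivative D) (at x) \<longleftrightarrow> (g has_derivative D) (at x)" for D
    using assms by (metis has_derivative_transform_within_open)
  then show ?thesis by (simp add: frechet_derivative_def)
qed

lemma C_diff_on_cong:
  assumes "open S" "\<And>x. x \<in> S \<Longrightarrow> f x = g x"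
  shows "C_diff_on n S f \<longleftrightarrow> C_diff_on n S g"
  using assms(2)
proof (induction n arbitrary: f g)
  case 0
  then show ?case by (simp cong: continuous_on_cong)
next
  case (Suc n)
  have "f differentiable at x \<longleftrightarrow> g differentiable at x" if "x \<in> S" for x
    using Suc.prems that assms(1) unfolding differentiable_def
    by (metis has_derivative_transform_within_open)
  moreover have "C_diff_on n S (\<lambda>x. frechet_derivative f (at x) v)
      \<longleftrightarrow> C_diff_on n S (\<lambda>x. frechet_derivative g (at x) v)" for v
    by (rule Suc.IH) (metis Suc.prems assms(1) frechet_derivative_cong_open)
  ultimately show ?case by simp
qed

lemma C_diff_on_subset: "C_diff_on n S f \<Longrightarrow> T \<subseteq> S \<Longrightarrow> C_diff_on n T f"
proof (induction n arbitrary: f)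
  case 0
  then show ?case by (auto intro: continuous_on_subset)
next
  case (Suc n)
  then show ?case by (simp add: subset_eq)
qed

text \<open>Derivatives are taken in full neighbourhoods rather than within \<open>S\<close>, so
  only the continuity of the base case has to be glued.\<close>

lemma C_diff_on_local:
  assumes "\<And>x. x \<in> S \<Longrightarrow> \<exists>N. open N \<and> x \<in> N \<and> C_diff_on n N f"
  shows "C_diff_on n S f"
  using assms
proof (induction n arbitrary: f)
  case 0
  have "continuous (at x) f" if "x \<in> S" for x
    using 0[OF that] by (auto simp: continuous_on_eq_continuous_at)
  then show ?case by (simp add: continuous_at_imp_continuous_on)
next
  case (Suc n)
  have "f differentiable at x" if "x \<in> S" for x using Suc.prems[OF that] by auto
  moreover have "C_diff_on n S (\<lambda>x. frechet_derivative f (at x) v)" for v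
    by (rule Suc.IH) (use Suc.prems in fastforce)
  ultimately show ?case by simp
qed

lemma smooth_on_local:
  assumes "\<And>x. x \<in> S \<Longrightarrow> \<exists>N. open N \<and> x \<in> N \<and> smooth_on N f"
  shows "smooth_on S f"
  using assms unfolding smooth_on_def by (meson C_diff_on_local)

lemma smooth_on_cong:
  assumes "open S" "\<And>x. x \<in> S \<Longrightarrow> f x = g x"
  shows "smooth_on S f \<longleftrightarrow> smooth_on S g"
  unfolding smooth_on_def by (simp add: C_diff_on_cong[OF assms])

lemma smooth_on_subset: "smooth_on S f \<Longrightarrow> T \<subseteq> S \<Longrightarrow> smooth_on T f"
  unfolding smooth_on_def by (meson C_diff_on_subset)

lemma C_diff_on_const: "C_diff_on n S (\<lambda>x. c)"
  by (induction n arbitrary: c) auto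

lemma C_diff_on_add:
  assumes "open S" "C_diff_on n S f" "C_diff_on n S g"
  shows "C_diff_on n S (\<lambda>x. f x + g x)"
  using assms(2,3)
proof (induction n arbitrary: f g)
  case 0
  then show ?case by (simp add: continuous_on_add)
next
  case (Suc n)
  have *: "((\<lambda>x. f x + g x) has_derivative
       (\<lambda>v. frechet_derivative f (at x) v + frechet_derivative g (at x) v)) (at x)"
    if "x \<in> S" for x
    using Suc.prems that by (intro has_derivative_add) (auto simp: frechet_derivative_works)
  have "frechet_derivative (\<lambda>x. f x + g x) (at x) v
      = frechet_derivative f (at x) v + frechet_derivative g (at x) v" if "x \<in> S" for x v
    using fun_cong[OF frechet_derivative_at[OF *[OF that]], of v] by simp
  then have "C_diff_on n S (\<lambda>x. frechet_derivative (\<lambda>x. f x + g x) (at x) v)" for v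
    using C_diff_on_cong[OF assms(1), of "\<lambda>x. frechet_derivative (\<lambda>x. f x + g x) (at x) v"
        "\<lambda>x. frechet_derivative f (at x) v + frechet_derivative g (at x) v" n]
      Suc by simp
  then show ?case using Suc.prems by (simp add: differentiable_add)
qed

lemma C_diff_on_mult:
  fixes f g :: "'a::real_normed_vector \<Rightarrow> 'b::real_normed_algebra"
  assumes "open S" "C_diff_on n S f" "C_diff_on n S g"
  shows "C_diff_on n S (\<lambda>x. f x * g x)"
  using assms(2,3)
proof (induction n arbitrary: f g)
  case 0
  then show ?case by (simp add: continuous_on_mult)
next
  case (Suc n)
  have *: "((\<lambda>x. f x * g x) has_derivative
       (\<lambda>v. f x * frechet_derivative g (at x) v + frechet_derivative f (at x) v * g x)) (at x)"
    if "x \<in> S" for x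
    using Suc.prems that by (intro has_derivative_mult) (auto simp: frechet_derivative_works)
  have "frechet_derivative (\<lambda>x. f x * g x) (at x) v
      = f x * frechet_derivative g (at x) v + frechet_derivative f (at x) v * g x" if "x \<in> S" for x v
    using fun_cong[OF frechet_derivative_at[OF *[OF that]], of v] by simp
  \<comment> \<open>The product rule pairs an undifferentiated factor with a derivative, so the
    former must be lowered from order \<open>Suc n\<close> to \<open>n\<close>.\<close>
  moreover have "C_diff_on n S (\<lambda>x. f x * frechet_derivative g (at x) v
      + frechet_derivative f (at x) v * g x)" for v
    by (intro C_diff_on_add assms Suc.IH Suc.prems[THEN C_diff_on_Suc_imp]) (use Suc.prems in auto)
  ultimately have "C_diff_on n S (\<lambda>x. frechet_derivative (\<lambda>x. f x * g x) (at x) v)" for v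
    using C_diff_on_cong[OF assms(1), of "\<lambda>x. frechet_derivative (\<lambda>x. f x * g x) (at x) v"
        "\<lambda>x. f x * frechet_derivative g (at x) v + frechet_derivative f (at x) v * g x" n] by simp
  then show ?case using * by (auto simp: differentiable_def)
qed

lemma frechet_derivative_translate:
  "frechet_derivative (\<lambda>x. f (x + l)) (at x) = frechet_derivative f (at (x + l))"
proof -
  have "((\<lambda>x. f (x + l)) has_derivative D) (at x) \<longleftrightarrow> (f has_derivative D) (at (x + l))" for D
  proof
    assume "((\<lambda>x. f (x + l)) has_derivative D) (at x)"
    then have "((\<lambda>x. f (x + l)) has_derivative D) (at (x + l - l))" by simp
    moreover have "((\<lambda>y. y - l) has_derivative (\<lambda>v. v)) (at (x + l))"
      by (auto intro!: derivative_eq_intros)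
    ultimately show "(f has_derivative D) (at (x + l))"
      using has_derivative_compose[where f = "\<lambda>y. y - l" and g = "\<lambda>x. f (x + l)" and x = "x + l"] by simp
  next
    assume 1: "(f has_derivative D) (at (x + l))"
    have 2: "((\<lambda>y. y + l) has_derivative (\<lambda>v. v)) (at x)"
      by (auto intro!: derivative_eq_intros)
    show "((\<lambda>x. f (x + l)) has_derivative D) (at x)"
      using has_derivative_compose[OF 2 1] by simp
  qed
  then show ?thesis by (simp add: frechet_derivative_def)
qed

lemma C_diff_on_translate:
  assumes "C_diff_on n S f" "\<And>x. x \<in> T \<Longrightarrow> x + l \<in> S"
  shows "C_diff_on n T (\<lambda>x. f (x + l))"
  using assms(1)
proof (induction n arbitrary: f)
  case 0
  then show ?case
    using assms(2) by (auto intro!: continuous_on_compose2[of S f] continuous_intros)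
next
  case (Suc n)
  have "(\<lambda>x. f (x + l)) differentiable at x" if "x \<in> T" for x
    using Suc.prems assms(2)[OF that] differentiable_chain_at[of "\<lambda>x. x + l" x f]
    by (auto simp: o_def)
  moreover have "C_diff_on n T (\<lambda>x. frechet_derivative (\<lambda>x. f (x + l)) (at x) v)" for v
    unfolding frechet_derivative_translate
    by (rule Suc.IH[of "\<lambda>x. frechet_derivative f (at x) v"]) (use Suc.prems in auto)
  ultimately show ?case by simp
qed

lemma C_diff_on_linear:
  assumes "bounded_linear l"
  shows "C_diff_on n S l"
proof (cases n)
  case 0
  then show ?thesis using assms by (simp add: linear_continuous_on)
next
  case (Suc m)
  have "frechet_derivative l (at x) = l" for x
    using frechet_derivative_at[OF bounded_linear_imp_has_derivative[OF assms]] by simp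
  then show ?thesis using Suc assms
    by (simp add: C_diff_on_const bounded_linear_imp_differentiable)
qed

text \<open>Covers exponentials, Gaussians and theta functions at once. The derivative along
  \<open>v\<close> is \<open>deriv h\<close> at \<open>l x\<close> times the constant
  \<open>l v\<close>, and \<open>deriv h\<close> is again entire, so the induction closes when
  \<open>h\<close> is arbitrary.\<close>

lemma C_diff_on_entire:
  fixes l :: "'a::real_normed_vector \<Rightarrow> complex"
  assumes "open S" "bounded_linear l" "h holomorphic_on UNIV"
  shows "C_diff_on n S (\<lambda>x. h (l x))"
  using assms(3)
proof (induction n arbitrary: h)
  case 0
  have "continuous_on S (\<lambda>x. h (l x))"
    by (rule continuous_on_compose2[of UNIV h])
      (auto intro: linear_continuous_on assms holomorphic_on_imp_continuous_on 0)
  then show ?case by simp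
next
  case (Suc n)
  have *: "((\<lambda>x. h (l x)) has_derivative (\<lambda>v. deriv h (l x) * l v)) (at x)" for x
  proof -
    have "(h has_field_derivative deriv h (l x)) (at (l x))"
      using Suc.prems holomorphic_derivI by blast
    then show ?thesis using assms(2)
      by (metis bounded_linear_imp_has_derivative has_derivative_compose has_field_derivative_def)
  qed
  have "frechet_derivative (\<lambda>x. h (l x)) (at x) = (\<lambda>v. deriv h (l x) * l v)" for x
    using frechet_derivative_at[OF *] by simp
  moreover have "C_diff_on n S (\<lambda>x. deriv h (l x) * l v)" for v
    using Suc.prems holomorphic_deriv[of h UNIV]
    by (intro C_diff_on_mult assms Suc.IH C_diff_on_const) auto
  ultimately show ?case using * by (auto simp: differentiable_def)
qed

lemma smooth_on_const: "smooth_on S (\<lambda>x. c)"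
  by (simp add: smooth_on_def C_diff_on_const)

lemma smooth_on_add: "open S \<Longrightarrow> smooth_on S f \<Longrightarrow> smooth_on S g \<Longrightarrow> smooth_on S (\<lambda>x. f x + g x)"
  by (simp add: smooth_on_def C_diff_on_add)

lemma smooth_on_mult:
  fixes f g :: "'a::real_normed_vector \<Rightarrow> 'b::real_normed_algebra"
  shows "open S \<Longrightarrow> smooth_on S f \<Longrightarrow> smooth_on S g \<Longrightarrow> smooth_on S (\<lambda>x. f x * g x)"
  by (simp add: smooth_on_def C_diff_on_mult)

lemma smooth_on_prod:
  fixes f :: "'i \<Rightarrow> 'a::real_normed_vector \<Rightarrow> 'b::real_normed_field"
  assumes "open S" "\<And>i. i \<in> I \<Longrightarrow> smooth_on S (f i)"
  shows "smooth_on S (\<lambda>x. \<Prod>i\<in>I. f i x)"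
  using assms(2) by (induction I rule: infinite_finite_induct) (simp_all add: smooth_on_const smooth_on_mult assms)

lemma smooth_on_sum:
  assumes "open S" "\<And>i. i \<in> I \<Longrightarrow> smooth_on S (f i)"
  shows "smooth_on S (\<lambda>x. \<Sum>i\<in>I. f i x)"
  using assms(2) by (induction I rule: infinite_finite_induct) (simp_all add: smooth_on_const smooth_on_add assms)

lemma smooth_on_translate:
  "smooth_on S f \<Longrightarrow> (\<And>x. x \<in> T \<Longrightarrow> x + l \<in> S) \<Longrightarrow> smooth_on T (\<lambda>x. f (x + l))"
  unfolding smooth_on_def by (blast intro: C_diff_on_translate)

lemma smooth_on_linear: "bounded_linear l \<Longrightarrow> smooth_on S l"
  by (simp add: smooth_on_def C_diff_on_linear)

lemma smooth_on_entire:
  "open S \<Longrightarrow> bounded_linear l \<Longrightarrow> h holomorphic_on UNIV \<Longrightarrow> smooth_on S (\<lambda>x. h (l x))"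
  by (simp add: smooth_on_def C_diff_on_entire)

lemma smooth_on_derivative: "smooth_on S f \<Longrightarrow> smooth_on S (\<lambda>x. frechet_derivative f (at x) v)"
  unfolding smooth_on_def by (metis C_diff_on.simps(2))

lemma smooth_on_differentiable: "smooth_on S f \<Longrightarrow> x \<in> S \<Longrightarrow> f differentiable at x"
  unfolding smooth_on_def by (metis C_diff_on.simps(2))

lemma smooth_on_continuous: "smooth_on S f \<Longrightarrow> continuous_on S f"
  unfolding smooth_on_def by (metis C_diff_on.simps(1))

subsection \<open>Symmetry of the second derivative\<close>

text \<open>Two applications of the mean value theorem: along \<open>u\<close> to the increment of
  \<open>f\<close> across \<open>h *\<^sub>R v\<close>, then along \<open>v\<close> to
  \<open>fu\<close>.\<close>

lemma second_difference_mvt: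
  fixes f :: "'a::real_normed_vector \<Rightarrow> real"
  assumes fu: "\<And>x t. ((\<lambda>t. f (x + t *\<^sub>R u)) has_real_derivative fu (x + t *\<^sub>R u)) (at t)"
    and fuv: "\<And>x t. ((\<lambda>t. fu (x + t *\<^sub>R v)) has_real_derivative fuv (x + t *\<^sub>R v)) (at t)"
    and "h > 0"
  shows "\<exists>p q. 0 < p \<and> p < h \<and> 0 < q \<and> q < h \<and>
    f (x + h *\<^sub>R u + h *\<^sub>R v) - f (x + h *\<^sub>R u) - f (x + h *\<^sub>R v) + f x
      = h * h * fuv (x + p *\<^sub>R u + q *\<^sub>R v)"
proof -
  have "\<exists>p>0. p < h \<and> (f (x + h *\<^sub>R v + h *\<^sub>R u) - f (x + h *\<^sub>R u)) - (f (x + h *\<^sub>R v + 0 *\<^sub>R u) - f (x + 0 *\<^sub>R u))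
     = (h - 0) * (fu (x + h *\<^sub>R v + p *\<^sub>R u) - fu (x + p *\<^sub>R u))"
    by (rule MVT2[where f = "\<lambda>s. f (x + h *\<^sub>R v + s *\<^sub>R u) - f (x + s *\<^sub>R u)"
          and f' = "\<lambda>s. fu (x + h *\<^sub>R v + s *\<^sub>R u) - fu (x + s *\<^sub>R u)"])
      (use \<open>h > 0\<close> in \<open>auto intro!: DERIV_diff fu\<close>)
  then obtain p where p: "0 < p" "p < h"
     "(f (x + h *\<^sub>R v + h *\<^sub>R u) - f (x + h *\<^sub>R u)) - (f (x + h *\<^sub>R v) - f x)
     = h * (fu (x + h *\<^sub>R v + p *\<^sub>R u) - fu (x + p *\<^sub>R u))" by auto
  have "\<exists>q>0. q < h \<and> fu (x + p *\<^sub>R u + h *\<^sub>R v) - fu (x + p *\<^sub>R u + 0 *\<^sub>R v)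
     = (h - 0) * fuv (x + p *\<^sub>R u + q *\<^sub>R v)"
    by (rule MVT2[where f = "\<lambda>s. fu (x + p *\<^sub>R u + s *\<^sub>R v)" and f' = "\<lambda>s. fuv (x + p *\<^sub>R u + s *\<^sub>R v)"])
      (use \<open>h > 0\<close> in \<open>auto intro!: fuv\<close>)
  then obtain q where "0 < q" "q < h" "fu (x + p *\<^sub>R u + h *\<^sub>R v) - fu (x + p *\<^sub>R u)
     = h * fuv (x + p *\<^sub>R u + q *\<^sub>R v)" by auto
  with p show ?thesis
    by (intro exI[of _ p] exI[of _ q]) (simp add: algebra_simps)
qed

text \<open>The second difference is symmetric in \<open>u\<close> and \<open>v\<close>, so both
  mixed derivatives share a value at points which tend to \<open>x\<close> with the size of the
  parallelogram.\<close>

lemma mixed_partials_real: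
  fixes f :: "'a::real_normed_vector \<Rightarrow> real"
  assumes fu: "\<And>x t. ((\<lambda>t. f (x + t *\<^sub>R u)) has_real_derivative fu (x + t *\<^sub>R u)) (at t)"
    and fv: "\<And>x t. ((\<lambda>t. f (x + t *\<^sub>R v)) has_real_derivative fv (x + t *\<^sub>R v)) (at t)"
    and fuv: "\<And>x t. ((\<lambda>t. fu (x + t *\<^sub>R v)) has_real_derivative fuv (x + t *\<^sub>R v)) (at t)"
    and fvu: "\<And>x t. ((\<lambda>t. fv (x + t *\<^sub>R u)) has_real_derivative fvu (x + t *\<^sub>R u)) (at t)"
    and cont: "isCont fuv x" "isCont fvu x"
  shows "fuv x = fvu x"
proof -
  define h where "h n = inverse (real (Suc n))" for n
  have h: "h n > 0" "h \<longlonglongrightarrow> 0" for n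
    by (auto simp: h_def[abs_def] LIMSEQ_inverse_real_of_nat simp del: of_nat_Suc)
  have "\<forall>n. \<exists>p q p' q'. 0 < p \<and> p < h n \<and> 0 < q \<and> q < h n \<and> 0 < p' \<and> p' < h n \<and> 0 < q' \<and> q' < h n \<and>
      fuv (x + p *\<^sub>R u + q *\<^sub>R v) = fvu (x + p' *\<^sub>R v + q' *\<^sub>R u)"
  proof
    fix n
    obtain p q where 1: "0 < p" "p < h n" "0 < q" "q < h n"
      "f (x + h n *\<^sub>R u + h n *\<^sub>R v) - f (x + h n *\<^sub>R u) - f (x + h n *\<^sub>R v) + f x
        = h n * h n * fuv (x + p *\<^sub>R u + q *\<^sub>R v)"
      using second_difference_mvt[where f=f, OF fu fuv h(1)] by blast
    obtain p' q' where 2: "0 < p'" "p' < h n" "0 < q'" "q' < h n"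
      "f (x + h n *\<^sub>R v + h n *\<^sub>R u) - f (x + h n *\<^sub>R v) - f (x + h n *\<^sub>R u) + f x
        = h n * h n * fvu (x + p' *\<^sub>R v + q' *\<^sub>R u)"
      using second_difference_mvt[where f=f, OF fv fvu h(1)] by blast
    have "h n * h n * fuv (x + p *\<^sub>R u + q *\<^sub>R v) = h n * h n * fvu (x + p' *\<^sub>R v + q' *\<^sub>R u)"
      using 1(5) 2(5) by (simp add: algebra_simps)
    then have "fuv (x + p *\<^sub>R u + q *\<^sub>R v) = fvu (x + p' *\<^sub>R v + q' *\<^sub>R u)"
      using h(1)[of n] by simp
    then show "\<exists>p q p' q'. 0 < p \<and> p < h n \<and> 0 < q \<and> q < h n \<and> 0 < p' \<and> p' < h n \<and> 0 < q' \<and> q' < h n \<and>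
      fuv (x + p *\<^sub>R u + q *\<^sub>R v) = fvu (x + p' *\<^sub>R v + q' *\<^sub>R u)" using 1 2 by blast
  qed
  then obtain p q p' q' where *: "\<And>n. 0 < p n \<and> p n < h n" "\<And>n. 0 < q n \<and> q n < h n"
     "\<And>n. 0 < p' n \<and> p' n < h n" "\<And>n. 0 < q' n \<and> q' n < h n"
     "\<And>n. fuv (x + p n *\<^sub>R u + q n *\<^sub>R v) = fvu (x + p' n *\<^sub>R v + q' n *\<^sub>R u)"
    by metis
  have lim: "r \<longlonglongrightarrow> 0" if "\<And>n. 0 < r n \<and> r n < h n" for r
    by (rule tendsto_sandwich[OF _ _ tendsto_const h(2)])
      (simp_all add: that less_imp_le eventually_sequentially)
  have "(\<lambda>n. x + p n *\<^sub>R u + q n *\<^sub>R v) \<longlonglongrightarrow> x + 0 *\<^sub>R u + 0 *\<^sub>R v"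
    "(\<lambda>n. x + p' n *\<^sub>R v + q' n *\<^sub>R u) \<longlonglongrightarrow> x + 0 *\<^sub>R v + 0 *\<^sub>R u"
    by (intro tendsto_intros lim *)+
  then have "(\<lambda>n. fuv (x + p n *\<^sub>R u + q n *\<^sub>R v)) \<longlonglongrightarrow> fuv x"
    "(\<lambda>n. fvu (x + p' n *\<^sub>R v + q' n *\<^sub>R u)) \<longlonglongrightarrow> fvu x"
    using cont by (auto intro: isCont_tendsto_compose)
  then show ?thesis using *(5) LIMSEQ_unique by auto
qed

lemma has_vector_derivative_along:
  assumes "f differentiable at (x + t *\<^sub>R u)"
  shows "((\<lambda>t. f (x + t *\<^sub>R u)) has_vector_derivative frechet_derivative f (at (x + t *\<^sub>R u)) u) (at t)"
proof -
  have "(f has_derivative frechet_derivative f (at (x + t *\<^sub>R u))) (at (x + t *\<^sub>R u))"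
    using assms by (simp add: frechet_derivative_works)
  moreover have "((\<lambda>t. x + t *\<^sub>R u) has_derivative (\<lambda>s. s *\<^sub>R u)) (at t)"
    by (auto intro!: derivative_eq_intros)
  ultimately have "((\<lambda>t. f (x + t *\<^sub>R u)) has_derivative
      (\<lambda>s. frechet_derivative f (at (x + t *\<^sub>R u)) (s *\<^sub>R u))) (at t)"
    by (rule has_derivative_compose[rotated])
  then show ?thesis
    using assms by (simp add: has_vector_derivative_def linear_frechet_derivative linear_cmul)
qed

lemma smooth_mixed_partials:
  fixes f :: "'a::real_normed_vector \<Rightarrow> complex"
  assumes "smooth_on UNIV f"
  shows "frechet_derivative (\<lambda>x. frechet_derivative f (at x) u) (at x) v
    = frechet_derivative (\<lambda>x. frechet_derivative f (at x) v) (at x) u"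
proof -
  note d = has_vector_derivative_along[OF smooth_on_differentiable[OF _ UNIV_I]]
  let ?fu = "\<lambda>x. frechet_derivative f (at x) u"
  let ?fv = "\<lambda>x. frechet_derivative f (at x) v"
  have s: "smooth_on UNIV ?fu" "smooth_on UNIV ?fv"
    using assms by (auto intro: smooth_on_derivative)
  have c: "isCont (\<lambda>x. frechet_derivative ?fu (at x) v) x" "isCont (\<lambda>x. frechet_derivative ?fv (at x) u) x"
    using smooth_on_continuous[OF smooth_on_derivative[OF s(1)]]
      smooth_on_continuous[OF smooth_on_derivative[OF s(2)]] by (auto simp: continuous_on_eq_continuous_at)
  \<comment> \<open>The mean value theorem is a real statement, so the equality is tested under real
    functionals, later \<open>Re\<close> and \<open>Im\<close>.\<close>
  have *: "p (frechet_derivative ?fu (at x) v) = p (frechet_derivative ?fv (at x) u)"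
    if p: "bounded_linear p" for p :: "complex \<Rightarrow> real"
  proof (rule mixed_partials_real[where f = "\<lambda>x. p (f x)" and fu = "\<lambda>x. p (?fu x)" and fv = "\<lambda>x. p (?fv x)"
        and fuv = "\<lambda>x. p (frechet_derivative ?fu (at x) v)" and fvu = "\<lambda>x. p (frechet_derivative ?fv (at x) u)"
        and u=u and v=v])
    show "isCont (\<lambda>x. p (frechet_derivative ?fu (at x) v)) x" "isCont (\<lambda>x. p (frechet_derivative ?fv (at x) u)) x"
      using c by (auto intro: bounded_linear.isCont[OF p])
    have d: "((\<lambda>t. p (g (y + t *\<^sub>R w))) has_real_derivative p (frechet_derivative g (at (y + t *\<^sub>R w)) w)) (at t)"
      if "smooth_on UNIV g" for g :: "'a \<Rightarrow> complex" and y w t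
      unfolding has_real_derivative_iff_has_vector_derivative
      by (rule bounded_linear.has_vector_derivative[OF p d[OF that]])
    fix y t
    show "((\<lambda>t. p (f (y + t *\<^sub>R u))) has_real_derivative p (?fu (y + t *\<^sub>R u))) (at t)"
      "((\<lambda>t. p (f (y + t *\<^sub>R v))) has_real_derivative p (?fv (y + t *\<^sub>R v))) (at t)"
      "((\<lambda>t. p (?fu (y + t *\<^sub>R v))) has_real_derivative p (frechet_derivative ?fu (at (y + t *\<^sub>R v)) v)) (at t)"
      "((\<lambda>t. p (?fv (y + t *\<^sub>R u))) has_real_derivative p (frechet_derivative ?fv (at (y + t *\<^sub>R u)) u)) (at t)"
      using d assms s by blast+
  qed
  show ?thesis
    using *[OF bounded_linear_Re] *[OF bounded_linear_Im] by (simp add: complex_eq_iff)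
qed

subsection \<open>The Cayley form\<close>

lemma atLeastAtMost_1_8: "{1..8::nat} = {1, 2, 3, 4, 5, 6, 7, 8}"
  by auto

text \<open>Turns the count of inversions into a product that simplification can evaluate on
  explicit finite sets.\<close>

lemma shuffle_sign_prod:
  assumes "finite I" "finite J"
  shows "shuffle_sign I J = (\<Prod>i\<in>I. \<Prod>j\<in>J. if j < i then - 1 else (1::'a::comm_ring_1))"
proof -
  have "(\<Prod>i\<in>I. \<Prod>j\<in>J. if j < i then - 1 else (1::'a)) = (\<Prod>(i, j)\<in>I \<times> J. if j < i then - 1 else 1)"
    using assms by (simp add: prod.cartesian_product)
  also have "\<dots> = (\<Prod>(i, j)\<in>{(i, j). i \<in> I \<and> j \<in> J \<and> j < i}. - 1)"
    using assms by (intro prod.mono_neutral_cong_right) (auto split: if_splits)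
  also have "\<dots> = shuffle_sign I J" by (simp add: shuffle_sign_def split_def)
  finally show ?thesis by simp
qed

text \<open>Only the subset \<open>K - I\<close> of \<open>K\<close> has complement
  \<open>I\<close>, so the sum over the power set collapses to a single term.\<close>

lemma wedge_dx:
  assumes "finite K"
  shows "wedge \<omega> (dx I) K = (if I \<subseteq> K then shuffle_sign (K - I) I * \<omega> (K - I) else 0)"
proof (cases "I \<subseteq> K")
  case True
  then have eq: "K - I' = I \<longleftrightarrow> I' = K - I" if "I' \<subseteq> K" for I'
    using that by blast
  have "wedge \<omega> (dx I) K = (\<Sum>I'\<in>Pow K. if I' = K - I then shuffle_sign (K - I) I * \<omega> (K - I) else 0)"
    unfolding wedge_def dx_def using eq True by (intro sum.cong) (auto simp: double_diff)
  then show ?thesis using assms True by (simp add: sum.delta)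
next
  case False
  then have "K - I' \<noteq> I" for I' by blast
  then show ?thesis using False by (simp add: wedge_def dx_def)
qed

lemma wedge_cayley_form:
  "wedge \<omega> cayley_form K =
     wedge \<omega> (dx {1,2,3,4}) K + wedge \<omega> (dx {1,2,5,6}) K - wedge \<omega> (dx {1,2,7,8}) K
     + wedge \<omega> (dx {1,3,5,7}) K + wedge \<omega> (dx {1,3,6,8}) K + wedge \<omega> (dx {1,4,5,8}) K
     - wedge \<omega> (dx {1,4,6,7}) K - wedge \<omega> (dx {2,3,5,8}) K + wedge \<omega> (dx {2,3,6,7}) K
     + wedge \<omega> (dx {2,4,5,7}) K + wedge \<omega> (dx {2,4,6,8}) K - wedge \<omega> (dx {3,4,5,6}) K
     + wedge \<omega> (dx {3,4,7,8}) K + wedge \<omega> (dx {5,6,7,8}) K"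
  by (simp only: wedge_def cayley_form_def sum.distrib[symmetric] sum_subtractf[symmetric]
      distrib_left right_diff_distrib)

text \<open>Seven independent equations that cut the 21-dimensional eigenspace out of the
  28-dimensional space of 2-forms. They are solved for the coefficients involving the label 1, so
  that these can be eliminated.\<close>

lemma hodge_wedge_cayley_1:
  fixes \<omega> :: "real form"
  assumes "hodge (wedge \<omega> cayley_form) = \<omega>"
  shows "\<omega> {1,2} = \<omega> {3,4} + \<omega> {5,6} - \<omega> {7,8}"
    "\<omega> {1,3} = \<omega> {5,7} + \<omega> {6,8} - \<omega> {2,4}"
    "\<omega> {1,4} = \<omega> {2,3} + \<omega> {5,8} - \<omega> {6,7}"
    "\<omega> {1,5} = - \<omega> {2,6} - \<omega> {3,7} - \<omega> {4,8}"
    "\<omega> {1,6} = \<omega> {2,5} - \<omega> {3,8} + \<omega> {4,7}"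
    "\<omega> {1,7} = \<omega> {2,8} + \<omega> {3,5} - \<omega> {4,6}"
    "\<omega> {1,8} = - \<omega> {2,7} + \<omega> {3,6} + \<omega> {4,5}"
proof -
  let ?U = "{1, 2, 3, 4, 5, 6, 7, 8} :: nat set"
  have *: "\<omega> J = shuffle_sign (?U - J) J * wedge \<omega> cayley_form (?U - J)" if "J \<subseteq> {1, 2, 3, 4, 5, 6, 7, 8}" for J
    using fun_cong[OF assms, of J] that unfolding hodge_def atLeastAtMost_1_8 by (simp del: One_nat_def)
  show "\<omega> {1,2} = \<omega> {3,4} + \<omega> {5,6} - \<omega> {7,8}"
    "\<omega> {1,3} = \<omega> {5,7} + \<omega> {6,8} - \<omega> {2,4}"
    "\<omega> {1,4} = \<omega> {2,3} + \<omega> {5,8} - \<omega> {6,7}"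
    "\<omega> {1,5} = - \<omega> {2,6} - \<omega> {3,7} - \<omega> {4,8}"
    "\<omega> {1,6} = \<omega> {2,5} - \<omega> {3,8} + \<omega> {4,7}"
    "\<omega> {1,7} = \<omega> {2,8} + \<omega> {3,5} - \<omega> {4,6}"
    "\<omega> {1,8} = - \<omega> {2,7} + \<omega> {3,6} + \<omega> {4,5}"
    by (subst *; simp add: wedge_cayley_form wedge_dx shuffle_sign_prod insert_Diff_if)+
qed

text \<open>Polymorphic in the coefficients, since it serves as a real test form in the invariance
  condition and as the complex curvature form.\<close>

definition diagonal_form :: "(nat \<Rightarrow> 'a::comm_ring_1) \<Rightarrow> 'a form" where
  "diagonal_form a = (\<lambda>K. a 0 * dx {1,2} K + a 1 * dx {3,4} K + a 2 * dx {5,6} K + a 3 * dx {7,8} K)"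

lemma wedge_add_left: "wedge (\<lambda>K. \<alpha> K + \<beta> K) \<gamma> K = wedge \<alpha> \<gamma> K + wedge \<beta> \<gamma> K"
  by (simp add: wedge_def distrib_left distrib_right sum.distrib)

lemma wedge_cmult_left: "wedge (\<lambda>K. c * \<alpha> K) \<gamma> K = c * wedge \<alpha> \<gamma> K"
  by (simp add: wedge_def sum_distrib_left mult_ac)

lemma wedge_diagonal_form:
  "wedge (diagonal_form a) \<beta> K =
     a 0 * wedge (dx {1,2}) \<beta> K + a 1 * wedge (dx {3,4}) \<beta> K
     + a 2 * wedge (dx {5,6}) \<beta> K + a 3 * wedge (dx {7,8}) \<beta> K"
  unfolding diagonal_form_def wedge_add_left wedge_cmult_left ..

text \<open>A diagonal form against the Cayley form gives four times fourteen products of basis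
  forms; each has a non-zero coefficient at most at the complement of
  \<open>P \<union> I\<close>.\<close>

lemma hodge_wedge_dx_dx:
  assumes "J \<subseteq> {1..8}" "P \<subseteq> {1..8}" "I \<subseteq> {1..8}"
  shows "shuffle_sign ({1..8} - J) J * wedge (dx P) (dx I) ({1..8} - J) =
    (if P \<inter> I = {}
     then shuffle_sign (P \<union> I) ({1..8} - (P \<union> I)) * shuffle_sign P I * dx ({1..8} - (P \<union> I)) J else 0 :: 'a::comm_ring_1)"
proof -
  define U where "U = {1..8::nat}"
  note a = assms[folded U_def]
  have eq: "I \<subseteq> U - J \<and> U - J - I = P \<longleftrightarrow> P \<inter> I = {} \<and> J = U - (P \<union> I)"
    using a by blast
  have "finite (U - J)" by (simp add: U_def)
  then have w: "wedge (dx P) (dx I) (U - J) = (if I \<subseteq> U - J \<and> U - J - I = P then shuffle_sign P I else 0 :: 'a)"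
    by (simp only: wedge_dx) (simp add: dx_def)
  have "U - (U - (P \<union> I)) = P \<union> I" using a by blast
  then show ?thesis
    unfolding U_def[symmetric] w eq by (cases "J = U - (P \<union> I)") (simp_all add: dx_def)
qed

text \<open>Eight of the fourteen terms of the Cayley form meet all four pairs 12, 34, 56, 78 and
  die against diagonal forms. The other six make the operator act on (a 0, ..., a 3) as the identity
  minus v v^T with v = (1, -1, -1, 1), and the hypothesis says that \<open>a\<close> is orthogonal
  to v.\<close>

lemma hodge_wedge_diagonal_form:
  fixes a :: "nat \<Rightarrow> 'a::comm_ring_1"
  assumes "a 0 + a 3 = a 1 + a 2"
  shows "hodge (wedge (diagonal_form a) cayley_form) = diagonal_form a"
proof
  fix J
  have a0: "a 0 = a 1 + a 2 - a 3" using assms by (simp add: algebra_simps)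
  show "hodge (wedge (diagonal_form a) cayley_form) J = diagonal_form a J"
  proof (cases "J \<subseteq> {1..8}")
    case True
    let ?s = "shuffle_sign ({1..8} - J) J"
    have s: "?s * (\<beta> + \<gamma>) = ?s * \<beta> + ?s * \<gamma>" "?s * (\<beta> - \<gamma>) = ?s * \<beta> - ?s * \<gamma>"
      "?s * (x * \<beta>) = x * (?s * \<beta>)" for \<beta> \<gamma> x :: 'a
      by (simp_all add: algebra_simps)
    show ?thesis
      using True unfolding hodge_def
      by (simp add: wedge_cayley_form wedge_diagonal_form s hodge_wedge_dx_dx del: One_nat_def)
        (simp only: atLeastAtMost_1_8,
          simp add: shuffle_sign_prod insert_Diff_if diagonal_form_def a0 algebra_simps insert_commute)
  next
    case False
    then have "J \<noteq> {1,2}" "J \<noteq> {3,4}" "J \<noteq> {5,6}" "J \<noteq> {7,8}" by auto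
    then show ?thesis using False by (simp add: hodge_def diagonal_form_def dx_def)
  qed
qed

lemma two_form_diagonal_form: "two_form (diagonal_form a)"
  unfolding two_form_def diagonal_form_def dx_def by (auto split: if_splits)

subsection \<open>Chirality\<close>

text \<open>The eigenvalue of the third Pauli matrix in tensor position \<open>j\<close>. From
  position 4 on it is an unspecified sign.\<close>

definition spin_sign :: "nat \<Rightarrow> spin_index \<Rightarrow> int" where
  "spin_sign j b = (case b of (b\<^sub>0, b\<^sub>1, b\<^sub>2, b\<^sub>3) \<Rightarrow> if [b\<^sub>0, b\<^sub>1, b\<^sub>2, b\<^sub>3] ! j then - 1 else 1)"

definition chirality :: "spin_index \<Rightarrow> int" where
  "chirality b = spin_sign 0 b * spin_sign 1 b * spin_sign 2 b * spin_sign 3 b"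

lemma less_4_cases: "(j::nat) < 4 \<Longrightarrow> j = 0 \<or> j = 1 \<or> j = 2 \<or> j = 3"
  by auto

lemma pauli_mult_1_2: "pauli_mult 1 2 a b = (if a = b then if a then - \<i> else \<i> else 0)"
  by (auto simp: pauli_mult_def pauli_def)

text \<open>The leading third Pauli matrices square to 1, and the prefactor
  \<open>\<i> * \<i>\<close> times the product of the first two Pauli matrices is
  \<open>- \<i>\<close> times the third, in position \<open>j\<close>.\<close>

lemma gamma_pair:
  assumes "j < 4"
  shows "(gamma (2 * j + 1) ** gamma (2 * j + 2)) $ a $ b = (if a = b then - \<i> * of_int (spin_sign j a) else 0)"
  using less_4_cases[OF assms]
  by (elim disjE; cases a; cases b)
    (simp_all add: gamma_def pauli_tensor_mult pauli_mult_1_2[unfolded One_nat_def]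
      pauli_mult_simps pauli_def[of 0] spin_sign_def)

lemma matrix_mult_diagonal:
  fixes A B :: "complex ^ 'n ^ 'n"
  assumes "\<And>a b. A $ a $ b = (if a = b then f a else 0)" "\<And>a b. B $ a $ b = (if a = b then g a else 0)"
  shows "(A ** B) $ a $ b = (if a = b then f a * g a else 0)"
proof -
  have "(A ** B) $ a $ b = (\<Sum>k\<in>UNIV. A $ a $ k * B $ k $ b)"
    by (simp add: matrix_matrix_mult_def)
  also have "\<dots> = (\<Sum>k\<in>UNIV. if k = a then f a * B $ a $ b else 0)"
    by (rule sum.cong) (simp_all add: assms(1))
  also have "\<dots> = f a * B $ a $ b" by simp
  finally show ?thesis by (simp only: assms(2)) simp
qed

text \<open>Regrouped into the four diagonal pairs, whose factors \<open>- \<i>\<close> multiply to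
  1.\<close>

lemma volume_element_entry: "volume_element $ a $ b = (if a = b then of_int (chirality a) else 0)"
proof -
  have v: "volume_element = ((gamma 1 ** gamma 2) ** (gamma 3 ** gamma 4)) ** (gamma 5 ** gamma 6) ** (gamma 7 ** gamma 8)"
    by (simp only: volume_element_def matrix_mul_assoc)
  note g = gamma_pair[of 0] gamma_pair[of 1] gamma_pair[of 2] gamma_pair[of 3]
  have g': "(gamma 1 ** gamma 2) $ a $ b = (if a = b then - \<i> * of_int (spin_sign 0 a) else 0)"
    "(gamma 3 ** gamma 4) $ a $ b = (if a = b then - \<i> * of_int (spin_sign 1 a) else 0)"
    "(gamma 5 ** gamma 6) $ a $ b = (if a = b then - \<i> * of_int (spin_sign 2 a) else 0)"
    "(gamma 7 ** gamma 8) $ a $ b = (if a = b then - \<i> * of_int (spin_sign 3 a) else 0)" for a b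
    using g[of a b] by (simp_all add: numeral_eq_Suc)
  show ?thesis
    unfolding v
    by (subst matrix_mult_diagonal[OF matrix_mult_diagonal[OF matrix_mult_diagonal[OF g'(1) g'(2)] g'(3)] g'(4)])
      (simp add: chirality_def complex_eq_iff)
qed

lemma volume_element_mult: "(volume_element *v \<eta>) $ a = of_int (chirality a) * \<eta> $ a"
  by (simp add: matrix_vector_mult_def volume_element_entry if_distrib if_distribR cong: if_cong)

section \<open>The invariant spinors and their chirality\<close>

lemma sum_increasing_pairs:
  "(\<Sum>p\<in>{(k::nat, l). k \<in> {1..8} \<and> l \<in> {1..8} \<and> k < l}. f p) =
     f (1, 2) + f (1, 3) + f (1, 4) + f (1, 5) + f (1, 6) + f (1, 7) + f (1, 8)
     + f (2, 3) + f (2, 4) + f (2, 5) + f (2, 6) + f (2, 7) + f (2, 8)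
     + f (3, 4) + f (3, 5) + f (3, 6) + f (3, 7) + f (3, 8)
     + f (4, 5) + f (4, 6) + f (4, 7) + f (4, 8)
     + f (5, 6) + f (5, 7) + f (5, 8)
     + f (6, 7) + f (6, 8)
     + f (7, 8)"
proof -
  have "{(k::nat, l). k \<in> {1..8} \<and> l \<in> {1..8} \<and> k < l} = Sigma {1..8} (\<lambda>k. {k<..8})"
    by auto
  then have "(\<Sum>p\<in>{(k::nat, l). k \<in> {1..8} \<and> l \<in> {1..8} \<and> k < l}. f p)
      = (\<Sum>k\<in>{1..8}. \<Sum>l\<in>{k<..8}. f (k, l))"
    by (simp add: sum.Sigma)
  moreover have "{1<..8::nat} = {2,3,4,5,6,7,8}" "{2<..8::nat} = {3,4,5,6,7,8}" "{3<..8::nat} = {4,5,6,7,8}"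
    "{4<..8::nat} = {5,6,7,8}" "{5<..8::nat} = {6,7,8}" "{6<..8::nat} = {7,8}" "{7<..8::nat} = {8}"
    by auto
  ultimately show ?thesis unfolding atLeastAtMost_1_8 by (simp del: One_nat_def add: add.assoc)
qed

text \<open>The diagonal forms satisfying the eigenvalue equation form a Cartan subalgebra of
  spin(7), and each basis spinor is a weight vector. Only weight zero is allowed, which forces the
  sign vector to be a multiple of (1, -1, -1, 1).\<close>

lemma spin7_invariant_support:
  assumes "spin7_invariant \<eta>" "\<eta> $ b \<noteq> 0"
  shows "chirality b = 1"
proof -
  have *: "a 0 * spin_sign 0 b + a 1 * spin_sign 1 b + a 2 * spin_sign 2 b + a 3 * spin_sign 3 b = 0"
    if a: "a 0 + a 3 = a 1 + a 2" for a :: "nat \<Rightarrow> real"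
  proof -
    define M where "M j = gamma (2 * j + 1) ** gamma (2 * j + 2)" for j
    have M: "M 0 = gamma 1 ** gamma 2" "M 1 = gamma 3 ** gamma 4" "M 2 = gamma 5 ** gamma 6" "M 3 = gamma 7 ** gamma 8"
      by (simp_all add: M_def eval_nat_numeral)
    have "(\<Sum>(k, l)\<in>{(k, l). k \<in> {1..8} \<and> l \<in> {1..8} \<and> k < l}.
           complex_of_real (diagonal_form a {k, l}) *s (gamma k *v (gamma l *v \<eta>))) = 0"
      using assms(1) two_form_diagonal_form[of a] hodge_wedge_diagonal_form[of a, OF a]
      unfolding spin7_invariant_def by blast
    then have "complex_of_real (a 0) *s (M 0 *v \<eta>) + complex_of_real (a 1) *s (M 1 *v \<eta>)
      + complex_of_real (a 2) *s (M 2 *v \<eta>) + complex_of_real (a 3) *s (M 3 *v \<eta>) = 0"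
      unfolding sum_increasing_pairs
      by (simp add: diagonal_form_def dx_def doubleton_eq_iff M matrix_vector_mul_assoc add.assoc del: One_nat_def)
    then have "(complex_of_real (a 0) *s (M 0 *v \<eta>) + complex_of_real (a 1) *s (M 1 *v \<eta>)
      + complex_of_real (a 2) *s (M 2 *v \<eta>) + complex_of_real (a 3) *s (M 3 *v \<eta>)) $ b = 0" by simp
    moreover have "(M j *v \<eta>) $ b = - \<i> * of_int (spin_sign j b) * \<eta> $ b" if "j < 4" for j
      by (simp only: M_def matrix_vector_mult_def vec_lambda_beta gamma_pair[OF that])
        (simp add: if_distrib if_distribR cong: if_cong)
    ultimately have "- \<i> * \<eta> $ b * of_real (a 0 * spin_sign 0 b + a 1 * spin_sign 1 b + a 2 * spin_sign 2 b + a 3 * spin_sign 3 b) = 0"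
      by (simp add: algebra_simps)
    then have "complex_of_real (a 0 * spin_sign 0 b + a 1 * spin_sign 1 b + a 2 * spin_sign 2 b + a 3 * spin_sign 3 b) = 0"
      using assms(2) by simp
    then show ?thesis by (simp only: of_real_eq_0_iff)
  qed
  \<comment> \<open>The three test vectors form a basis of the hyperplane
    \<open>a 0 + a 3 = a 1 + a 2\<close>.\<close>
  have "real_of_int (spin_sign 0 b + spin_sign 1 b) = 0" "real_of_int (spin_sign 0 b + spin_sign 2 b) = 0"
    "real_of_int (spin_sign 1 b + spin_sign 3 b) = 0"
    using *[of "\<lambda>j. if j = 0 \<or> j = 1 then 1 else 0"] *[of "\<lambda>j. if j = 0 \<or> j = 2 then 1 else 0"]
      *[of "\<lambda>j. if j = 1 \<or> j = 3 then 1 else 0"] by simp_all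
  then have "spin_sign 1 b = - spin_sign 0 b" "spin_sign 2 b = - spin_sign 0 b" "spin_sign 3 b = spin_sign 0 b"
    by linarith+
  moreover have "spin_sign 0 b = 1 \<or> spin_sign 0 b = - 1"
    by (cases b) (simp add: spin_sign_def)
  ultimately show ?thesis by (auto simp: chirality_def)
qed

text \<open>The diagonal part of \<open>spin(7)\<close> annihilates just these two basis vectors; the remaining part
  forces the relative sign.\<close>

definition invariant_spinor :: spinor where
  "invariant_spinor = axis (False, True, True, False) 1 - axis (True, False, False, True) 1"

lemma matrix_mult_axis: "(A *v axis k 1) $ a = A $ a $ k" for A :: "complex ^ 'n ^ 'm"
  by (simp add: matrix_vector_mult_def axis_def if_distrib cong: if_cong)

lemma matrix_mult_invariant_spinor:
  "(gamma k *v (gamma l *v invariant_spinor)) $ a =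
     (gamma k ** gamma l) $ a $ (False, True, True, False) - (gamma k ** gamma l) $ a $ (True, False, False, True)"
  by (simp add: matrix_vector_mul_assoc invariant_spinor_def matrix_vector_mult_diff_distrib matrix_mult_axis)

text \<open>Once the seven equations are substituted, each of the 16 spinor components vanishes
  identically in the remaining 21 coefficients.\<close>

lemma spin7_invariant_invariant_spinor: "spin7_invariant invariant_spinor"
  unfolding spin7_invariant_def
proof (intro allI impI)
  fix \<omega> :: "real form"
  assume "two_form \<omega> \<and> hodge (wedge \<omega> cayley_form) = \<omega>"
  then have h: "hodge (wedge \<omega> cayley_form) = \<omega>" by simp
  show "(\<Sum>(k, l)\<in>{(k, l). k \<in> {1..8} \<and> l \<in> {1..8} \<and> k < l}.
           complex_of_real (\<omega> {k, l}) *s (gamma k *v (gamma l *v invariant_spinor))) = 0"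
    unfolding vec_eq_iff split_paired_All all_bool_eq
    unfolding sum_increasing_pairs split_conv vector_add_component vector_smult_component
      matrix_mult_invariant_spinor hodge_wedge_cayley_1[OF h]
    by (simp add: gamma_def pauli_tensor_mult pauli_mult_def pauli_def algebra_simps)
qed

text \<open>The definite description needs two facts: the explicit spinor shows that 1 qualifies,
  and the support of invariant spinors excludes every other value.\<close>

lemma invariant_chirality_eq: "invariant_chirality = 1"
  unfolding invariant_chirality_def
proof (rule the_equality)
  have "invariant_spinor $ (False, True, True, False) = 1"
    by (simp add: invariant_spinor_def axis_def)
  then have "invariant_spinor \<noteq> 0" by auto
  moreover have "volume_element *v invariant_spinor = 1 *s invariant_spinor"
    using spin7_invariant_support[OF spin7_invariant_invariant_spinor]
    by (auto simp: vec_eq_iff volume_element_mult)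
  ultimately show "\<exists>\<eta>. \<eta> \<noteq> 0 \<and> spin7_invariant \<eta> \<and> volume_element *v \<eta> = 1 *s \<eta>"
    using spin7_invariant_invariant_spinor by blast
next
  fix \<epsilon>
  assume "\<exists>\<eta>. \<eta> \<noteq> 0 \<and> spin7_invariant \<eta> \<and> volume_element *v \<eta> = \<epsilon> *s \<eta>"
  then obtain \<eta> where \<eta>: "\<eta> \<noteq> 0" "spin7_invariant \<eta>" "volume_element *v \<eta> = \<epsilon> *s \<eta>" by blast
  then obtain b where b: "\<eta> $ b \<noteq> 0" by (auto simp: vec_eq_iff)
  have "of_int (chirality b) * \<eta> $ b = \<epsilon> * \<eta> $ b"
    using arg_cong[OF \<eta>(3), of "\<lambda>v. v $ b"] by (simp add: volume_element_mult)
  then show "\<epsilon> = 1" using b spin7_invariant_support[OF \<eta>(2) b] by simp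
qed

lemma chirality_cases: "chirality b = 1 \<or> chirality b = - 1"
  by (cases b) (auto simp: chirality_def spin_sign_def)

lemma neg_eq_self_iff: "- z = z \<longleftrightarrow> z = 0" for z :: complex
  by (auto simp: complex_eq_iff)

lemma S_plus_iff: "\<eta> \<in> S_plus \<longleftrightarrow> (\<forall>b. chirality b = - 1 \<longrightarrow> \<eta> $ b = 0)"
proof -
  have "of_int (chirality b) * \<eta> $ b = 1 * \<eta> $ b \<longleftrightarrow> (chirality b = - 1 \<longrightarrow> \<eta> $ b = 0)" for b
    using chirality_cases[of b] neg_eq_self_iff by auto
  then show ?thesis
    unfolding S_plus_def invariant_chirality_eq mem_Collect_eq vec_eq_iff volume_element_mult
      vector_smult_component by simp
qed

lemma S_minus_iff: "\<eta> \<in> S_minus \<longleftrightarrow> (\<forall>b. chirality b = 1 \<longrightarrow> \<eta> $ b = 0)"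
proof -
  have "of_int (chirality b) * \<eta> $ b = - 1 * \<eta> $ b \<longleftrightarrow> (chirality b = 1 \<longrightarrow> \<eta> $ b = 0)" for b
    using chirality_cases[of b] neg_eq_self_iff[of "\<eta> $ b"] by auto
  then show ?thesis
    unfolding S_minus_def invariant_chirality_eq mem_Collect_eq vec_eq_iff volume_element_mult
      vector_smult_component by simp
qed

subsection \<open>Coordinates and the lattice\<close>

definition coord :: "nat \<Rightarrow> real ^ 8 \<Rightarrow> real" where
  "coord k x = x $ (of_nat k :: 8)"

definition evec :: "nat \<Rightarrow> real ^ 8" where
  "evec k = axis (of_nat k) 1"

text \<open>The labels run once through the residues modulo 8, with 8 going to 0, so they can serve
  as names of the coordinates.\<close>

lemma of_nat_8_inj: "inj_on (of_nat :: nat \<Rightarrow> 8) {1..8}"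
proof (rule inj_onI)
  have *: "k = l" if "k \<le> l" "k \<in> {1..8}" "l \<in> {1..8}" "(of_nat k :: 8) = of_nat l" for k l :: nat
  proof -
    have "(of_nat (l - k) :: 8) = 0" using that by (simp add: of_nat_diff)
    then have "8 dvd l - k" by (simp add: of_nat_eq_0_iff_char_dvd)
    then show ?thesis using that by (auto dest: dvd_imp_le)
  qed
  fix k l :: nat
  assume "k \<in> {1..8}" "l \<in> {1..8}" "(of_nat k :: 8) = of_nat l"
  then show "k = l" using *[of k l] *[of l k] by (metis nat_le_linear)
qed

lemma coord_evec: "k \<in> {1..8} \<Longrightarrow> l \<in> {1..8} \<Longrightarrow> coord k (evec l) = (if k = l then 1 else 0)"
  unfolding coord_def evec_def axis_def using of_nat_8_inj by (auto dest: inj_onD)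

lemma coord_simps [simp]:
  "coord k (x + y) = coord k x + coord k y" "coord k (x - y) = coord k x - coord k y"
  "coord k (- x) = - coord k x" "coord k (c *\<^sub>R x) = c * coord k x" "coord k 0 = 0"
  by (simp_all add: coord_def)

lemma bounded_linear_coord: "bounded_linear (coord k)"
  unfolding coord_def[abs_def] by (rule bounded_linear_vec_nth)

definition int_lattice :: "(real ^ 8) set" where
  "int_lattice = {x. \<forall>i. x $ i \<in> \<int>}"

lemma coord_int_lattice: "x \<in> int_lattice \<Longrightarrow> coord k x \<in> \<int>"
  by (simp add: int_lattice_def coord_def)

lemma int_lattice_add: "x \<in> int_lattice \<Longrightarrow> y \<in> int_lattice \<Longrightarrow> x + y \<in> int_lattice"
  and int_lattice_minus: "x \<in> int_lattice \<Longrightarrow> - x \<in> int_lattice"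
  and int_lattice_diff: "x \<in> int_lattice \<Longrightarrow> y \<in> int_lattice \<Longrightarrow> x - y \<in> int_lattice"
  and int_lattice_0: "0 \<in> int_lattice"
  by (auto simp: int_lattice_def)

definition floor_vec :: "real ^ 8 \<Rightarrow> real ^ 8" where
  "floor_vec x = (\<chi> i. of_int \<lfloor>x $ i\<rfloor>)"

lemma floor_vec_lattice: "floor_vec x \<in> int_lattice"
  by (simp add: floor_vec_def int_lattice_def)

lemma floor_vec_add: "l \<in> int_lattice \<Longrightarrow> floor_vec (x + l) = floor_vec x + l"
  by (auto simp: floor_vec_def int_lattice_def vec_eq_iff elim!: Ints_cases)

lemma full_lattice_int_lattice: "full_lattice int_lattice"
  unfolding full_lattice_def
proof (intro exI[of _ Basis] conjI)
  show "independent (Basis :: (real ^ 8) set)" "span (Basis :: (real ^ 8) set) = UNIV"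
    by (simp_all add: independent_Basis)
  show "int_lattice = {\<Sum>b\<in>Basis. of_int (n b) *\<^sub>R b | n :: real ^ 8 \<Rightarrow> int. True}"
  proof (intro equalityI subsetI)
    fix x :: "real ^ 8"
    assume x: "x \<in> int_lattice"
    have fl: "of_int \<lfloor>x \<bullet> b\<rfloor> = x \<bullet> b" if b: "b \<in> Basis" for b
    proof -
      obtain i where "b = axis i 1" using b by (auto simp: Basis_vec_def)
      moreover obtain n where "x $ i = of_int n" using x by (auto simp: int_lattice_def elim: Ints_cases)
      ultimately show ?thesis by (simp add: inner_axis)
    qed
    have "x = (\<Sum>b\<in>Basis. (x \<bullet> b) *\<^sub>R b)" by (simp add: euclidean_representation)
    also have "\<dots> = (\<Sum>b\<in>Basis. of_int \<lfloor>x \<bullet> b\<rfloor> *\<^sub>R b)"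
      by (rule sum.cong[OF refl]) (simp only: fl)
    finally have "x = (\<Sum>b\<in>Basis. of_int \<lfloor>x \<bullet> b\<rfloor> *\<^sub>R b)" .
    then show "x \<in> {\<Sum>b\<in>Basis. of_int (n b) *\<^sub>R b | n :: real ^ 8 \<Rightarrow> int. True}"
      by (intro CollectI exI[of _ "\<lambda>b. \<lfloor>x \<bullet> b\<rfloor>"]) simp
  next
    fix x
    assume "x \<in> {\<Sum>b\<in>Basis. of_int (n b) *\<^sub>R b | n :: real ^ 8 \<Rightarrow> int. True}"
    then obtain n :: "real ^ 8 \<Rightarrow> int" where x: "x = (\<Sum>b\<in>Basis. of_int (n b) *\<^sub>R b)" by blast
    have "b $ i \<in> \<int>" if "b \<in> Basis" for b :: "real ^ 8" and i
      using that by (auto simp: Basis_vec_def axis_def)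
    then show "x \<in> int_lattice"
      unfolding x int_lattice_def by (auto intro!: Ints_sum)
  qed
qed

subsection \<open>A second derivative test\<close>

text \<open>If \<open>D\<close> were positive, the first derivative, zero at the maximum, would be
  positive just to its right, and the mean value theorem would yield a larger value.\<close>

lemma second_derivative_max:
  fixes \<phi> :: "real \<Rightarrow> real"
  assumes d1: "\<And>t. (\<phi> has_real_derivative \<phi>' t) (at t)" and d2: "(\<phi>' has_real_derivative D) (at 0)"
    and max: "\<And>t. \<phi> t \<le> \<phi> 0"
  shows "D \<le> 0"
proof (rule ccontr)
  assume "\<not> D \<le> 0"
  moreover have "\<phi>' 0 = 0" by (rule DERIV_local_max[OF d1, of 1]) (use max in auto)
  ultimately obtain \<delta> where \<delta>: "\<delta> > 0" "\<And>h. 0 < h \<Longrightarrow> h < \<delta> \<Longrightarrow> \<phi>' h > 0"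
    using DERIV_pos_inc_right[OF d2] by auto
  obtain z where "0 < z" "z < \<delta> / 2" "\<phi> (\<delta> / 2) - \<phi> 0 = (\<delta> / 2 - 0) * \<phi>' z"
    using MVT2[of 0 "\<delta> / 2" \<phi> \<phi>'] d1 \<delta>(1) by auto
  moreover have "\<phi>' z > 0" using calculation \<delta> by simp
  ultimately have "\<phi> (\<delta> / 2) > \<phi> 0" using \<delta>(1)
    by (metis diff_gt_0_iff_gt diff_zero half_gt_zero mult_pos_pos)
  then show False using max[of "\<delta> / 2"] by simp
qed

subsection \<open>Covariant derivatives with constant curvature\<close>

text \<open>Deliberately not antisymmetric: odd coordinates of the first argument meet even
  coordinates of the second, as in Landau gauge. Its antisymmetrisation is the curvature up to the
  factor 2 pi i.\<close>

definition pairing :: "(nat \<Rightarrow> int) \<Rightarrow> real ^ 8 \<Rightarrow> real ^ 8 \<Rightarrow> real" where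
  "pairing d x v = (\<Sum>j<4. of_int (d j) * coord (2 * j + 1) x * coord (2 * j + 2) v)"

definition potential :: "(nat \<Rightarrow> int) \<Rightarrow> nat \<Rightarrow> real ^ 8 \<Rightarrow> complex" where
  "potential d k x = \<i> * of_real (2 * pi * pairing d x (evec k))"

text \<open>Translation by \<open>l\<close> changes the potential by the constant
  \<open>potential d k l\<close>. The logarithmic derivative of this factor is minus that constant,
  which makes the transformation law compatible with \<open>nabla\<close>.\<close>

definition automorphy :: "(nat \<Rightarrow> int) \<Rightarrow> real ^ 8 \<Rightarrow> real ^ 8 \<Rightarrow> complex" where
  "automorphy d l x = exp (- (\<i> * of_real (2 * pi * pairing d l x)))"

definition curv :: "(nat \<Rightarrow> int) \<Rightarrow> nat \<Rightarrow> nat \<Rightarrow> complex" where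
  "curv d k l = \<i> * of_real (2 * pi * (pairing d (evec k) (evec l) - pairing d (evec l) (evec k)))"

definition partial :: "nat \<Rightarrow> (real ^ 8 \<Rightarrow> complex) \<Rightarrow> real ^ 8 \<Rightarrow> complex" where
  "partial k f x = frechet_derivative f (at x) (evec k)"

definition nabla :: "(nat \<Rightarrow> int) \<Rightarrow> nat \<Rightarrow> (real ^ 8 \<Rightarrow> complex) \<Rightarrow> real ^ 8 \<Rightarrow> complex" where
  "nabla d k f x = partial k f x + potential d k x * f x"

text \<open>The smooth sections of the line bundle, pulled back to the universal cover.\<close>

definition lsections :: "(nat \<Rightarrow> int) \<Rightarrow> (real ^ 8 \<Rightarrow> complex) set" where
  "lsections d = {f. smooth_on UNIV f \<and> (\<forall>l\<in>int_lattice. \<forall>x. f (x + l) = automorphy d l x * f x)}"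

lemma pairing_add:
  "pairing d (x + y) v = pairing d x v + pairing d y v"
  "pairing d x (v + w) = pairing d x v + pairing d x w"
  by (simp_all add: pairing_def algebra_simps sum.distrib)

lemma pairing_scaleR:
  "pairing d (c *\<^sub>R x) v = c * pairing d x v" "pairing d x (c *\<^sub>R v) = c * pairing d x v"
  by (simp_all add: pairing_def sum_distrib_left algebra_simps)

lemma pairing_lattice: "x \<in> int_lattice \<Longrightarrow> y \<in> int_lattice \<Longrightarrow> pairing d x y \<in> \<int>"
  unfolding pairing_def by (intro Ints_sum Ints_mult) (auto intro: coord_int_lattice)

lemma bounded_linear_pairing: "bounded_linear (pairing d x)" "bounded_linear (\<lambda>x. pairing d x v)"
  by (intro linear_conv_bounded_linear[THEN iffD1] linearI; simp add: pairing_add pairing_scaleR)+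

lemma bounded_linear_of_real_mult:
  assumes "bounded_linear p"
  shows "bounded_linear (\<lambda>x. c * complex_of_real (a * p x))"
  using bounded_linear_compose[OF bounded_linear_mult_right[of c]
      bounded_linear_compose[OF bounded_linear_of_real bounded_linear_compose[OF bounded_linear_mult_right[of a] assms]]]
  by simp

lemma bounded_linear_potential: "bounded_linear (potential d k)"
  unfolding potential_def[abs_def] by (intro bounded_linear_of_real_mult bounded_linear_pairing)

lemma smooth_potential: "smooth_on S (potential d k)"
  by (rule smooth_on_linear[OF bounded_linear_potential])

lemma partial_potential: "partial k (potential d l) x = potential d l (evec k)"
  unfolding partial_def
  using frechet_derivative_at[OF bounded_linear_imp_has_derivative[OF bounded_linear_potential], of d l x] by simp

lemma potential_add: "potential d k (x + y) = potential d k x + potential d k y"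
  by (simp add: potential_def pairing_add algebra_simps)

lemma cnj_potential: "cnj (potential d k x) = - potential d k x"
  by (simp add: potential_def)

lemma curv_eq: "curv d k l = potential d l (evec k) - potential d k (evec l)"
  by (simp add: curv_def potential_def algebra_simps)

lemma pairing_evec:
  assumes "k \<in> {1..8}" "l \<in> {1..8}"
  shows "pairing d (evec k) (evec l) = (if odd k \<and> l = k + 1 then of_int (d (k div 2)) else 0)"
proof -
  have "pairing d (evec k) (evec l) = (\<Sum>j<4. if j = k div 2 \<and> odd k \<and> l = k + 1 then of_int (d (k div 2)) else 0)"
    unfolding pairing_def
  proof (rule sum.cong[OF refl])
    fix j :: nat assume "j \<in> {..<4}"
    then have "2 * j + 1 \<in> {1..8}" "2 * j + 2 \<in> {1..8}" by auto
    then show "of_int (d j) * coord (2 * j + 1) (evec k) * coord (2 * j + 2) (evec l) =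
      (if j = k div 2 \<and> odd k \<and> l = k + 1 then of_int (d (k div 2)) else 0)"
      using assms by (auto simp: coord_evec)
  qed
  also have "\<dots> = (if odd k \<and> l = k + 1 then of_int (d (k div 2)) else 0)"
    using assms by (auto simp: sum.delta)
  finally show ?thesis .
qed

lemma sum_pairing_evec:
  fixes M :: "nat \<Rightarrow> nat \<Rightarrow> complex"
  shows "(\<Sum>k\<in>{1..8}. \<Sum>l\<in>{1..8}. of_real (pairing d (evec k) (evec l)) * M k l)
    = (\<Sum>j<4. of_int (d j) * M (2 * j + 1) (2 * j + 2))"
proof -
  have "(\<Sum>k\<in>{1..8}. \<Sum>l\<in>{1..8}. of_real (pairing d (evec k) (evec l)) * M k l)
    = (\<Sum>k\<in>{1..8}. \<Sum>l\<in>{1..8}. if l = k + 1 then if odd k then of_int (d (k div 2)) * M k (k + 1) else 0 else 0)"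
    by (intro sum.cong) (auto simp: pairing_evec)
  also have "\<dots> = (\<Sum>k\<in>{1..8}. if k + 1 \<in> {1..8} then if odd k then of_int (d (k div 2)) * M k (k + 1) else 0 else 0)"
    by (simp add: sum.delta)
  also have "\<dots> = (\<Sum>j<4. of_int (d j) * M (2 * j + 1) (2 * j + 2))"
  proof -
    have "{..<4::nat} = {0, 1, 2, 3}" by auto
    then show ?thesis unfolding atLeastAtMost_1_8 by simp
  qed
  finally show ?thesis .
qed

context
  fixes d :: "nat \<Rightarrow> int"
begin

lemma smooth_partial: "smooth_on S f \<Longrightarrow> smooth_on S (partial k f)"
  unfolding partial_def[abs_def] by (rule smooth_on_derivative)

lemma smooth_nabla: "smooth_on UNIV f \<Longrightarrow> smooth_on UNIV (nabla d k f)"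
  unfolding nabla_def[abs_def]
  by (intro smooth_on_add smooth_on_mult smooth_partial smooth_potential) auto

lemma partial_add:
  assumes "smooth_on UNIV f" "smooth_on UNIV g"
  shows "partial k (\<lambda>x. f x + g x) x = partial k f x + partial k g x"
proof -
  have "((\<lambda>x. f x + g x) has_derivative
       (\<lambda>v. frechet_derivative f (at x) v + frechet_derivative g (at x) v)) (at x)"
    using assms by (intro has_derivative_add) (auto simp: smooth_on_differentiable frechet_derivative_works[symmetric])
  from fun_cong[OF frechet_derivative_at[OF this], of "evec k"] show ?thesis
    by (simp add: partial_def)
qed

lemma partial_mult:
  assumes "smooth_on UNIV f" "smooth_on UNIV g"
  shows "partial k (\<lambda>x. f x * g x) x = f x * partial k g x + partial k f x * g x"
proof -
  have "((\<lambda>x. f x * g x) has_derivative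
       (\<lambda>v. f x * frechet_derivative g (at x) v + frechet_derivative f (at x) v * g x)) (at x)"
    using assms by (intro has_derivative_mult) (auto simp: smooth_on_differentiable frechet_derivative_works[symmetric])
  from fun_cong[OF frechet_derivative_at[OF this], of "evec k"] show ?thesis
    by (simp add: partial_def)
qed

lemma partial_const: "partial k (\<lambda>x. c) x = 0"
  by (simp add: partial_def)

lemma partial_commute:
  "smooth_on UNIV f \<Longrightarrow> partial k (partial l f) x = partial l (partial k f) x"
  unfolding partial_def[abs_def] by (rule smooth_mixed_partials)

lemma nabla_add:
  assumes "smooth_on UNIV f" "smooth_on UNIV g"
  shows "nabla d k (\<lambda>x. f x + g x) x = nabla d k f x + nabla d k g x"
  using assms by (simp add: nabla_def partial_add algebra_simps)

lemma nabla_cmult: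
  assumes "smooth_on UNIV f"
  shows "nabla d k (\<lambda>x. c * f x) x = c * nabla d k f x"
  using assms by (simp add: nabla_def partial_mult smooth_on_const partial_const algebra_simps)

lemma nabla_zero: "nabla d k (\<lambda>x. 0) x = 0"
  by (simp add: nabla_def partial_const)

lemma nabla_sum:
  assumes "\<And>i. i \<in> I \<Longrightarrow> smooth_on UNIV (f i)"
  shows "nabla d k (\<lambda>x. \<Sum>i\<in>I. f i x) x = (\<Sum>i\<in>I. nabla d k (f i) x)"
  using assms
  by (induction I rule: infinite_finite_induct) (simp_all add: nabla_zero nabla_add smooth_on_sum)

text \<open>Mixed partial derivatives commute and the terms quadratic in the potential are
  symmetric. What remains are derivatives of the linear potential, which are constants.\<close>

lemma nabla_commutator:
  assumes f: "smooth_on UNIV f"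
  shows "nabla d k (nabla d l f) x = nabla d l (nabla d k f) x + curv d k l * f x"
proof -
  have "nabla d k (nabla d l f) x = partial k (partial l f) x + potential d l x * partial k f x
      + potential d l (evec k) * f x + potential d k x * partial l f x
      + potential d k x * (potential d l x * f x)" for k l
  proof -
    have "partial k (nabla d l f) x = partial k (\<lambda>x. partial l f x + potential d l x * f x) x"
      by (simp add: nabla_def[abs_def])
    also have "\<dots> = partial k (partial l f) x + (potential d l x * partial k f x + potential d l (evec k) * f x)"
      using f by (simp add: partial_add partial_mult smooth_partial smooth_potential smooth_on_mult partial_potential)
    finally show ?thesis by (simp add: nabla_def algebra_simps)
  qed
  then show ?thesis
    using partial_commute[OF f, of k l x] by (simp add: curv_eq algebra_simps)
qed

lemma smooth_automorphy: "smooth_on UNIV (automorphy d l)"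
proof -
  have "bounded_linear (\<lambda>x. - \<i> * complex_of_real (2 * pi * pairing d l x))"
    by (intro bounded_linear_of_real_mult bounded_linear_pairing)
  then show ?thesis
    unfolding automorphy_def[abs_def] using smooth_on_entire[of UNIV _ exp]
    by (auto simp: holomorphic_on_exp)
qed

lemma partial_automorphy: "partial k (automorphy d l) x = - potential d k l * automorphy d l x"
proof -
  have "bounded_linear (\<lambda>x. - \<i> * complex_of_real (2 * pi * pairing d l x))"
    by (intro bounded_linear_of_real_mult bounded_linear_pairing)
  then have "((\<lambda>x. - \<i> * complex_of_real (2 * pi * pairing d l x)) has_derivative
      (\<lambda>v. - \<i> * complex_of_real (2 * pi * pairing d l v))) (at x)"
    by (rule bounded_linear_imp_has_derivative)
  from has_derivative_compose[OF this DERIV_exp[unfolded has_field_derivative_def]]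
  have "(automorphy d l has_derivative
      (\<lambda>v. automorphy d l x * (- \<i> * complex_of_real (2 * pi * pairing d l v)))) (at x)"
    unfolding automorphy_def[abs_def] by (simp add: field_simps)
  from fun_cong[OF frechet_derivative_at[OF this], of "evec k"] show ?thesis
    by (simp add: partial_def potential_def mult_ac)
qed

lemma norm_automorphy: "norm (automorphy d l x) = 1"
  by (simp add: automorphy_def norm_exp_eq_Re)

lemma nabla_lsections: "f \<in> lsections d \<Longrightarrow> nabla d k f \<in> lsections d"
  unfolding lsections_def
proof (safe intro!: smooth_nabla)
  fix l x
  assume f: "smooth_on UNIV f" and q: "\<forall>l\<in>int_lattice. \<forall>x. f (x + l) = automorphy d l x * f x"
    and l: "l \<in> int_lattice"
  have "partial k f (x + l) = partial k (\<lambda>x. f (x + l)) x"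
    by (simp add: partial_def frechet_derivative_translate)
  also have "\<dots> = partial k (\<lambda>x. automorphy d l x * f x) x" using q l by simp
  also have "\<dots> = automorphy d l x * partial k f x - potential d k l * automorphy d l x * f x"
    using f by (simp add: partial_mult smooth_automorphy partial_automorphy)
  finally show "nabla d k f (x + l) = automorphy d l x * nabla d k f x"
    using q l by (simp add: nabla_def potential_add algebra_simps)
qed

lemma lsections_smooth: "f \<in> lsections d \<Longrightarrow> smooth_on UNIV f"
  by (simp add: lsections_def)

lemma lsections_lincomb: "f \<in> lsections d \<Longrightarrow> g \<in> lsections d \<Longrightarrow> (\<lambda>x. f x + c * g x) \<in> lsections d"
  unfolding lsections_def by (auto intro!: smooth_on_add smooth_on_mult smooth_on_const simp: algebra_simps)

end

context
  fixes d :: "nat \<Rightarrow> int"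
begin

subsection \<open>The lowest eigenvalue of the connection Laplacian\<close>

text \<open>Compatibility with the Hermitian metric: the potential is purely imaginary and cancels
  between the two factors.\<close>

lemma has_vector_derivative_pairing:
  assumes "smooth_on UNIV g" "smooth_on UNIV h"
  shows "((\<lambda>t. cnj (g (x + t *\<^sub>R evec k)) * h (x + t *\<^sub>R evec k)) has_vector_derivative
    (cnj (nabla d k g (x + t *\<^sub>R evec k)) * h (x + t *\<^sub>R evec k)
      + cnj (g (x + t *\<^sub>R evec k)) * nabla d k h (x + t *\<^sub>R evec k))) (at t)"
proof -
  let ?y = "x + t *\<^sub>R evec k"
  have d: "((\<lambda>t. f (x + t *\<^sub>R evec k)) has_vector_derivative partial k f ?y) (at t)"
    if "smooth_on UNIV f" for f
    unfolding partial_def by (rule has_vector_derivative_along[OF smooth_on_differentiable[OF that UNIV_I]])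
  have "((\<lambda>t. cnj (g (x + t *\<^sub>R evec k)) * h (x + t *\<^sub>R evec k)) has_vector_derivative
    (cnj (g ?y) * partial k h ?y + cnj (partial k g ?y) * h ?y)) (at t)"
    by (intro has_vector_derivative_mult has_vector_derivative_cnj d assms)
  moreover have "cnj (nabla d k g ?y) * h ?y + cnj (g ?y) * nabla d k h ?y
      = cnj (g ?y) * partial k h ?y + cnj (partial k g ?y) * h ?y"
    by (simp add: nabla_def cnj_potential algebra_simps)
  ultimately show ?thesis by simp
qed

text \<open>Along a coordinate line, half the second derivative of the squared norm is the squared
  norm of \<open>nabla d k f\<close> plus the term in question. At a maximum this sum is at most 0,
  and its first summand is not negative.\<close>

lemma Re_nabla_nabla_at_max:
  assumes f: "smooth_on UNIV f" and max: "\<And>x. norm (f x) \<le> norm (f x\<^sub>0)"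
  shows "Re (cnj (f x\<^sub>0) * nabla d k (nabla d k f) x\<^sub>0) \<le> 0"
proof -
  let ?D = "nabla d k f" and ?y = "\<lambda>t. x\<^sub>0 + t *\<^sub>R evec k"
  have sD: "smooth_on UNIV ?D" using f by (rule smooth_nabla)
  have "((\<lambda>t. Re (cnj (f (?y t)) * f (?y t))) has_real_derivative
      Re (cnj (?D (?y t)) * f (?y t) + cnj (f (?y t)) * ?D (?y t))) (at t)" for t
    unfolding has_real_derivative_iff_has_vector_derivative
    by (rule bounded_linear.has_vector_derivative[OF bounded_linear_Re has_vector_derivative_pairing[OF f f]])
  then have 1: "((\<lambda>t. Re (cnj (f (?y t)) * f (?y t))) has_real_derivative
      2 * Re (cnj (f (?y t)) * ?D (?y t))) (at t)" for t
    by (simp add: algebra_simps)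
  have 2: "((\<lambda>t. Re (cnj (f (?y t)) * ?D (?y t))) has_real_derivative
      Re (cnj (?D (?y t)) * ?D (?y t) + cnj (f (?y t)) * nabla d k ?D (?y t))) (at t)" for t
    unfolding has_real_derivative_iff_has_vector_derivative
    by (rule bounded_linear.has_vector_derivative[OF bounded_linear_Re has_vector_derivative_pairing[OF f sD]])
  have n: "Re (cnj z * z) = (norm z)\<^sup>2" for z :: complex
    by (simp only: cmod_power2) (simp add: power2_eq_square)
  have "2 * Re (cnj (?D (?y 0)) * ?D (?y 0) + cnj (f (?y 0)) * nabla d k ?D (?y 0)) \<le> 0"
    by (rule second_derivative_max[OF 1 DERIV_cmult[OF 2]]) (simp only: n power_mono max norm_ge_zero scaleR_zero_left add_0_right)
  moreover have "Re (cnj (?D x\<^sub>0) * ?D x\<^sub>0) \<ge> 0" unfolding n by simp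
  moreover have "b \<le> 0" if "2 * (a + b) \<le> 0" "0 \<le> a" for a b :: real
    using that by simp
  ultimately show ?thesis
    by (simp only: scaleR_zero_left add_0_right plus_complex.simps)
qed

text \<open>The automorphy factors have modulus 1, so the norm is periodic and takes all its values
  on the compact unit cube.\<close>

lemma norm_lsections_attains_max:
  assumes "f \<in> lsections d"
  obtains x\<^sub>0 where "\<And>x. norm (f x) \<le> norm (f x\<^sub>0)"
proof -
  let ?C = "cbox 0 (\<chi> i. 1) :: (real ^ 8) set"
  have "continuous_on ?C (\<lambda>x. norm (f x))"
    using smooth_on_continuous[OF lsections_smooth[OF assms]]
    by (intro continuous_on_norm) (rule continuous_on_subset, auto)
  moreover have "0 \<in> ?C" by (simp add: mem_box_cart)
  ultimately obtain x\<^sub>0 where x0: "\<And>x. x \<in> ?C \<Longrightarrow> norm (f x) \<le> norm (f x\<^sub>0)"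
    using continuous_attains_sup[of ?C "\<lambda>x. norm (f x)"] by auto
  have "norm (f x) \<le> norm (f x\<^sub>0)" for x
  proof -
    have "f (x - floor_vec x + floor_vec x) = automorphy d (floor_vec x) (x - floor_vec x) * f (x - floor_vec x)"
      using assms floor_vec_lattice unfolding lsections_def by blast
    then have "norm (f x) = norm (f (x - floor_vec x))"
      by (simp add: norm_mult norm_automorphy)
    moreover have "x - floor_vec x \<in> ?C"
      by (auto simp: mem_box_cart floor_vec_def; linarith)
    ultimately show ?thesis using x0 by simp
  qed
  then show ?thesis using that by blast
qed

text \<open>A sum of squares without a minus sign; the eigenvalues meant in the overview are those
  of its negative.\<close>

definition laplacian :: "(real ^ 8 \<Rightarrow> complex) \<Rightarrow> real ^ 8 \<Rightarrow> complex" where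
  "laplacian f x = (\<Sum>k\<in>{1..8}. nabla d k (nabla d k f) x)"

text \<open>At a maximum point of the norm, the Laplacian paired with \<open>f\<close> has
  nonpositive real part, but the equation makes it \<open>c\<close> times the squared
  maximum.\<close>

lemma positive_eigenvalue_trivial:
  assumes f: "f \<in> lsections d" and eq: "\<And>x. laplacian f x = of_real c * f x" and "c > 0"
  shows "f x = 0"
proof -
  obtain x\<^sub>0 where x0: "\<And>x. norm (f x) \<le> norm (f x\<^sub>0)"
    using norm_lsections_attains_max[OF f] by blast
  have "(\<Sum>k\<in>{1..8}. Re (cnj (f x\<^sub>0) * nabla d k (nabla d k f) x\<^sub>0)) \<le> 0"
    using Re_nabla_nabla_at_max[OF lsections_smooth[OF f] x0] by (intro sum_nonpos) auto
  moreover have "(\<Sum>k\<in>{1..8}. Re (cnj (f x\<^sub>0) * nabla d k (nabla d k f) x\<^sub>0)) = Re (cnj (f x\<^sub>0) * laplacian f x\<^sub>0)"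
    unfolding laplacian_def sum_distrib_left Re_sum ..
  moreover have "Re (cnj (f x\<^sub>0) * laplacian f x\<^sub>0) = c * (norm (f x\<^sub>0))\<^sup>2"
    unfolding eq cmod_power2 by (simp add: power2_eq_square algebra_simps)
  ultimately have "norm (f x\<^sub>0) = 0"
    using \<open>c > 0\<close> by (simp add: mult_le_0_iff)
  then show ?thesis using x0[of x] by simp
qed

text \<open>As the curvature is constant, moving \<open>nabla d l\<close> past either of the two
  factors \<open>nabla d k\<close> produces the same term, hence the 2.\<close>

lemma nabla_laplacian:
  assumes f: "smooth_on UNIV f"
  shows "laplacian (nabla d l f) x = nabla d l (laplacian f) x + 2 * (\<Sum>k\<in>{1..8}. curv d k l * nabla d k f x)"
proof -
  have *: "nabla d k (nabla d k (nabla d l f)) x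
      = nabla d l (nabla d k (nabla d k f)) x + 2 * (curv d k l * nabla d k f x)" for k
  proof -
    have "nabla d k (nabla d l f) = (\<lambda>x. nabla d l (nabla d k f) x + curv d k l * f x)"
      using nabla_commutator[OF f] by blast
    then have "nabla d k (nabla d k (nabla d l f)) x
        = nabla d k (nabla d l (nabla d k f)) x + curv d k l * nabla d k f x"
      using f by (simp add: nabla_add nabla_cmult smooth_nabla smooth_on_mult smooth_on_const)
    then show ?thesis using nabla_commutator[OF smooth_nabla[OF f], where d1 = d and k = k and l = l and x = x] by simp
  qed
  have "nabla d l (laplacian f) x = (\<Sum>k\<in>{1..8}. nabla d l (nabla d k (nabla d k f)) x)"
    unfolding laplacian_def[abs_def] using f by (intro nabla_sum) (simp add: smooth_nabla)
  then show ?thesis by (simp add: laplacian_def[of "nabla d l f"] * sum.distrib sum_distrib_left)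
qed

section \<open>Ladder operators of the Landau levels\<close>

definition kappa :: "nat \<Rightarrow> real" where
  "kappa j = 2 * pi * of_int (d j)"

text \<open>The annihilation operator in the plane of the coordinates \<open>2 * j + 1\<close> and
  \<open>2 * j + 2\<close>. The sign of the field decides which of the two Cauchy-Riemann operators
  lowers the energy.\<close>

definition lowering :: "nat \<Rightarrow> (real ^ 8 \<Rightarrow> complex) \<Rightarrow> real ^ 8 \<Rightarrow> complex" where
  "lowering j f x = nabla d (2 * j + 1) f x + (- \<i> * of_real (sgn (kappa j))) * nabla d (2 * j + 2) f x"

lemma curv_pair:
  assumes "j < 4" "k \<in> {1..8}"
  shows "curv d k (2 * j + 1) = (if k = 2 * j + 2 then - \<i> * of_real (kappa j) else 0)"
    "curv d k (2 * j + 2) = (if k = 2 * j + 1 then \<i> * of_real (kappa j) else 0)"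
  using assms by (auto simp: curv_def pairing_evec kappa_def)

lemma lowering_lsections: "f \<in> lsections d \<Longrightarrow> lowering j f \<in> lsections d"
  unfolding lowering_def[abs_def] by (intro lsections_lincomb nabla_lsections)

lemma laplacian_lincomb:
  assumes "smooth_on UNIV f" "smooth_on UNIV g"
  shows "laplacian (\<lambda>x. f x + c * g x) x = laplacian f x + c * laplacian g x"
proof -
  have "nabla d k (\<lambda>x. f x + c * g x) = (\<lambda>x. nabla d k f x + c * nabla d k g x)"
    if "smooth_on UNIV f" "smooth_on UNIV g" for f g k
    using that by (intro ext) (simp add: nabla_add nabla_cmult smooth_on_mult smooth_on_const)
  then show ?thesis using assms
    by (simp add: laplacian_def smooth_nabla sum.distrib sum_distrib_left)
qed

text \<open>Commuting with the Laplacian maps the two derivatives of the plane to multiples of each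
  other; \<open>lowering\<close> is the combination on which this map is multiplication by
  \<open>2 * \<bar>kappa j\<bar>\<close>.\<close>

lemma laplacian_lowering:
  assumes f: "f \<in> lsections d" and j: "j < 4" and eq: "\<And>x. laplacian f x = of_real c * f x"
  shows "laplacian (lowering j f) x = of_real (c + 2 * \<bar>kappa j\<bar>) * lowering j f x"
proof -
  let ?x = "2 * j + 1" and ?y = "2 * j + 2" and ?s = "of_real (sgn (kappa j)) :: complex"
  have s: "smooth_on UNIV f" using f by (rule lsections_smooth)
  have eq': "laplacian f = (\<lambda>x. of_real c * f x)" using eq by blast
  have L: "laplacian (nabla d l f) x = of_real c * nabla d l f x + 2 * (\<Sum>k\<in>{1..8}. curv d k l * nabla d k f x)" for l
    using nabla_laplacian[OF s, of l x] nabla_cmult[OF s] by (simp add: eq')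
  have yx: "?x \<in> {1..8}" "?y \<in> {1..8}" using j by auto
  have "(\<Sum>k\<in>{1..8}. curv d k ?x * nabla d k f x) = (\<Sum>k\<in>{1..8}. if k = ?y then - \<i> * of_real (kappa j) * nabla d ?y f x else 0)"
    by (rule sum.cong[OF refl], subst curv_pair(1)[OF j]) auto
  then have Lx: "laplacian (nabla d ?x f) x = of_real c * nabla d ?x f x - 2 * \<i> * of_real (kappa j) * nabla d ?y f x"
    using yx by (simp only: L sum.delta[OF finite_atLeastAtMost]) simp
  have "(\<Sum>k\<in>{1..8}. curv d k ?y * nabla d k f x) = (\<Sum>k\<in>{1..8}. if k = ?x then \<i> * of_real (kappa j) * nabla d ?x f x else 0)"
    by (rule sum.cong[OF refl], subst curv_pair(2)[OF j]) auto
  then have Ly: "laplacian (nabla d ?y f) x = of_real c * nabla d ?y f x + 2 * \<i> * of_real (kappa j) * nabla d ?x f x"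
    using yx by (simp only: L sum.delta[OF finite_atLeastAtMost]) simp
  have a: "of_real \<bar>kappa j\<bar> = ?s * of_real (kappa j)" by (simp flip: of_real_mult add: sgn_mult_abs abs_sgn mult.commute)
  \<comment> \<open>Lets the sign be factored out of the second derivative term; in this form it
    also holds for \<open>kappa j = 0\<close>.\<close>
  have b: "of_real (kappa j) = ?s * (?s * of_real (kappa j))" by (simp flip: of_real_mult add: sgn_if)
  have "laplacian (lowering j f) x = laplacian (nabla d ?x f) x + (- \<i> * ?s) * laplacian (nabla d ?y f) x"
    unfolding lowering_def[abs_def] by (intro laplacian_lincomb smooth_nabla s)
  also have "\<dots> = of_real c * lowering j f x
      + 2 * (?s * of_real (kappa j)) * nabla d ?x f x - 2 * \<i> * of_real (kappa j) * nabla d ?y f x"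
    unfolding Lx Ly lowering_def by (simp add: algebra_simps)
  also have "2 * \<i> * of_real (kappa j) * nabla d ?y f x = 2 * \<i> * (?s * (?s * of_real (kappa j))) * nabla d ?y f x"
    using b by simp
  also have "of_real c * lowering j f x + 2 * (?s * of_real (kappa j)) * nabla d ?x f x
      - 2 * \<i> * (?s * (?s * of_real (kappa j))) * nabla d ?y f x
    = of_real c * lowering j f x + 2 * (?s * of_real (kappa j)) * lowering j f x"
    unfolding lowering_def by (simp add: algebra_simps)
  finally show ?thesis using a by (simp add: algebra_simps)
qed

text \<open>On the kernel each of the two derivatives is \<open>\<plusminus>\<i>\<close> times the
  other, so the sum of squares collapses to a multiple of their commutator. This is the zero-point
  energy of the oscillator.\<close>

lemma lowering_zero:
  assumes f: "f \<in> lsections d" and j: "j < 4" and dj: "d j \<noteq> 0" and eq: "\<And>x. lowering j f x = 0"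
  shows "nabla d (2 * j + 1) (nabla d (2 * j + 1) f) x + nabla d (2 * j + 2) (nabla d (2 * j + 2) f) x
    = - of_real \<bar>kappa j\<bar> * f x"
proof -
  let ?x = "2 * j + 1" and ?y = "2 * j + 2" and ?s = "of_real (sgn (kappa j)) :: complex"
  have s: "smooth_on UNIV f" using f by (rule lsections_smooth)
  have a: "of_real \<bar>kappa j\<bar> = ?s * of_real (kappa j)" by (simp flip: of_real_mult add: sgn_mult_abs abs_sgn mult.commute)
  have b: "?s * ?s = 1" using dj by (simp flip: of_real_mult add: sgn_if kappa_def)
  have x: "nabla d ?x f = (\<lambda>x. \<i> * ?s * nabla d ?y f x)"
    using eq by (intro ext) (simp add: lowering_def algebra_simps)
  have y: "nabla d ?y f = (\<lambda>x. - \<i> * ?s * nabla d ?x f x)"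
  proof
    fix z
    have "- \<i> * ?s * (\<i> * ?s * nabla d ?y f z) = (?s * ?s) * nabla d ?y f z"
      using i_squared by algebra
    also have "\<dots> = nabla d ?y f z" unfolding b by simp
    finally show "nabla d ?y f z = - \<i> * ?s * nabla d ?x f z" by (simp only: x)
  qed
  have 1: "nabla d ?x (nabla d ?x f) x = \<i> * ?s * nabla d ?x (nabla d ?y f) x"
    by (rule trans[OF arg_cong[OF x, of "\<lambda>g. nabla d ?x g x"] nabla_cmult[OF smooth_nabla[OF s]]])
  have 2: "nabla d ?y (nabla d ?y f) x = - \<i> * ?s * nabla d ?y (nabla d ?x f) x"
    by (rule trans[OF arg_cong[OF y, of "\<lambda>g. nabla d ?y g x"] nabla_cmult[OF smooth_nabla[OF s]]])
  have "nabla d ?x (nabla d ?y f) x = nabla d ?y (nabla d ?x f) x + curv d ?x ?y * f x"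
    by (rule nabla_commutator[OF s])
  moreover have "curv d ?x ?y = \<i> * of_real (kappa j)"
    using curv_pair(2)[OF j, of ?x] j by simp
  ultimately show ?thesis unfolding 1 2 a by (simp add: algebra_simps)
qed

lemma sum_1_8_pairs: "(\<Sum>k\<in>{1..8::nat}. g k) = (\<Sum>j<4. g (2 * j + 1) + g (2 * j + 2))"
proof -
  have "{..<4::nat} = {0, 1, 2, 3}" by auto
  then show ?thesis unfolding atLeastAtMost_1_8 by (simp add: add_ac numeral_2_eq_2[symmetric] del: One_nat_def)
qed

text \<open>Each ladder operator lowers \<open>E\<close> by at least \<open>4\<pi>\<close>, and \<open>E < 0\<close> is excluded by the maximum
  principle. If all ladder operators annihilate \<open>f\<close>, then \<open>f\<close> has the eigenvalue \<open>\<Sum>j. \<bar>\<kappa>\<^sub>j\<bar>\<close>.\<close>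

lemma laplacian_eigenvalue_bound:
  assumes nz: "\<And>j. j < 4 \<Longrightarrow> d j \<noteq> 0"
  shows "f \<in> lsections d \<Longrightarrow> (\<And>x. laplacian f x = - of_real E * f x) \<Longrightarrow> E < 4 * pi * real n
    \<Longrightarrow> E < (\<Sum>j<4. \<bar>kappa j\<bar>) \<Longrightarrow> f = (\<lambda>x. 0)"
proof (induction n arbitrary: f E)
  case 0
  show ?case
  proof
    fix x
    show "f x = 0"
      by (rule positive_eigenvalue_trivial[OF 0(1), of "- E"]) (simp add: 0(2), use 0(3) in simp)
  qed
next
  case (Suc n)
  have "lowering j f = (\<lambda>x. 0)" if j: "j < 4" for j
  proof (rule Suc.IH[OF lowering_lsections[OF Suc.prems(1)]])
    have "\<bar>kappa j\<bar> = 2 * pi * \<bar>of_int (d j)\<bar>" by (simp add: kappa_def abs_mult)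
    moreover have "\<bar>of_int (d j) :: real\<bar> \<ge> 1" using nz[OF j] by linarith
    ultimately have k: "\<bar>kappa j\<bar> \<ge> 2 * pi" by simp
    show "laplacian (lowering j f) x = - of_real (E - 2 * \<bar>kappa j\<bar>) * lowering j f x" for x
      using laplacian_lowering[OF Suc.prems(1) j, of "- E" x] Suc.prems(2) by simp
    show "E - 2 * \<bar>kappa j\<bar> < 4 * pi * real n" using Suc.prems(3) k by (simp add: algebra_simps)
    show "E - 2 * \<bar>kappa j\<bar> < (\<Sum>j<4. \<bar>kappa j\<bar>)" using Suc.prems(4) by (simp add: algebra_simps)
  qed
  then have *: "nabla d (2 * j + 1) (nabla d (2 * j + 1) f) x + nabla d (2 * j + 2) (nabla d (2 * j + 2) f) x
    = - of_real \<bar>kappa j\<bar> * f x" if "j < 4" for j x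
    using lowering_zero[OF Suc.prems(1) that nz[OF that]] that by simp
  show ?case
  proof
    fix x
    have "laplacian f x = (\<Sum>j<4. - of_real \<bar>kappa j\<bar> * f x)"
      unfolding laplacian_def sum_1_8_pairs using * by (intro sum.cong) auto
    also have "\<dots> = - of_real (\<Sum>j<4. \<bar>kappa j\<bar>) * f x"
      by (simp add: sum_distrib_right sum_negf)
    finally have "of_real (E - (\<Sum>j<4. \<bar>kappa j\<bar>)) * f x = 0"
      using Suc.prems(2)[of x] by (simp add: algebra_simps)
    then show "f x = 0" using Suc.prems(4) by (simp only: mult_eq_0_iff of_real_eq_0_iff) simp
  qed
qed

end

subsection \<open>The flat Dirac operator\<close>

definition dirac_flat :: "(nat \<Rightarrow> int) \<Rightarrow> (spin_index \<Rightarrow> real ^ 8 \<Rightarrow> complex) \<Rightarrow> spin_index \<Rightarrow> real ^ 8 \<Rightarrow> complex" where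
  "dirac_flat d F b x = (\<Sum>k\<in>{1..8}. \<Sum>e\<in>UNIV. gamma k $ b $ e * nabla d k (F e) x)"

lemma gamma_mult_sum: "(gamma k ** gamma l) $ b $ c = (\<Sum>e\<in>UNIV. gamma k $ b $ e * gamma l $ e $ c)"
  by (simp add: matrix_matrix_mult_def)

lemma smooth_sum_gamma:
  assumes "\<And>e. smooth_on UNIV (F e)"
  shows "smooth_on UNIV (\<lambda>x. \<Sum>e\<in>(UNIV :: spin_index set). gamma k $ b $ e * nabla d k (F e) x)"
  by (intro smooth_on_sum smooth_on_mult smooth_on_const smooth_nabla assms) auto

lemma gamma_pair_swap:
  assumes "j < 4"
  shows "(gamma (2 * j + 2) ** gamma (2 * j + 1)) $ a $ b = (if a = b then \<i> * of_int (spin_sign j a) else 0)"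
proof -
  have "gamma (2 * j + 1) ** gamma (2 * j + 2) + gamma (2 * j + 2) ** gamma (2 * j + 1) = 0"
    using gamma_clifford[of "2 * j + 1" "2 * j + 2"] assms by simp
  then have "(gamma (2 * j + 1) ** gamma (2 * j + 2) + gamma (2 * j + 2) ** gamma (2 * j + 1)) $ a $ b = 0"
    by simp
  then have "(gamma (2 * j + 1) ** gamma (2 * j + 2)) $ a $ b + (gamma (2 * j + 2) ** gamma (2 * j + 1)) $ a $ b = 0"
    by (simp only: vector_add_component)
  then show ?thesis unfolding gamma_pair[OF assms] by (auto simp: add_eq_0_iff split: if_splits)
qed

text \<open>The Weitzenboeck formula: as the curvature only pairs \<open>2j+1\<close> with \<open>2j+2\<close>, the curvature
  term is diagonal in the standard basis of the spinor module.\<close>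

lemma dirac_flat_laplacian:
  assumes F: "\<And>e. smooth_on UNIV (F e)" and ker: "\<And>b x. dirac_flat d F b x = 0"
  shows "laplacian d (F b) x = of_real (2 * pi * of_int (\<Sum>j<4. spin_sign j b * d j)) * F b x"
proof -
  define X where "X k l c = nabla d k (nabla d l (F c)) x" for k l c
  define G where "G k l = (\<Sum>c\<in>UNIV. (gamma k ** gamma l) $ b $ c * X k l c)" for k l
  define W where "W k l = (\<Sum>c\<in>UNIV. (gamma k ** gamma l) $ b $ c * F c x)" for k l
  \<comment> \<open>The sum over \<open>l\<close> is component \<open>b\<close> of
    \<open>gamma k\<close> applied to the k-th covariant derivative of the Dirac equation.\<close>
  have "(\<Sum>l\<in>{1..8}. G k l) = 0" for k
  proof -
    have z: "(\<Sum>l\<in>{1..8}. \<Sum>c\<in>UNIV. gamma l $ e $ c * X k l c) = 0" for e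
    proof -
      have "dirac_flat d F e = (\<lambda>x. 0)" using ker by blast
      then have "0 = nabla d k (dirac_flat d F e) x" by (simp add: nabla_zero)
      also have "\<dots> = (\<Sum>l\<in>{1..8}. nabla d k (\<lambda>x. \<Sum>c\<in>UNIV. gamma l $ e $ c * nabla d l (F c) x) x)"
        unfolding dirac_flat_def[abs_def] by (intro nabla_sum smooth_sum_gamma F)
      also have "\<dots> = (\<Sum>l\<in>{1..8}. \<Sum>c\<in>UNIV. gamma l $ e $ c * X k l c)"
        unfolding X_def
        by (subst nabla_sum) (simp_all add: nabla_cmult smooth_nabla F smooth_on_mult smooth_on_const)
      finally show ?thesis by simp
    qed
    have "(\<Sum>l\<in>{1..8}. G k l) = (\<Sum>l\<in>{1..8}. \<Sum>c\<in>UNIV. \<Sum>e\<in>UNIV. gamma k $ b $ e * (gamma l $ e $ c * X k l c))"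
      unfolding G_def gamma_mult_sum sum_distrib_right by (simp only: mult.assoc)
    also have "\<dots> = (\<Sum>l\<in>{1..8}. \<Sum>e\<in>UNIV. \<Sum>c\<in>UNIV. gamma k $ b $ e * (gamma l $ e $ c * X k l c))"
      by (intro sum.cong[OF refl] sum.swap)
    also have "\<dots> = (\<Sum>e\<in>UNIV. \<Sum>l\<in>{1..8}. \<Sum>c\<in>UNIV. gamma k $ b $ e * (gamma l $ e $ c * X k l c))"
      by (rule sum.swap)
    also have "\<dots> = (\<Sum>e\<in>UNIV. gamma k $ b $ e * (\<Sum>l\<in>{1..8}. \<Sum>c\<in>UNIV. gamma l $ e $ c * X k l c))"
      unfolding sum_distrib_left ..
    also have "\<dots> = 0" unfolding z by simp
    finally show ?thesis .
  qed
  then have S: "(\<Sum>k\<in>{1..8}. \<Sum>l\<in>{1..8}. G k l) = 0" by simp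
  then have "(\<Sum>k\<in>{1..8}. \<Sum>l\<in>{1..8}. G l k) = 0"
    by (subst sum.swap)
  \<comment> \<open>Adding the transposed double sum brings in the anticommutators of the gamma
    matrices; the order of the two derivatives is then corrected by the curvature.\<close>
  with S have "(\<Sum>k\<in>{1..8}. \<Sum>l\<in>{1..8}. G k l + G l k) = 0"
    by (simp add: sum.distrib)
  moreover have "G k l + G l k = (if l = k then - 2 * X k k b else 0) - curv d k l * W l k"
    if k: "k \<in> {1..8}" and l: "l \<in> {1..8}" for k l
  proof -
    have comm: "X k l c = X l k c + curv d k l * F c x" for c
      unfolding X_def by (rule nabla_commutator[OF F])
    have cl: "(gamma k ** gamma l) $ b $ c + (gamma l ** gamma k) $ b $ c = (if l = k \<and> c = b then - 2 else 0)" for c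
    proof -
      have "(gamma k ** gamma l + gamma l ** gamma k) $ b $ c = (if k = l then - 2 *\<^sub>R mat 1 else 0) $ b $ c"
        by (simp only: gamma_clifford[OF k l])
      then show ?thesis by (auto simp: mat_def scaleR_conv_of_real)
    qed
    have "G k l + G l k = (\<Sum>c\<in>UNIV. ((gamma k ** gamma l) $ b $ c + (gamma l ** gamma k) $ b $ c) * X k l c
        - curv d k l * ((gamma l ** gamma k) $ b $ c * F c x))"
      unfolding G_def sum.distrib[symmetric] by (intro sum.cong) (auto simp: comm algebra_simps)
    also have "\<dots> = (\<Sum>c\<in>UNIV. if c = b then (if l = k then - 2 * X k l b else 0) else 0) - curv d k l * W l k"
      unfolding sum_subtractf W_def sum_distrib_left cl
      by (intro arg_cong2[of _ _ _ _ "(-)"] sum.cong refl) auto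
    finally show ?thesis by simp
  qed
  ultimately have "(\<Sum>k\<in>{1..8}. \<Sum>l\<in>{1..8}. (if l = k then - 2 * X k k b else 0) - curv d k l * W l k) = 0"
    by simp
  then have 1: "(\<Sum>k\<in>{1..8}. \<Sum>l\<in>{1..8}. curv d k l * W l k) = - 2 * laplacian d (F b) x"
    by (simp add: sum_subtractf laplacian_def X_def sum_distrib_left sum_negf)
  have "(\<Sum>k\<in>{1..8}. \<Sum>l\<in>{1..8}. curv d k l * W l k)
    = (2 * pi * \<i>) * ((\<Sum>k\<in>{1..8}. \<Sum>l\<in>{1..8}. of_real (pairing d (evec k) (evec l)) * W l k)
      - (\<Sum>k\<in>{1..8}. \<Sum>l\<in>{1..8}. of_real (pairing d (evec l) (evec k)) * W l k))"
    unfolding curv_def sum_subtractf[symmetric] sum_distrib_left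
    by (intro sum.cong refl) (simp add: algebra_simps)
  also have "(\<Sum>k\<in>{1..8}. \<Sum>l\<in>{1..8}. of_real (pairing d (evec l) (evec k)) * W l k)
     = (\<Sum>k\<in>{1..8}. \<Sum>l\<in>{1..8}. of_real (pairing d (evec k) (evec l)) * W k l)"
    by (rule sum.swap)
  also have "\<dots> = (\<Sum>j<4. of_int (d j) * W (2 * j + 1) (2 * j + 2))"
    by (rule sum_pairing_evec)
  also have "(\<Sum>k\<in>{1..8}. \<Sum>l\<in>{1..8}. of_real (pairing d (evec k) (evec l)) * W l k)
      = (\<Sum>j<4. of_int (d j) * W (2 * j + 2) (2 * j + 1))"
    by (rule sum_pairing_evec)
  also have "(\<Sum>j<4. of_int (d j) * W (2 * j + 2) (2 * j + 1)) - (\<Sum>j<4. of_int (d j) * W (2 * j + 1) (2 * j + 2))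
      = (\<Sum>j<4. 2 * \<i> * of_int (spin_sign j b * d j) * F b x)"
    unfolding sum_subtractf[symmetric]
  proof (rule sum.cong[OF refl])
    fix j :: nat assume "j \<in> {..<4}"
    then have j: "j < 4" by simp
    have "W (2 * j + 1) (2 * j + 2) = - \<i> * of_int (spin_sign j b) * F b x"
      "W (2 * j + 2) (2 * j + 1) = \<i> * of_int (spin_sign j b) * F b x"
      unfolding W_def gamma_pair[OF j] gamma_pair_swap[OF j]
      by (simp_all add: if_distrib if_distribR cong: if_cong)
    then show "of_int (d j) * W (2 * j + 2) (2 * j + 1) - of_int (d j) * W (2 * j + 1) (2 * j + 2)
        = 2 * \<i> * of_int (spin_sign j b * d j) * F b x"
      by (simp add: algebra_simps)
  qed
  also have "\<dots> = 2 * \<i> * of_int (\<Sum>j<4. spin_sign j b * d j) * F b x"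
    by (simp add: sum_distrib_left sum_distrib_right)
  finally have "- 2 * laplacian d (F b) x = (2 * pi * \<i>) * (2 * \<i> * of_int (\<Sum>j<4. spin_sign j b * d j) * F b x)"
    using 1 by simp
  also have "\<dots> = - 2 * (2 * pi * of_int (\<Sum>j<4. spin_sign j b * d j) * F b x)"
    unfolding of_real_mult of_real_of_int_eq using i_squared by algebra
  finally show ?thesis by simp
qed

lemma spin_sign_cases: "spin_sign j b = 1 \<or> spin_sign j b = - 1"
  by (cases b) (simp add: spin_sign_def)

lemma chirality_prod: "chirality b = (\<Prod>j<4. spin_sign j b)"
  by (simp add: chirality_def eval_nat_numeral)

text \<open>The strict inequality comes from chirality: if all four signs were
  \<open>- sgn (d j)\<close>, the minus signs would cancel in the product and the chirality would be
  the excluded one.\<close>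

lemma dirac_flat_kernel_chirality:
  assumes nz: "\<And>j. j < 4 \<Longrightarrow> d j \<noteq> 0"
    and F: "\<And>e. F e \<in> lsections d" and ker: "\<And>b x. dirac_flat d F b x = 0"
    and b: "chirality b \<noteq> (\<Prod>j<4. sgn (d j))"
  shows "F b = (\<lambda>x. 0)"
proof -
  define E where "E = - (2 * pi * of_int (\<Sum>j<4. spin_sign j b * d j))"
  have le: "- (spin_sign j b * d j) \<le> \<bar>d j\<bar>" for j
    using spin_sign_cases[of j b] by auto
  have "\<exists>j<4. - (spin_sign j b * d j) \<noteq> \<bar>d j\<bar>"
  proof (rule ccontr)
    assume "\<not> ?thesis"
    then have "spin_sign j b = - sgn (d j)" if "j < 4" for j
      using that nz[OF that] spin_sign_cases[of j b] by (auto simp: sgn_if split: if_splits)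
    then have "chirality b = (\<Prod>j<4. - sgn (d j))"
      unfolding chirality_prod by (intro prod.cong) auto
    also have "\<dots> = (\<Prod>j<4. sgn (d j))" by (simp add: eval_nat_numeral)
    finally show False using b by simp
  qed
  then have "(\<Sum>j<4. - (spin_sign j b * d j)) < (\<Sum>j<4. \<bar>d j\<bar>)"
    using le by (intro sum_strict_mono_ex1) (auto simp: order_less_le)
  then have "real_of_int (\<Sum>j<4. - (spin_sign j b * d j)) < of_int (\<Sum>j<4. \<bar>d j\<bar>)"
    by (simp only: of_int_less_iff)
  then have "2 * pi * real_of_int (\<Sum>j<4. - (spin_sign j b * d j)) < 2 * pi * of_int (\<Sum>j<4. \<bar>d j\<bar>)"
    by simp
  moreover have "2 * pi * real_of_int (\<Sum>j<4. - (spin_sign j b * d j)) = E"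
    unfolding E_def sum_negf by simp
  moreover have "2 * pi * of_int (\<Sum>j<4. \<bar>d j\<bar>) = (\<Sum>j<4. \<bar>kappa d j\<bar>)"
    by (simp add: kappa_def abs_mult sum_distrib_left)
  ultimately have lt: "E < (\<Sum>j<4. \<bar>kappa d j\<bar>)" by (simp only:)
  obtain n where "E < 4 * pi * real n"
    using reals_Archimedean3[of "4 * pi"] by (metis mult.commute pi_gt_zero zero_less_mult_iff zero_less_numeral)
  moreover have "laplacian d (F b) x = - of_real E * F b x" for x
    unfolding dirac_flat_laplacian[OF lsections_smooth[OF F] ker] by (simp add: E_def)
  ultimately show ?thesis
    using laplacian_eigenvalue_bound[OF nz F _ _ lt] by blast
qed

subsection \<open>Theta functions\<close>

text \<open>The series \<open>\<Sum>n\<in>\<int>. q\<^bsup>n\<^sup>2\<^esup> exp (n z)\<close> is split at \<open>n = 0\<close> into entire power series in \<open>exp z\<close> and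
  \<open>exp (- z)\<close>.\<close>

definition half_theta :: "real \<Rightarrow> complex \<Rightarrow> complex" where
  "half_theta q w = (\<Sum>n. of_real (q ^ (n * n)) * w ^ n)"

text \<open>Each term has norm \<open>(q ^ n * norm w) ^ n\<close>, and the base tends to 0 for
  every \<open>w\<close>, so the series has infinite radius of convergence.\<close>

lemma half_theta_summable:
  assumes "0 \<le> q" "q < 1"
  shows "summable (\<lambda>n. of_real (q ^ (n * n)) * w ^ n :: complex)"
proof -
  have "(\<lambda>n. q ^ n * norm w) \<longlonglongrightarrow> 0 * norm w"
    using assms by (intro tendsto_mult LIMSEQ_realpow_zero tendsto_const) auto
  then have "\<forall>\<^sub>F n in sequentially. q ^ n * norm w < 1 / 2"
    by (rule order_tendstoD(2)) simp
  then have "\<forall>\<^sub>F n in sequentially. norm (of_real (q ^ (n * n)) * w ^ n) \<le> (1 / 2) ^ n"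
  proof (rule eventually_mono)
    fix n assume n: "q ^ n * norm w < 1 / 2"
    have "norm (of_real (q ^ (n * n)) * w ^ n) = (q ^ n * norm w) ^ n"
      using assms by (simp add: norm_mult norm_power power_mult power_mult_distrib)
    also have "\<dots> \<le> (1 / 2) ^ n" using n assms by (intro power_mono) auto
    finally show "norm (of_real (q ^ (n * n)) * w ^ n) \<le> (1 / 2) ^ n" .
  qed
  then show ?thesis by (rule summable_comparison_test_ev) (simp add: summable_geometric)
qed

lemma half_theta_holomorphic:
  assumes "0 \<le> q" "q < 1"
  shows "half_theta q holomorphic_on UNIV"
proof -
  have "half_theta q holomorphic_on ball 0 r" for r
  proof (rule power_series_holomorphic)
    fix w :: complex
    show "(\<lambda>n. of_real (q ^ (n * n)) * (w - 0) ^ n) sums half_theta q w"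
      unfolding half_theta_def using half_theta_summable[OF assms] by (simp add: summable_sums)
  qed
  then have "half_theta q field_differentiable at w" for w
    by (rule holomorphic_on_imp_differentiable_at[of _ "ball 0 (norm w + 1)"]) auto
  then show ?thesis
    by (simp add: holomorphic_on_def)
qed

text \<open>Shift the index and use (n + 1)^2 = n^2 + 2 n + 1; this is half of the quasi-periodicity
  of theta.\<close>

lemma half_theta_rec:
  assumes "0 \<le> q" "q < 1"
  shows "half_theta q w = 1 + of_real q * w * half_theta q (of_real (q\<^sup>2) * w)"
proof -
  have "half_theta q w = 1 + (\<Sum>n. of_real (q ^ (Suc n * Suc n)) * w ^ Suc n)"
    unfolding half_theta_def by (subst suminf_split_head[OF half_theta_summable[OF assms]]) simp
  also have "(\<lambda>n. of_real (q ^ (Suc n * Suc n)) * w ^ Suc n)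
      = (\<lambda>n. of_real q * w * (of_real (q ^ (n * n)) * (of_real (q\<^sup>2) * w) ^ n))"
  proof
    fix n
    have e: "Suc n * Suc n = Suc (n * n) + 2 * n" by simp
    have "of_real (q ^ (Suc n * Suc n)) * w ^ Suc n
        = of_real (q * q ^ (n * n) * (q\<^sup>2) ^ n) * (w * w ^ n)"
      unfolding e power_add power_Suc power_mult ..
    then show "of_real (q ^ (Suc n * Suc n)) * w ^ Suc n
        = of_real q * w * (of_real (q ^ (n * n)) * (of_real (q\<^sup>2) * w) ^ n)"
      by (simp only: of_real_mult of_real_power power_mult_distrib mult_ac)
  qed
  also have "suminf \<dots> = of_real q * w * half_theta q (of_real (q\<^sup>2) * w)"
    unfolding half_theta_def by (rule suminf_mult[OF half_theta_summable[OF assms]])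
  finally show ?thesis .
qed

text \<open>The term at n = 0 occurs in both halves, hence the \<open>- 1\<close>.\<close>

definition theta :: "real \<Rightarrow> complex \<Rightarrow> complex" where
  "theta q z = half_theta q (exp z) + half_theta q (exp (- z)) - 1"

lemma theta_holomorphic:
  assumes "0 \<le> q" "q < 1"
  shows "theta q holomorphic_on UNIV"
proof -
  have "(half_theta q \<circ> (\<lambda>z. exp (c * z))) holomorphic_on UNIV" for c
    by (rule holomorphic_on_compose_gen[OF _ half_theta_holomorphic[OF assms]]) (auto intro!: holomorphic_intros)
  from this[of 1] this[of "-1"] show ?thesis
    unfolding theta_def[abs_def] by (intro holomorphic_intros) (simp_all add: o_def)
qed

text \<open>The shift multiplies w = exp z by q^2. After one use of the recursion on each side, the
  split-off 1 absorbs the \<open>- 1\<close>, and both sides are combinations of the half series at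
  q^2 w and at 1 / w.\<close>

lemma theta_shift:
  assumes "0 < q" "q < 1"
  shows "theta q (z + of_real (2 * ln q)) = theta q z / (of_real q * exp z)"
proof -
  define w where "w = exp z"
  have w: "w \<noteq> 0" and q: "complex_of_real q \<noteq> 0" using assms by (auto simp: w_def)
  have e: "exp (z + of_real (2 * ln q)) = of_real (q\<^sup>2) * w"
  proof -
    have "exp (of_real (2 * ln q)) = complex_of_real (exp (2 * ln q))" by (simp only: exp_of_real)
    also have "exp (2 * ln q) = q\<^sup>2" using assms by (simp add: exp_double)
    finally show ?thesis unfolding exp_add w_def by simp
  qed
  have e': "exp (- (z + of_real (2 * ln q))) = inverse (of_real (q\<^sup>2) * w)"
    unfolding exp_minus e ..
  have e'': "exp (- z) = inverse w" by (simp add: exp_minus w_def)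
  have 1: "half_theta q w = 1 + of_real q * w * half_theta q (of_real (q\<^sup>2) * w)"
    using assms by (intro half_theta_rec) auto
  have "half_theta q (inverse (of_real (q\<^sup>2) * w))
     = 1 + of_real q * inverse (of_real (q\<^sup>2) * w) * half_theta q (of_real (q\<^sup>2) * inverse (of_real (q\<^sup>2) * w))"
    using assms by (intro half_theta_rec) auto
  also have "of_real (q\<^sup>2) * inverse (of_real (q\<^sup>2) * w) = inverse w"
    using q w by (simp add: field_simps)
  finally have 2: "half_theta q (inverse (of_real (q\<^sup>2) * w))
     = 1 + of_real q * inverse (of_real (q\<^sup>2) * w) * half_theta q (inverse w)" .
  show ?thesis
    unfolding theta_def e e' e'' 2 unfolding w_def[symmetric] 1
    using q w by (simp add: field_simps power2_eq_square)
qed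

lemma exp_2_pi_int: "exp (2 * of_int n * of_real pi * \<i>) = (1::complex)"
  using exp_integer_2pi[of "of_int n"] by (simp add: mult_ac)

lemma theta_periodic: "theta q (z + 2 * of_int n * of_real pi * \<i>) = theta q z"
proof -
  have "exp (z + 2 * of_int n * of_real pi * \<i>) = exp z"
    "exp (- (z + 2 * of_int n * of_real pi * \<i>)) = exp (- z)"
    by (simp_all only: exp_minus exp_add exp_2_pi_int mult_1_right)
  then show ?thesis unfolding theta_def by (simp only:)
qed

text \<open>At 0 all terms are nonnegative reals and the term at n = 0 is 1. Non-vanishing at a
  single point is all that the non-zero kernel element needs.\<close>

lemma theta_0_nonzero:
  assumes "0 \<le> q" "q < 1"
  shows "theta q 0 \<noteq> 0"
proof -
  have s: "summable (\<lambda>n. q ^ (n * n))"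
    using half_theta_summable[OF assms, of 1] by (simp only: power_one mult_1_right summable_of_real_iff)
  have "half_theta q 1 = of_real (\<Sum>n. q ^ (n * n))"
    unfolding half_theta_def by (simp add: suminf_of_real[OF s])
  then have "theta q 0 = of_real (2 * (\<Sum>n. q ^ (n * n)) - 1)"
    by (simp add: theta_def)
  moreover have "(\<Sum>n<1. q ^ (n * n)) \<le> (\<Sum>n. q ^ (n * n))"
    using assms by (intro sum_le_suminf[OF s]) auto
  then have "2 * (\<Sum>n. q ^ (n * n)) - 1 \<noteq> 0" by simp
  ultimately show ?thesis by (simp only: of_real_eq_0_iff not_False_eq_True)
qed

subsection \<open>The kernel of the flat Dirac operator\<close>

definition gauss :: "int \<Rightarrow> complex \<Rightarrow> complex" where
  "gauss n z = exp (- (of_real (pi * \<bar>of_int n\<bar>)) * z\<^sup>2)"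

definition theta_nome :: "int \<Rightarrow> real" where
  "theta_nome n = exp (- (pi * \<bar>of_int n\<bar>))"

definition theta_arg :: "int \<Rightarrow> real \<Rightarrow> real \<Rightarrow> complex" where
  "theta_arg n s t = \<i> * of_real (2 * pi * of_int n * t) - of_real (2 * pi * \<bar>of_int n\<bar> * s)"

text \<open>Multiplied out, this is the sum over integers m of exp (- pi |n| (s + m)^2 + 2 pi i n m
  t): Gaussian ground states centred at all integers. Replacing s by s + 1 shifts m and leaves a
  phase in t.\<close>

definition theta_factor :: "int \<Rightarrow> real \<Rightarrow> real \<Rightarrow> complex" where
  "theta_factor n s t = gauss n (of_real s) * theta (theta_nome n) (theta_arg n s t)"

definition theta_section :: "(nat \<Rightarrow> int) \<Rightarrow> real ^ 8 \<Rightarrow> complex" where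
  "theta_section d x = (\<Prod>j<4. theta_factor (d j) (coord (2 * j + 1) x) (coord (2 * j + 2) x))"

lemma theta_nome_bounds: "n \<noteq> 0 \<Longrightarrow> 0 < theta_nome n \<and> theta_nome n < 1"
  by (simp add: theta_nome_def)

lemma gauss_holomorphic: "gauss n holomorphic_on UNIV"
  unfolding gauss_def[abs_def] by (intro holomorphic_intros)

lemma bounded_linear_theta_arg: "bounded_linear (\<lambda>x. theta_arg n (coord k x) (coord l x))"
proof -
  have "bounded_linear (\<lambda>x. 1 * complex_of_real (2 * pi * \<bar>of_int n\<bar> * coord k x))"
    by (rule bounded_linear_of_real_mult[OF bounded_linear_coord])
  then show ?thesis
    unfolding theta_arg_def
    by (intro bounded_linear_sub bounded_linear_of_real_mult bounded_linear_coord) (simp only: mult_1_left)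
qed

lemma bounded_linear_of_real_coord: "bounded_linear (\<lambda>x. complex_of_real (coord k x))"
  by (rule bounded_linear_compose[OF bounded_linear_of_real bounded_linear_coord])

lemma smooth_gauss: "smooth_on UNIV (\<lambda>x. gauss n (of_real (coord k x)))"
  by (intro smooth_on_entire bounded_linear_of_real_coord gauss_holomorphic) auto

lemma smooth_theta:
  assumes "n \<noteq> 0"
  shows "smooth_on UNIV (\<lambda>x. theta (theta_nome n) (theta_arg n (coord k x) (coord l x)))"
  using theta_nome_bounds[OF assms]
  by (intro smooth_on_entire[OF _ bounded_linear_theta_arg theta_holomorphic]) auto

lemma smooth_theta_factor: "n \<noteq> 0 \<Longrightarrow> smooth_on UNIV (\<lambda>x. theta_factor n (coord k x) (coord l x))"
  unfolding theta_factor_def by (intro smooth_on_mult smooth_gauss smooth_theta) auto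

lemma theta_section_smooth:
  assumes "\<And>j. j < 4 \<Longrightarrow> d j \<noteq> 0"
  shows "smooth_on UNIV (theta_section d)"
  unfolding theta_section_def[abs_def] by (intro smooth_on_prod smooth_theta_factor) (auto simp: assms)

text \<open>The nome is chosen so that the shift of the argument is exactly \<open>2 * ln q\<close>;
  the Gaussian then cancels the real part of the quasi-periodicity factor and leaves a
  phase.\<close>

lemma theta_factor_add_1:
  assumes "n \<noteq> 0"
  shows "theta_factor n (s + 1) t = exp (- (\<i> * of_real (2 * pi * of_int n * t))) * theta_factor n s t"
proof -
  let ?a = "pi * \<bar>of_int n\<bar>" and ?q = "theta_nome n"
  note q = theta_nome_bounds[OF assms(1)]
  have ln: "ln ?q = - ?a" by (simp add: theta_nome_def)
  have "theta_arg n (s + 1) t = theta_arg n s t + of_real (2 * ln ?q)"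
    by (simp add: theta_arg_def ln algebra_simps)
  then have t: "theta ?q (theta_arg n (s + 1) t) = theta ?q (theta_arg n s t) / (of_real ?q * exp (theta_arg n s t))"
    using theta_shift q by simp
  have g: "gauss n (of_real (s + 1)) = gauss n (of_real s) * exp (of_real (- 2 * ?a * s)) * of_real ?q"
    unfolding gauss_def theta_nome_def exp_of_real[symmetric] exp_add[symmetric]
    by (simp add: power2_eq_square algebra_simps)
  have e: "exp (of_real (- 2 * ?a * s)) / exp (theta_arg n s t) = exp (- (\<i> * of_real (2 * pi * of_int n * t)))"
    unfolding exp_diff[symmetric] by (simp add: theta_arg_def algebra_simps)
  have "theta_factor n (s + 1) t = (exp (of_real (- 2 * ?a * s)) / exp (theta_arg n s t)) * theta_factor n s t"
    unfolding theta_factor_def t g using q by (simp add: field_simps)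
  then show ?thesis unfolding e .
qed

lemma theta_factor_add_int:
  assumes "n \<noteq> 0"
  shows "theta_factor n (s + of_int a) t
    = exp (- (\<i> * of_real (2 * pi * (of_int n * of_int a * t)))) * theta_factor n s t"
proof -
  let ?e = "\<lambda>a::int. exp (- (\<i> * of_real (2 * pi * (of_int n * of_int a * t))))"
  have e: "?e (a + 1) = ?e 1 * ?e a" for a
    unfolding exp_add[symmetric] by (simp add: algebra_simps)
  have step: "theta_factor n (s + of_int (a + 1)) t = ?e 1 * theta_factor n (s + of_int a) t" for a
    using theta_factor_add_1[OF assms, of "s + of_int a" t] by (simp add: algebra_simps)
  show ?thesis
  proof (induction a rule: int_induct[where k = 0])
    case base
    then show ?case by simp
  next
    case (step1 i)
    then show ?case unfolding step e by (simp only: mult.assoc)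
  next
    case (step2 i)
    have "?e 1 * theta_factor n (s + of_int (i - 1)) t = ?e 1 * (?e (i - 1) * theta_factor n s t)"
      using step[of "i - 1"] e[of "i - 1"] step2.IH by simp
    then show ?case by (simp only: mult_cancel_left exp_not_eq_zero simp_thms)
  qed
qed

lemma theta_factor_periodic: "theta_factor n s (t + of_int b) = theta_factor n s t"
proof -
  have "theta_arg n s (t + of_int b) = theta_arg n s t + 2 * of_int (n * b) * of_real pi * \<i>"
    by (simp add: theta_arg_def algebra_simps)
  then show ?thesis by (simp only: theta_factor_def theta_periodic)
qed

lemma theta_section_lsections:
  assumes nz: "\<And>j. j < 4 \<Longrightarrow> d j \<noteq> 0"
  shows "theta_section d \<in> lsections d"
  unfolding lsections_def
proof (safe intro!: theta_section_smooth nz)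
  fix l x assume l: "l \<in> int_lattice"
  have "theta_factor (d j) (coord (2 * j + 1) (x + l)) (coord (2 * j + 2) (x + l))
      = exp (- (\<i> * of_real (2 * pi * (of_int (d j) * coord (2 * j + 1) l * coord (2 * j + 2) x))))
        * theta_factor (d j) (coord (2 * j + 1) x) (coord (2 * j + 2) x)"
    if j: "j < 4" for j
  proof -
    obtain a b where ab: "coord (2 * j + 1) l = of_int a" "coord (2 * j + 2) l = of_int b"
      using coord_int_lattice[OF l] by (metis Ints_cases)
    show ?thesis
      unfolding coord_simps ab theta_factor_periodic theta_factor_add_int[OF nz[OF j]] ..
  qed
  then have "theta_section d (x + l) =
      (\<Prod>j<4. exp (- (\<i> * of_real (2 * pi * (of_int (d j) * coord (2 * j + 1) l * coord (2 * j + 2) x))))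
        * theta_factor (d j) (coord (2 * j + 1) x) (coord (2 * j + 2) x))"
    unfolding theta_section_def by (intro prod.cong) auto
  also have "\<dots> = automorphy d l x * theta_section d x"
    unfolding prod.distrib theta_section_def automorphy_def pairing_def exp_sum[OF finite_lessThan, symmetric]
    by (simp add: sum_distrib_left sum_negf)
  finally show "theta_section d (x + l) = automorphy d l x * theta_section d x" .
qed

lemma theta_section_0:
  assumes nz: "\<And>j. j < 4 \<Longrightarrow> d j \<noteq> 0"
  shows "theta_section d 0 \<noteq> 0"
proof -
  have "theta_factor n 0 0 \<noteq> 0" if "n \<noteq> 0" for n
    using theta_nome_bounds[OF that] theta_0_nonzero[of "theta_nome n"]
    by (simp add: theta_factor_def gauss_def theta_arg_def)
  then show ?thesis by (simp add: theta_section_def nz)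
qed

section \<open>Cauchy-Riemann equations for the theta products\<close>

lemma partial_entire:
  assumes "bounded_linear l" "(h has_field_derivative h') (at (l x))"
  shows "partial k (\<lambda>x. h (l x)) x = h' * l (evec k)"
proof -
  have "((\<lambda>x. h (l x)) has_derivative (\<lambda>v. h' * l v)) (at x)"
    using has_derivative_compose[OF bounded_linear_imp_has_derivative[OF assms(1)] assms(2)[unfolded has_field_derivative_def]] .
  from fun_cong[OF frechet_derivative_at[OF this], of "evec k"] show ?thesis
    by (simp add: partial_def)
qed

text \<open>The operator \<open>lowering\<close> without the potential term, hence a derivation that
  can be applied factor by factor.\<close>

definition dbar :: "(nat \<Rightarrow> int) \<Rightarrow> nat \<Rightarrow> (real ^ 8 \<Rightarrow> complex) \<Rightarrow> real ^ 8 \<Rightarrow> complex" where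
  "dbar d j f x = partial (2 * j + 1) f x - \<i> * of_int (sgn (d j)) * partial (2 * j + 2) f x"

lemma dbar_mult:
  assumes "smooth_on UNIV f" "smooth_on UNIV g"
  shows "dbar d j (\<lambda>x. f x * g x) x = f x * dbar d j g x + dbar d j f x * g x"
  using assms by (simp add: dbar_def partial_mult algebra_simps)

lemma dbar_prod:
  assumes "finite I" "\<And>i. i \<in> I \<Longrightarrow> smooth_on UNIV (g i)" "\<And>i. i \<in> I \<Longrightarrow> dbar d j (g i) x = c i * g i x"
  shows "dbar d j (\<lambda>x. \<Prod>i\<in>I. g i x) x = (\<Sum>i\<in>I. c i) * (\<Prod>i\<in>I. g i x)"
  using assms
proof (induction I rule: finite_induct)
  case empty
  then show ?case by (simp add: dbar_def partial_const)
next
  case (insert i I)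
  then show ?case by (simp add: dbar_mult smooth_on_prod algebra_simps)
qed

lemma of_int_abs_sgn: "complex_of_real \<bar>of_int n\<bar> = of_int (sgn n) * of_int n"
  by (cases "n \<ge> 0") (auto simp: sgn_if)

text \<open>\<open>dbar d j\<close> kills the linear argument of theta, so by the chain rule theta
  contributes nothing; only the Gaussian, a function of one real coordinate, leaves a term.\<close>

lemma dbar_theta_factor:
  assumes "i < 4" "j < 4" "d i \<noteq> 0"
  shows "dbar d j (\<lambda>x. theta_factor (d i) (coord (2 * i + 1) x) (coord (2 * i + 2) x)) x
    = (if i = j then - of_real (2 * pi * \<bar>of_int (d j)\<bar> * coord (2 * j + 1) x) else 0)
      * theta_factor (d i) (coord (2 * i + 1) x) (coord (2 * i + 2) x)"
proof -
  have k: "2 * i + 1 \<in> {1..8}" "2 * i + 2 \<in> {1..8}" "2 * j + 1 \<in> {1..8}" "2 * j + 2 \<in> {1..8}"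
    using assms by auto
  have ij: "2 * i + 1 \<noteq> 2 * j + 2" "2 * i + 2 \<noteq> 2 * j + 1" by presburger+
  let ?X = "\<lambda>x. complex_of_real (coord (2 * i + 1) x)"
  let ?t = "\<lambda>x. theta_arg (d i) (coord (2 * i + 1) x) (coord (2 * i + 2) x)"
  have g: "(gauss (d i) has_field_derivative (- 2 * of_real (pi * \<bar>of_int (d i)\<bar>) * z * gauss (d i) z)) (at z)" for z
    unfolding gauss_def[abs_def] by (auto intro!: derivative_eq_intros)
  have "partial k (\<lambda>x. gauss (d i) (?X x)) x
      = (- 2 * of_real (pi * \<bar>of_int (d i)\<bar>) * ?X x * gauss (d i) (?X x)) * ?X (evec k)" for k
    by (rule partial_entire[OF bounded_linear_of_real_coord g])
  then have G: "dbar d j (\<lambda>x. gauss (d i) (?X x)) x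
    = (if i = j then - of_real (2 * pi * \<bar>of_int (d j)\<bar> * coord (2 * j + 1) x) else 0) * gauss (d i) (?X x)"
    unfolding dbar_def using k ij by (simp add: coord_evec)
  have h: "theta (theta_nome (d i)) holomorphic_on UNIV"
    using theta_nome_bounds[OF assms(3)] by (intro theta_holomorphic) auto
  define D where "D = deriv (theta (theta_nome (d i))) (?t x)"
  have P: "partial k (\<lambda>x. theta (theta_nome (d i)) (?t x)) x = D * ?t (evec k)" for k
    unfolding D_def by (rule partial_entire[OF bounded_linear_theta_arg holomorphic_derivI[OF h]]) auto
  have A: "?t (evec (2 * j + 1)) - \<i> * of_int (sgn (d j)) * ?t (evec (2 * j + 2)) = 0"
  proof -
    have e: "?t (evec (2 * j + 1)) = (if i = j then - of_real (2 * pi * \<bar>of_int (d j)\<bar>) else 0)"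
      "?t (evec (2 * j + 2)) = (if i = j then \<i> * of_real (2 * pi * of_int (d j)) else 0)"
      unfolding theta_arg_def using k ij by (auto simp: coord_evec)
    have e': "- complex_of_real (2 * pi * \<bar>of_int (d j)\<bar>)
        - \<i> * of_int (sgn (d j)) * (\<i> * of_real (2 * pi * of_int (d j))) = 0"
      unfolding of_real_mult of_int_abs_sgn of_real_of_int_eq using i_squared by algebra
    show ?thesis
      unfolding e by (cases "i = j") (simp_all only: e' if_True if_False mult_zero_right diff_zero simp_thms)
  qed
  have "dbar d j (\<lambda>x. theta (theta_nome (d i)) (?t x)) x = D *
      (?t (evec (2 * j + 1)) - \<i> * of_int (sgn (d j)) * ?t (evec (2 * j + 2)))"
    unfolding dbar_def P by (simp only: right_diff_distrib mult_ac)
  then have T: "dbar d j (\<lambda>x. theta (theta_nome (d i)) (?t x)) x = 0"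
    unfolding A by simp
  show ?thesis
    unfolding theta_factor_def
    by (subst dbar_mult[OF smooth_gauss smooth_theta[OF assms(3)]])
      (simp only: G T mult_zero_right add_0_left mult.assoc)
qed

lemma sgn_kappa: "sgn (kappa d j) = of_int (sgn (d j))"
proof -
  have "sgn (of_int n :: real) = of_int (sgn n)" for n by (simp add: sgn_if)
  then show ?thesis by (simp add: kappa_def sgn_mult)
qed

text \<open>The width of the Gaussian is tuned for this: its logarithmic derivative cancels the
  potential term of the lowering operator.\<close>

lemma lowering_theta_section:
  assumes nz: "\<And>j. j < 4 \<Longrightarrow> d j \<noteq> 0" and j: "j < 4"
  shows "lowering d j (theta_section d) x = 0"
proof -
  let ?c = "\<lambda>i. if i = j then - of_real (2 * pi * \<bar>of_int (d j)\<bar> * coord (2 * j + 1) x) else (0::complex)"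
  have "dbar d j (theta_section d) x = (\<Sum>i<4. ?c i) * theta_section d x"
    unfolding theta_section_def[abs_def]
    by (rule dbar_prod) (use nz j dbar_theta_factor smooth_theta_factor in auto)
  also have "(\<Sum>i<4. ?c i) = - of_real (2 * pi * \<bar>of_int (d j)\<bar> * coord (2 * j + 1) x)"
    using j by (simp add: sum.delta)
  finally have D: "dbar d j (theta_section d) x
      = - of_real (2 * pi * \<bar>of_int (d j)\<bar> * coord (2 * j + 1) x) * theta_section d x" .
  have k: "2 * i + 1 \<in> {1..8}" "2 * i + 2 \<in> {1..8}" if "i < 4" for i :: nat using that by auto
  have "pairing d x (evec (2 * j + 1)) = 0"
    unfolding pairing_def
  proof (intro sum.neutral ballI)
    fix i :: nat assume "i \<in> {..<4}"
    then have "coord (2 * i + 2) (evec (2 * j + 1)) = (if 2 * i + 2 = 2 * j + 1 then 1 else 0)"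
      using k[of i] k[OF j] by (intro coord_evec) auto
    moreover have "2 * i + 2 \<noteq> 2 * j + 1" by presburger
    ultimately show "of_int (d i) * coord (2 * i + 1) x * coord (2 * i + 2) (evec (2 * j + 1)) = 0"
      by simp
  qed
  moreover have "pairing d x (evec (2 * j + 2)) = (\<Sum>i<4. if i = j then of_int (d j) * coord (2 * j + 1) x else 0)"
    unfolding pairing_def
  proof (rule sum.cong[OF refl])
    fix i :: nat assume "i \<in> {..<4}"
    then show "of_int (d i) * coord (2 * i + 1) x * coord (2 * i + 2) (evec (2 * j + 2))
        = (if i = j then of_int (d j) * coord (2 * j + 1) x else 0)"
      using k[of i] k[OF j] by (simp add: coord_evec)
  qed
  ultimately have p: "potential d (2 * j + 1) x = 0"
    "potential d (2 * j + 2) x = \<i> * of_real (2 * pi * (of_int (d j) * coord (2 * j + 1) x))"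
    using j by (simp_all add: potential_def sum.delta)
  note s = of_int_abs_sgn[of "d j"]
  have "lowering d j (theta_section d) x = dbar d j (theta_section d) x
      - \<i> * of_int (sgn (d j)) * potential d (2 * j + 2) x * theta_section d x"
    unfolding lowering_def nabla_def dbar_def sgn_kappa p(1) by (simp add: algebra_simps)
  also have "\<dots> = 0"
    unfolding D p(2) of_real_mult s of_real_of_int_eq using i_squared by algebra
  finally show ?thesis .
qed

section \<open>The spin component that carries the theta section\<close>

lemma pauli_2: "pauli 2 a b = \<i> * (if b then - 1 else 1) * pauli 1 a b"
  by (simp add: pauli_def)

text \<open>On a basis vector the second Pauli matrix is \<open>\<plusminus>\<i>\<close> times the
  first. On one spin component the Dirac operator therefore joins each pair of derivatives into one
  Cauchy-Riemann operator.\<close>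

lemma gamma_column:
  assumes "j < 4"
  shows "gamma (2 * j + 2) $ a $ b = \<i> * of_int (spin_sign j b) * gamma (2 * j + 1) $ a $ b"
proof -
  obtain a\<^sub>0 a\<^sub>1 a\<^sub>2 a\<^sub>3 b\<^sub>0 b\<^sub>1 b\<^sub>2 b\<^sub>3 where ab: "a = (a\<^sub>0, a\<^sub>1, a\<^sub>2, a\<^sub>3)" "b = (b\<^sub>0, b\<^sub>1, b\<^sub>2, b\<^sub>3)"
    by (metis prod_cases4)
  note simps = mult_ac ab gamma_def pauli_tensor_def pauli_2 spin_sign_def
  consider "j = 0" | "j = 1" | "j = 2" | "j = 3" using assms by linarith
  then show ?thesis
  proof cases
    case 1 then show ?thesis by (cases b\<^sub>0) (simp_all add: simps del: i_squared complex_i_mult_minus)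
  next
    case 2 then show ?thesis by (cases b\<^sub>1) (simp_all add: simps del: i_squared complex_i_mult_minus)
  next
    case 3 then show ?thesis by (cases b\<^sub>2) (simp_all add: simps del: i_squared complex_i_mult_minus)
  next
    case 4 then show ?thesis by (cases b\<^sub>3) (simp_all add: simps del: i_squared complex_i_mult_minus)
  qed
qed

text \<open>\<open>True\<close> encodes the spin sign -1, so positive \<open>d j\<close> must give
  \<open>True\<close>.\<close>

definition lowest_spin_index :: "(nat \<Rightarrow> int) \<Rightarrow> spin_index" where
  "lowest_spin_index d = (d 0 > 0, d 1 > 0, d 2 > 0, d 3 > 0)"

lemma spin_sign_lowest:
  assumes "j < 4" "d j \<noteq> 0"
  shows "spin_sign j (lowest_spin_index d) = - sgn (d j)"
  using less_4_cases[OF assms(1)] assms(2) by (auto simp: spin_sign_def lowest_spin_index_def)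

lemma dirac_flat_theta_section:
  assumes nz: "\<And>j. j < 4 \<Longrightarrow> d j \<noteq> 0"
  shows "dirac_flat d (\<lambda>b x. if b = lowest_spin_index d then theta_section d x else 0) b x = 0"
proof -
  let ?b = "lowest_spin_index d"
  have N: "nabla d k (\<lambda>x. if e = ?b then theta_section d x else 0) x
      = (if e = ?b then nabla d k (theta_section d) x else 0)" for k e
    by (simp add: nabla_zero)
  have "dirac_flat d (\<lambda>b x. if b = ?b then theta_section d x else 0) b x
      = (\<Sum>k\<in>{1..8}. gamma k $ b $ ?b * nabla d k (theta_section d) x)"
    unfolding dirac_flat_def N by (simp add: if_distrib cong: if_cong)
  also have "\<dots> = (\<Sum>j<4. gamma (2 * j + 1) $ b $ ?b * lowering d j (theta_section d) x)"
    unfolding sum_1_8_pairs lowering_def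
  proof (rule sum.cong[OF refl])
    fix j :: nat assume "j \<in> {..<4}"
    then have j: "j < 4" by simp
    have g: "gamma (2 * j + 2) $ b $ ?b = - \<i> * of_real (sgn (kappa d j)) * gamma (2 * j + 1) $ b $ ?b"
      using gamma_column[OF j, of b ?b] spin_sign_lowest[where d = d, OF j nz[OF j]] by (simp add: sgn_kappa)
    show "gamma (2 * j + 1) $ b $ ?b * nabla d (2 * j + 1) (theta_section d) x
        + gamma (2 * j + 2) $ b $ ?b * nabla d (2 * j + 2) (theta_section d) x
      = gamma (2 * j + 1) $ b $ ?b * (nabla d (2 * j + 1) (theta_section d) x
        + - \<i> * of_real (sgn (kappa d j)) * nabla d (2 * j + 2) (theta_section d) x)"
      unfolding g by (simp only: distrib_left mult_ac)
  qed
  also have "\<dots> = 0" using lowering_theta_section[OF nz] by simp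
  finally show ?thesis .
qed

subsection \<open>The torus and its charts\<close>

abbreviation proj :: "real ^ 8 \<Rightarrow> torus_point" where
  "proj \<equiv> torus_proj int_lattice"

lemma mem_proj_iff: "y \<in> proj x \<longleftrightarrow> y - x \<in> int_lattice"
  unfolding torus_proj_def image_iff by (metis add_diff_cancel_left' diff_add_cancel add.commute)

lemma proj_eq_iff: "proj x = proj y \<longleftrightarrow> x - y \<in> int_lattice"
proof
  assume "proj x = proj y"
  then show "x - y \<in> int_lattice" using mem_proj_iff[of x x] mem_proj_iff[of x y] int_lattice_0 by simp
next
  assume xy: "x - y \<in> int_lattice"
  have "z - x \<in> int_lattice \<longleftrightarrow> z - y \<in> int_lattice" for z
    using int_lattice_add[OF xy, of "z - x"] int_lattice_diff[OF _ xy, of "z - y"] by (auto simp: algebra_simps)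
  then show "proj x = proj y" by (auto simp: mem_proj_iff)
qed

lemma proj_add: "l \<in> int_lattice \<Longrightarrow> proj (x + l) = proj x"
  by (simp add: proj_eq_iff)

text \<open>Corners of the open unit cubes used as charts. Confining them to a fundamental domain
  makes the corner recoverable from the domain of the chart.\<close>

definition chart_index :: "(real ^ 8) set" where
  "chart_index = {a. \<forall>i. 0 \<le> a $ i \<and> a $ i < 1}"

definition open_cube :: "real ^ 8 \<Rightarrow> (real ^ 8) set" where
  "open_cube a = {x. \<forall>i. a $ i < x $ i \<and> x $ i < a $ i + 1}"

definition chart_domain :: "real ^ 8 \<Rightarrow> torus_point set" where
  "chart_domain a = proj ` open_cube a"

definition lift :: "real ^ 8 \<Rightarrow> torus_point \<Rightarrow> real ^ 8" where
  "lift a p = (THE x. x \<in> open_cube a \<and> proj x = p)"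

lemma open_open_cube: "open (open_cube a)"
proof -
  have "open_cube a = box a (a + (\<chi> i. 1))" by (auto simp: open_cube_def mem_box_cart)
  then show ?thesis by (simp add: open_box)
qed

lemma open_cube_unique:
  assumes "x \<in> open_cube a" "y \<in> open_cube a" "proj x = proj y"
  shows "x = y"
proof -
  have "x $ i = y $ i" for i
  proof -
    have "(x - y) $ i \<in> \<int>"
      using assms(3) unfolding proj_eq_iff by (simp add: int_lattice_def)
    then obtain n where n: "x $ i - y $ i = of_int n" by (auto elim: Ints_cases)
    have "a $ i < x $ i" "x $ i < a $ i + 1" "a $ i < y $ i" "y $ i < a $ i + 1"
      using assms(1,2) by (auto simp: open_cube_def)
    then have "\<bar>real_of_int n\<bar> < 1" unfolding n[symmetric] by linarith
    then have "n = 0" by (simp flip: of_int_abs)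
    then show ?thesis using n by simp
  qed
  then show ?thesis by (simp add: vec_eq_iff)
qed

lemma lift_proj: "x \<in> open_cube a \<Longrightarrow> lift a (proj x) = x"
  unfolding lift_def by (rule the_equality) (auto intro: open_cube_unique)

lemma lift_chart_domain:
  assumes "p \<in> chart_domain a"
  shows "lift a p \<in> open_cube a" "proj (lift a p) = p"
  using assms lift_proj by (auto simp: chart_domain_def)

lemma proj_chart_domain: "proj x \<in> chart_domain a \<longleftrightarrow> (\<exists>l\<in>int_lattice. x + l \<in> open_cube a)"
proof
  assume "proj x \<in> chart_domain a"
  then obtain y where "y \<in> open_cube a" "proj y = proj x" unfolding chart_domain_def by (metis imageE)
  then show "\<exists>l\<in>int_lattice. x + l \<in> open_cube a"
    by (intro bexI[of _ "y - x"]) (auto simp: proj_eq_iff)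
next
  assume "\<exists>l\<in>int_lattice. x + l \<in> open_cube a"
  then show "proj x \<in> chart_domain a" unfolding chart_domain_def by (metis imageI proj_add)
qed

lemma open_translate_cube: "open {y. y + l \<in> open_cube a}"
proof -
  have "{y. y + l \<in> open_cube a} = (\<lambda>y. y + l) -` open_cube a" by auto
  then show ?thesis
    by (simp add: open_vimage[OF open_open_cube] continuous_intros)
qed

lemma torus_open_chart_domain: "torus_open int_lattice (chart_domain a)"
proof -
  have "proj -` chart_domain a = (\<Union>l\<in>int_lattice. {y. y + l \<in> open_cube a})"
    by (auto simp: proj_chart_domain)
  then show ?thesis
    unfolding torus_open_def torus_def chart_domain_def
    using open_translate_cube by (auto simp: chart_domain_def)
qed

text \<open>Take the unit cube centred at \<open>x\<close> and move it by a lattice vector until its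
  corner is in the index set.\<close>

lemma chart_domain_cover: "\<exists>a\<in>chart_index. proj x \<in> chart_domain a"
proof
  let ?h = "(\<chi> i. 1 / 2) :: real ^ 8"
  let ?a = "x - ?h - floor_vec (x - ?h)"
  show "?a \<in> chart_index"
    by (auto simp: chart_index_def floor_vec_def; linarith)
  have "x + - floor_vec (x - ?h) \<in> open_cube ?a"
    by (auto simp: open_cube_def)
  then show "proj x \<in> chart_domain ?a"
    unfolding proj_chart_domain using int_lattice_minus[OF floor_vec_lattice] by blast
qed

lemma torus_cases:
  assumes "p \<in> torus int_lattice"
  obtains x where "p = proj x"
  using assms by (auto simp: torus_def)

lemma proj_torus: "proj x \<in> torus int_lattice"
  by (simp add: torus_def)

text \<open>The domain with corner \<open>b\<close> omits the points whose i-th coordinate is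
  congruent to \<open>b $ i\<close>; if \<open>a $ i\<close> differs, the domain with corner
  \<open>a\<close> contains such a point.\<close>

lemma inj_on_chart_domain: "inj_on chart_domain chart_index"
proof (rule inj_onI, rule ccontr)
  fix a b
  assume ab: "a \<in> chart_index" "b \<in> chart_index" "chart_domain a = chart_domain b" "a \<noteq> b"
  then obtain i where i: "a $ i \<noteq> b $ i" by (auto simp: vec_eq_iff)
  \<comment> \<open>The integer shift that brings \<open>b $ i\<close> strictly between
    \<open>a $ i\<close> and \<open>a $ i + 1\<close>.\<close>
  define t where "t = (if a $ i < b $ i then 0 else 1 :: real)"
  define x :: "real ^ 8" where "x = (\<chi> m. if m = i then b $ i + t else a $ m + 1 / 2)"
  have r: "0 \<le> a $ i" "a $ i < 1" "0 \<le> b $ i" "b $ i < 1" using ab by (auto simp: chart_index_def)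
  have "x \<in> open_cube a"
    using i r by (auto simp: open_cube_def x_def t_def)
  then have "proj x \<in> chart_domain b" using ab(3) unfolding chart_domain_def by blast
  then obtain l where l: "l \<in> int_lattice" "x + l \<in> open_cube b" by (auto simp: proj_chart_domain)
  obtain n where n: "l $ i = of_int n" using l(1) by (auto simp: int_lattice_def elim: Ints_cases)
  have "b $ i < b $ i + t + of_int n" "b $ i + t + of_int n < b $ i + 1"
    using l(2) n by (auto simp: open_cube_def x_def dest: spec[of _ i])
  then have "0 < t + of_int n" "t + of_int n < 1" by auto
  then show False by (auto simp: t_def split: if_splits)
qed

section \<open>Smoothness and derivatives on the torus, read on the cover\<close>

lemma torus_smooth_onI:
  assumes "\<And>x. proj x \<in> U \<Longrightarrow> \<exists>N g. open N \<and> x \<in> N \<and> smooth_on N g \<and> (\<forall>y\<in>N. h (proj y) = g y)"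
  shows "torus_smooth_on int_lattice U h"
  unfolding torus_smooth_on_def
proof (rule smooth_on_local)
  fix x assume "x \<in> proj -` U"
  then obtain N g where N: "open N" "x \<in> N" "smooth_on N g" "\<forall>y\<in>N. h (proj y) = g y"
    using assms by (metis vimageE)
  then have "smooth_on N (h \<circ> proj)" using smooth_on_cong[of N "h \<circ> proj" g] by simp
  then show "\<exists>N. open N \<and> x \<in> N \<and> smooth_on N (h \<circ> proj)" using N by blast
qed

text \<open>The derivative is defined at an unspecified lift of the point; periodicity of
  \<open>h \<circ> proj\<close> carries it to the lift \<open>x\<close>.\<close>

lemma torus_deriv_local:
  assumes N: "open N" "x \<in> N" "\<And>y. y \<in> N \<Longrightarrow> h (proj y) = g y"
  shows "torus_deriv int_lattice k h (proj x) = partial k g x"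
proof -
  define x' where "x' = (SOME x'. x' \<in> proj x)"
  have "x' \<in> proj x" unfolding x'_def by (rule someI[of _ x]) (simp add: mem_proj_iff int_lattice_0)
  then obtain l where l: "l \<in> int_lattice" "x' = x + l" by (auto simp: torus_proj_def)
  have "(\<lambda>y. (h \<circ> proj) (y + l)) = h \<circ> proj" using l(1) by (auto simp: proj_add)
  then have "frechet_derivative (h \<circ> proj) (at x') = frechet_derivative (h \<circ> proj) (at x)"
    using frechet_derivative_translate[of "h \<circ> proj" l x] l(2) by simp
  also have "\<dots> = frechet_derivative g (at x)"
    by (rule frechet_derivative_cong_open[OF N(1,2)]) (simp add: N(3))
  finally show ?thesis
    unfolding torus_deriv_def x'_def[symmetric] partial_def evec_def by simp
qed

text \<open>Near every lift of a point of the chart, \<open>lift a \<circ> proj\<close> is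
  translation by a fixed lattice vector.\<close>

lemma torus_smooth_on_chart:
  assumes "\<And>p. p \<in> chart_domain a \<Longrightarrow> h p = f (lift a p)" "smooth_on UNIV f"
  shows "torus_smooth_on int_lattice (chart_domain a) h"
proof (rule torus_smooth_onI)
  fix x assume "proj x \<in> chart_domain a"
  then obtain l where l: "l \<in> int_lattice" "x + l \<in> open_cube a" by (auto simp: proj_chart_domain)
  have "h (proj y) = f (y + l)" if "y + l \<in> open_cube a" for y
  proof -
    have "proj (y + l) \<in> chart_domain a" using that by (simp add: chart_domain_def)
    then show ?thesis using assms(1)[of "proj (y + l)"] lift_proj[OF that] l(1) by (simp add: proj_add)
  qed
  moreover have "smooth_on {y. y + l \<in> open_cube a} (\<lambda>y. f (y + l))"
    by (rule smooth_on_translate[OF assms(2)]) auto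
  ultimately show "\<exists>N g. open N \<and> x \<in> N \<and> smooth_on N g \<and> (\<forall>y\<in>N. h (proj y) = g y)"
    using open_translate_cube l(2) by (intro exI[of _ "{y. y + l \<in> open_cube a}"] exI[of _ "\<lambda>y. f (y + l)"]) auto
qed

lemma torus_deriv_chart:
  assumes "\<And>p. p \<in> chart_domain a \<Longrightarrow> h p = f (lift a p)" "p \<in> chart_domain a"
  shows "torus_deriv int_lattice k h p = partial k f (lift a p)"
proof -
  have "torus_deriv int_lattice k h (proj (lift a p)) = partial k f (lift a p)"
  proof (rule torus_deriv_local[OF open_open_cube lift_chart_domain(1)[OF assms(2)]])
    fix y assume y: "y \<in> open_cube a"
    then have "proj y \<in> chart_domain a" by (simp add: chart_domain_def)
    then show "h (proj y) = f y" using assms(1) lift_proj[OF y] by metis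
  qed
  then show ?thesis using lift_chart_domain(2)[OF assms(2)] by simp
qed

subsection \<open>Line bundles with constant curvature\<close>

text \<open>This satisfies the transformation law of a section and vanishes nowhere, but jumps at the walls of
  the unit cubes. It identifies each fibre with \<open>\<complex>\<close>.\<close>

definition gauge :: "(nat \<Rightarrow> int) \<Rightarrow> real ^ 8 \<Rightarrow> complex" where
  "gauge d x = automorphy d (floor_vec x) x"

text \<open>Multiplying by \<open>gauge\<close> at the lift makes the chart expression of a section
  equal to the corresponding quasi-periodic function on the cube.\<close>

definition chart :: "(nat \<Rightarrow> int) \<Rightarrow> real ^ 8 \<Rightarrow> total_point chart" where
  "chart d a = (chart_domain a, \<lambda>e i. if i = 0 then gauge d (lift a (fst e)) * snd e 0 else 0)"

definition line_bundle :: "(nat \<Rightarrow> int) \<Rightarrow> total_point vbundle" where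
  "line_bundle d = \<lparr>total_space = torus int_lattice \<times> cspace 1, bundle_proj = fst, bundle_rank = 1,
     bundle_atlas = chart d ` chart_index\<rparr>"

text \<open>The cube of a chart is recovered from its domain.\<close>

definition conn :: "(nat \<Rightarrow> int) \<Rightarrow> total_point connection" where
  "conn d c k p = (\<lambda>i j. potential d k (lift (inv_into chart_index chart_domain (fst c)) p))"

text \<open>Split off from \<open>lsections\<close> because \<open>gauge\<close> has this property
  without being smooth.\<close>

definition quasi_periodic :: "(nat \<Rightarrow> int) \<Rightarrow> (real ^ 8 \<Rightarrow> complex) \<Rightarrow> bool" where
  "quasi_periodic d f \<longleftrightarrow> (\<forall>l\<in>int_lattice. \<forall>x. f (x + l) = automorphy d l x * f x)"

lemma lsections_iff: "f \<in> lsections d \<longleftrightarrow> smooth_on UNIV f \<and> quasi_periodic d f"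
  by (simp add: lsections_def quasi_periodic_def)

text \<open>Expanding the pairing of \<open>floor_vec x + l\<close> with \<open>x + l\<close> leaves
  two extra terms that pair lattice vectors; they are integers since \<open>d\<close> is integral,
  and the exponential does not see them.\<close>

lemma gauge_quasi_periodic: "quasi_periodic d (gauge d)"
  unfolding quasi_periodic_def
proof (intro ballI allI)
  fix l x assume l: "l \<in> int_lattice"
  have "pairing d (floor_vec x) l + pairing d l l \<in> \<int>"
    using l floor_vec_lattice by (intro Ints_add pairing_lattice)
  then obtain n where n: "pairing d (floor_vec x) l + pairing d l l = of_int n" by (auto elim: Ints_cases)
  have "pairing d (floor_vec (x + l)) (x + l)
      = pairing d l x + pairing d (floor_vec x) x + of_int n"
    unfolding floor_vec_add[OF l] pairing_add using n by simp
  then have "gauge d (x + l) = exp (- (\<i> * of_real (2 * pi * pairing d l x))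
      + - (\<i> * of_real (2 * pi * pairing d (floor_vec x) x)) + 2 * of_int (- n) * of_real pi * \<i>)"
    unfolding gauge_def automorphy_def by (simp add: algebra_simps)
  also have "\<dots> = automorphy d l x * gauge d x * exp (2 * of_int (- n) * of_real pi * \<i>)"
    unfolding exp_add automorphy_def gauge_def ..
  also have "exp (2 * of_int (- n) * of_real pi * \<i>) = (1::complex)"
    by (rule exp_2_pi_int)
  finally show "gauge d (x + l) = automorphy d l x * gauge d x" by simp
qed

lemma norm_gauge: "norm (gauge d x) = 1"
  by (simp add: gauge_def norm_automorphy)

lemma gauge_nonzero: "gauge d x \<noteq> 0"
  using norm_gauge[of d x] by auto

lemma quasi_periodic_quotient:
  assumes "quasi_periodic d f" "proj x = proj y"
  shows "f x / gauge d x = f y / gauge d y"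
proof -
  have l: "x - y \<in> int_lattice" using assms(2) by (simp add: proj_eq_iff)
  have "f (y + (x - y)) = automorphy d (x - y) y * f y"
    "gauge d (y + (x - y)) = automorphy d (x - y) y * gauge d y"
    using assms(1) gauge_quasi_periodic l unfolding quasi_periodic_def by blast+
  moreover have "automorphy d (x - y) y \<noteq> 0" using norm_automorphy[of d "x - y" y] by auto
  ultimately show ?thesis by simp
qed

lemma bundle_simps [simp]:
  "total_space (line_bundle d) = torus int_lattice \<times> cspace 1" "bundle_proj (line_bundle d) = fst"
  "bundle_rank (line_bundle d) = 1" "bundle_atlas (line_bundle d) = chart d ` chart_index"
  by (simp_all add: line_bundle_def)

lemma fst_chart [simp]: "fst (chart d a) = chart_domain a"
  by (simp add: chart_def)

lemma snd_chart: "snd (chart d a) e i = (if i = 0 then gauge d (lift a (fst e)) * snd e 0 else 0)"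
  by (simp add: chart_def)

lemma conn_chart: "a \<in> chart_index \<Longrightarrow> conn d (chart d a) k p i j = potential d k (lift a p)"
  by (simp add: conn_def inv_into_f_f[OF inj_on_chart_domain])

lemma fibre_bundle: "p \<in> torus int_lattice \<Longrightarrow> fibre (line_bundle d) p = {p} \<times> cspace 1"
  by (auto simp: fibre_def)

lemma chart_domain_torus: "p \<in> chart_domain a \<Longrightarrow> p \<in> torus int_lattice"
  using torus_open_chart_domain unfolding torus_open_def by blast

lemma bij_chart:
  assumes "p \<in> chart_domain a"
  shows "bij_betw (snd (chart d a)) (fibre (line_bundle d) p) (cspace 1)"
proof (rule bij_betwI[where g = "\<lambda>v. (p, \<lambda>i. v i / gauge d (lift a p))"])
  note f = fibre_bundle[OF chart_domain_torus[OF assms], of d]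
  show "snd (chart d a) \<in> fibre (line_bundle d) p \<rightarrow> cspace 1" by (auto simp: snd_chart cspace_def)
  show "(\<lambda>v. (p, \<lambda>i. v i / gauge d (lift a p))) \<in> cspace 1 \<rightarrow> fibre (line_bundle d) p"
    by (auto simp: f cspace_def)
  show "(p, \<lambda>i. snd (chart d a) e i / gauge d (lift a p)) = e" if "e \<in> fibre (line_bundle d) p" for e
    using that gauge_nonzero unfolding f by (auto simp: snd_chart cspace_def fun_eq_iff)
  show "snd (chart d a) (p, \<lambda>i. v i / gauge d (lift a p)) = v" if "v \<in> cspace 1" for v
    using that gauge_nonzero by (auto simp: snd_chart cspace_def fun_eq_iff)
qed

lemma transition_bundle:
  assumes "p \<in> chart_domain a"
  shows "transition (line_bundle d) (chart d a) (chart d b) p 0 0 = gauge d (lift b p) / gauge d (lift a p)"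
proof -
  let ?v = "\<lambda>m::nat. if m = 0 then 1 else 0 :: complex"
  define e where "e = inv_into (fibre (line_bundle d) p) (snd (chart d a)) ?v"
  have v: "?v \<in> snd (chart d a) ` fibre (line_bundle d) p"
    using bij_chart[OF assms, of d] by (auto simp: bij_betw_def cspace_def)
  have e: "e \<in> fibre (line_bundle d) p" "snd (chart d a) e = ?v"
    unfolding e_def by (rule inv_into_into[OF v], rule f_inv_into_f[OF v])
  have "fst e = p" using e(1) fibre_bundle[OF chart_domain_torus[OF assms]] by auto
  moreover have "snd (chart d a) e 0 = 1" using e(2) by simp
  ultimately have "snd e 0 = 1 / gauge d (lift a p)"
    using gauge_nonzero by (simp add: snd_chart field_simps)
  then show ?thesis
    unfolding transition_def e_def[symmetric] snd_chart using \<open>fst e = p\<close> by simp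
qed

text \<open>\<open>gauge\<close> jumps, but the quotient of its values at two lifts of one point is
  an automorphy factor, which is smooth for fixed lattice vectors.\<close>

lemma transition_local:
  assumes l: "l \<in> int_lattice" "y + l \<in> open_cube a" and m: "m \<in> int_lattice" "y + m \<in> open_cube b"
  shows "transition (line_bundle d) (chart d a) (chart d b) (proj y) 0 0 = automorphy d (m - l) (y + l)"
proof -
  have "proj y \<in> chart_domain a" using l by (auto simp: proj_chart_domain)
  moreover have "lift a (proj y) = y + l" "lift b (proj y) = y + m"
    using lift_proj[OF l(2)] lift_proj[OF m(2)] by (simp_all add: proj_add l m)
  ultimately have "transition (line_bundle d) (chart d a) (chart d b) (proj y) 0 0 = gauge d (y + m) / gauge d (y + l)"
    by (simp add: transition_bundle)
  moreover have "gauge d ((y + l) + (m - l)) = automorphy d (m - l) (y + l) * gauge d (y + l)"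
    using gauge_quasi_periodic int_lattice_diff[OF m(1) l(1)] unfolding quasi_periodic_def by blast
  ultimately show ?thesis using gauge_nonzero[of d "y + l"] by simp
qed

lemma hermitian_bundle_bundle: "hermitian_bundle int_lattice (line_bundle d)"
proof -
  have t: "torus_smooth_on int_lattice (chart_domain a \<inter> chart_domain b)
      (\<lambda>p. transition (line_bundle d) (chart d a) (chart d b) p 0 0)" for a b
  proof (rule torus_smooth_onI)
    fix x assume "proj x \<in> chart_domain a \<inter> chart_domain b"
    then obtain l m where lm: "l \<in> int_lattice" "x + l \<in> open_cube a" "m \<in> int_lattice" "x + m \<in> open_cube b"
      by (auto simp: proj_chart_domain)
    let ?N = "{y. y + l \<in> open_cube a} \<inter> {y. y + m \<in> open_cube b}"
    have "smooth_on ?N (\<lambda>y. automorphy d (m - l) (y + l))"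
      by (rule smooth_on_translate[OF smooth_automorphy]) auto
    moreover have "open ?N" using open_translate_cube by blast
    ultimately show "\<exists>N g. open N \<and> x \<in> N \<and> smooth_on N g \<and>
        (\<forall>y\<in>N. transition (line_bundle d) (chart d a) (chart d b) (proj y) 0 0 = g y)"
      using lm transition_local by (intro exI[of _ ?N] exI[of _ "\<lambda>y. automorphy d (m - l) (y + l)"]) auto
  qed
  have u: "unitary_matrix 1 (transition (line_bundle d) (chart d a) (chart d b) p)" if "p \<in> chart_domain a" for a b p
  proof -
    have "norm (transition (line_bundle d) (chart d a) (chart d b) p 0 0) = 1"
      unfolding transition_bundle[OF that] norm_divide norm_gauge by simp
    then show ?thesis by (simp add: unitary_matrix_def complex_norm_square[symmetric])
  qed
  have s: "snd (chart d b) e 0 = transition (line_bundle d) (chart d a) (chart d b) p 0 0 * snd (chart d a) e 0"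
    if "p \<in> chart_domain a" "e \<in> fibre (line_bundle d) p" for a b p e
    using that gauge_nonzero by (auto simp: transition_bundle snd_chart fibre_def)
  have c: "torus int_lattice = (\<Union>a\<in>chart_index. chart_domain a)"
    using chart_domain_cover chart_domain_torus by (auto elim!: torus_cases)
  show ?thesis
    unfolding hermitian_bundle_def
    using bij_chart torus_open_chart_domain t u s c by auto
qed

text \<open>At lifts \<open>x\<close> and \<open>x + m\<close> the potentials differ by
  \<open>potential d k m\<close>, which is what the derivative of the transition function
  \<open>automorphy d m\<close> compensates.\<close>

lemma unitary_connection_conn: "unitary_connection int_lattice (line_bundle d) (conn d)"
proof -
  have "torus_smooth_on int_lattice (chart_domain a) (\<lambda>p. conn d (chart d a) k p 0 0)" if "a \<in> chart_index" for a k
    by (rule torus_smooth_on_chart[OF conn_chart[OF that] smooth_potential])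
  moreover have "conn d (chart d a) k p 0 0 = - cnj (conn d (chart d a) k p 0 0)" if "a \<in> chart_index" for a k p
    by (simp add: conn_chart[OF that] cnj_potential)
  moreover have "torus_deriv int_lattice k (\<lambda>q. transition (line_bundle d) (chart d a) (chart d b) q 0 0) p
      + conn d (chart d b) k p 0 0 * transition (line_bundle d) (chart d a) (chart d b) p 0 0
     = transition (line_bundle d) (chart d a) (chart d b) p 0 0 * conn d (chart d a) k p 0 0"
    if ab: "a \<in> chart_index" "b \<in> chart_index" and p: "p \<in> chart_domain a" "p \<in> chart_domain b" for a b k p
  proof -
    define x where "x = lift a p"
    have x: "x \<in> open_cube a" "proj x = p" unfolding x_def using lift_chart_domain[OF p(1)] by auto
    then obtain m where m: "m \<in> int_lattice" "x + m \<in> open_cube b" using p(2) by (auto simp: proj_chart_domain)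
    let ?N = "open_cube a \<inter> {y. y + m \<in> open_cube b}"
    have loc: "transition (line_bundle d) (chart d a) (chart d b) (proj y) 0 0 = automorphy d m y" if "y \<in> ?N" for y
      using transition_local[of 0 y a m b d] that m int_lattice_0 by simp
    have "torus_deriv int_lattice k (\<lambda>q. transition (line_bundle d) (chart d a) (chart d b) q 0 0) (proj x)
       = partial k (automorphy d m) x"
      by (rule torus_deriv_local[where N = ?N]) (use open_open_cube open_translate_cube x m loc in auto)
    moreover have "lift b p = x + m" using lift_proj[OF m(2)] m(1) x(2) by (simp add: proj_add)
    moreover have "transition (line_bundle d) (chart d a) (chart d b) p 0 0 = automorphy d m x"
      using loc[of x] x m by simp
    ultimately show ?thesis
      unfolding conn_chart[OF ab(1)] conn_chart[OF ab(2)] x(2) x_def[symmetric]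
      by (simp add: partial_automorphy potential_add algebra_simps)
  qed
  ultimately show ?thesis
    unfolding unitary_connection_def mat_mult_def by auto
qed

section \<open>Curvature and the instanton equation\<close>

lemma two_form_curv: "two_form_of (curv d) = diagonal_form (\<lambda>j. 2 * pi * \<i> * of_int (d j))"
proof
  fix K
  show "two_form_of (curv d) K = diagonal_form (\<lambda>j. 2 * pi * \<i> * of_int (d j)) K"
  proof (cases "K \<subseteq> {1..8} \<and> card K = 2")
    case True
    then obtain k l where kl: "K = {k, l}" "k < l"
      by (metis card_2_iff insert_commute linorder_neqE_nat)
    then have r: "k \<in> {1..8}" "l \<in> {1..8}" using True by auto
    have "two_form_of (curv d) K = curv d k l" using True kl by (simp add: two_form_of_def)
    also have "\<dots> = (if odd k \<and> l = k + 1 then 2 * pi * \<i> * of_int (d (k div 2)) else 0)"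
      unfolding curv_def pairing_evec[OF r] pairing_evec[OF r(2) r(1)] using kl(2) by simp
    also have "\<dots> = diagonal_form (\<lambda>j. 2 * pi * \<i> * of_int (d j)) K"
    proof -
      have "k = 1 \<or> k = 2 \<or> k = 3 \<or> k = 4 \<or> k = 5 \<or> k = 6 \<or> k = 7 \<or> k = 8" using r(1) by auto
      then show ?thesis
        unfolding kl(1) diagonal_form_def dx_def using kl(2) r(2)
        by (elim disjE) (auto simp: doubleton_eq_iff)
    qed
    finally show ?thesis .
  next
    case False
    then have "K \<noteq> {1,2}" "K \<noteq> {3,4}" "K \<noteq> {5,6}" "K \<noteq> {7,8}" by auto
    then show ?thesis unfolding two_form_of_def if_not_P[OF False] by (simp add: diagonal_form_def dx_def)
  qed
qed

text \<open>In rank 1 the commutator of the connection matrices vanishes and the potential is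
  linear, so the curvature in every chart is the constant \<open>curv d\<close>.\<close>

lemma spin7_instanton_bundle:
  assumes "d 0 + d 3 = d 1 + d 2"
  shows "spin7_instanton int_lattice (line_bundle d) (conn d)"
proof -
  have "curvature int_lattice (line_bundle d) (conn d) (chart d a) p k l 0 0 = curv d k l"
    if a: "a \<in> chart_index" and p: "p \<in> chart_domain a" for a p k l
  proof -
    have "torus_deriv int_lattice k (\<lambda>q. conn d (chart d a) l q 0 0) p = potential d l (evec k)" for k l
      using torus_deriv_chart[where h = "\<lambda>q. conn d (chart d a) l q 0 0", OF conn_chart[OF a] p]
      by (simp add: partial_potential)
    then show ?thesis by (simp add: curvature_def mat_mult_def conn_chart[OF a] curv_eq)
  qed
  moreover have "hodge (wedge (two_form_of (curv d)) cayley_form) = two_form_of (curv d)"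
    unfolding two_form_curv
  proof (rule hodge_wedge_diagonal_form)
    have "2 * pi * \<i> * complex_of_int (d 0) + 2 * pi * \<i> * complex_of_int (d 3) = 2 * pi * \<i> * of_int (d 0 + d 3)"
      by (simp add: algebra_simps)
    then show "2 * pi * \<i> * complex_of_int (d 0) + 2 * pi * \<i> * complex_of_int (d 3)
       = 2 * pi * \<i> * of_int (d 1) + 2 * pi * \<i> * of_int (d 2)"
      unfolding assms by (simp add: algebra_simps)
  qed
  ultimately show ?thesis
    unfolding spin7_instanton_def using hermitian_bundle_bundle unitary_connection_conn by (simp add: Let_def)
qed

subsection \<open>Sections and the Dirac operator\<close>

text \<open>Turns a function on the cover into a section. For quasi-periodic \<open>f\<close> the
  quotient by \<open>gauge\<close> does not depend on the lift that is chosen.\<close>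

definition bundle_point :: "(nat \<Rightarrow> int) \<Rightarrow> (real ^ 8 \<Rightarrow> complex) \<Rightarrow> torus_point \<Rightarrow> total_point" where
  "bundle_point d f p = (p, \<lambda>i. if i = 0 then f (SOME x. proj x = p) / gauge d (SOME x. proj x = p) else 0)"

lemma bundle_point_proj:
  assumes "quasi_periodic d f"
  shows "bundle_point d f (proj x) = (proj x, \<lambda>i. if i = 0 then f x / gauge d x else 0)"
proof -
  have "proj (SOME y. proj y = proj x) = proj x" by (rule someI[of _ x]) simp
  then show ?thesis unfolding bundle_point_def using quasi_periodic_quotient[OF assms] by metis
qed

lemma bundle_point_fibre: "p \<in> torus int_lattice \<Longrightarrow> bundle_point d f p \<in> fibre (line_bundle d) p"
  by (simp add: fibre_bundle bundle_point_def cspace_def)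

lemma chart_bundle_point:
  assumes "quasi_periodic d f" "p \<in> chart_domain a"
  shows "snd (chart d a) (bundle_point d f p) 0 = f (lift a p)"
  using bundle_point_proj[OF assms(1), of "lift a p"] lift_chart_domain[OF assms(2)] gauge_nonzero
  by (simp add: snd_chart)

text \<open>Evaluates the definite descriptions in \<open>dirac\<close> and
  \<open>zero_spinor_field\<close>. The charts are consistent because all their coordinates are
  values of one quasi-periodic function; uniqueness follows from injectivity of a single
  chart.\<close>

lemma fibre_element_bundle:
  assumes f: "quasi_periodic d f" and p: "p \<in> torus int_lattice"
    and v: "\<And>a. a \<in> chart_index \<Longrightarrow> p \<in> chart_domain a \<Longrightarrow> v (chart d a) 0 = f (lift a p)"
  shows "fibre_element (line_bundle d) p v = bundle_point d f p"
  unfolding fibre_element_def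
proof (rule the_equality)
  show "bundle_point d f p \<in> fibre (line_bundle d) p \<and> (\<forall>c\<in>bundle_atlas (line_bundle d). p \<in> fst c \<longrightarrow>
      (\<forall>i<bundle_rank (line_bundle d). snd c (bundle_point d f p) i = v c i))"
    using bundle_point_fibre[OF p] chart_bundle_point[OF f] v by auto
  fix e
  assume e: "e \<in> fibre (line_bundle d) p \<and> (\<forall>c\<in>bundle_atlas (line_bundle d). p \<in> fst c \<longrightarrow>
      (\<forall>i<bundle_rank (line_bundle d). snd c e i = v c i))"
  obtain a where a: "a \<in> chart_index" "p \<in> chart_domain a"
    using chart_domain_cover p by (auto elim!: torus_cases)
  have "snd (chart d a) e 0 = snd (chart d a) (bundle_point d f p) 0"
    using e a v[OF a] chart_bundle_point[OF f a(2)] by auto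
  then have "snd (chart d a) e = snd (chart d a) (bundle_point d f p)"
    by (auto simp: snd_chart fun_eq_iff)
  then show "e = bundle_point d f p"
    using bij_betw_imp_inj_on[OF bij_chart[OF a(2)]] e bundle_point_fibre[OF p] by (auto dest: inj_onD)
qed

lemma quasi_periodic_zero: "quasi_periodic d (\<lambda>x. 0)"
  by (simp add: quasi_periodic_def)

lemma zero_spinor_field_bundle:
  "zero_spinor_field int_lattice (line_bundle d) = (\<lambda>b. \<lambda>p\<in>torus int_lattice. bundle_point d (\<lambda>x. 0) p)"
  unfolding zero_spinor_field_def
  by (rule ext, rule restrict_ext, rule fibre_element_bundle) (auto intro: quasi_periodic_zero)

definition flat_section :: "(nat \<Rightarrow> int) \<Rightarrow> total_point spinor_field \<Rightarrow> spin_index \<Rightarrow> real ^ 8 \<Rightarrow> complex" where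
  "flat_section d \<psi> b x = gauge d x * snd (\<psi> b (proj x)) 0"

lemma spinor_sections_bundle:
  "\<psi> \<in> spinor_sections int_lattice (line_bundle d) \<longleftrightarrow>
     (\<forall>b. \<psi> b \<in> (\<Pi>\<^sub>E p\<in>torus int_lattice. fibre (line_bundle d) p)) \<and>
     (\<forall>a\<in>chart_index. \<forall>b. torus_smooth_on int_lattice (chart_domain a) (\<lambda>p. snd (chart d a) (\<psi> b p) 0))"
  by (simp add: spinor_sections_def)

lemma chart_section:
  assumes "\<psi> \<in> spinor_sections int_lattice (line_bundle d)" "p \<in> chart_domain a"
  shows "snd (chart d a) (\<psi> b p) 0 = flat_section d \<psi> b (lift a p)"
proof -
  have "\<psi> b p \<in> fibre (line_bundle d) p"
    using assms(1) chart_domain_torus[OF assms(2)] unfolding spinor_sections_bundle by (blast intro: PiE_mem)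
  then show ?thesis
    using lift_chart_domain[OF assms(2)] by (auto simp: flat_section_def snd_chart fibre_def)
qed

text \<open>In a chart one sees the value at the translated point \<open>y + l\<close>, which is
  smooth in \<open>y\<close>; the transformation law brings it back to \<open>y\<close> at the cost
  of a smooth factor, so the jumps of \<open>gauge\<close> do no harm.\<close>

lemma flat_section_lsections:
  assumes \<psi>: "\<psi> \<in> spinor_sections int_lattice (line_bundle d)"
  shows "flat_section d \<psi> b \<in> lsections d"
  unfolding lsections_iff
proof
  show q: "quasi_periodic d (flat_section d \<psi> b)"
    using gauge_quasi_periodic unfolding quasi_periodic_def flat_section_def by (simp add: proj_add mult.assoc)
  show "smooth_on UNIV (flat_section d \<psi> b)"
  proof (rule smooth_on_local)
    fix x
    obtain a where a: "a \<in> chart_index" "proj x \<in> chart_domain a" using chart_domain_cover by blast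
    then obtain l where l: "l \<in> int_lattice" "x + l \<in> open_cube a" by (auto simp: proj_chart_domain)
    let ?N = "{y. y + l \<in> open_cube a}" and ?h = "\<lambda>p. snd (chart d a) (\<psi> b p) 0"
    have "torus_smooth_on int_lattice (chart_domain a) ?h"
      using \<psi> a(1) unfolding spinor_sections_bundle by blast
    then have "smooth_on (proj -` chart_domain a) (?h \<circ> proj)"
      unfolding torus_smooth_on_def .
    then have h: "smooth_on ?N (?h \<circ> proj)"
      by (rule smooth_on_subset) (use l(1) in \<open>auto simp: proj_chart_domain\<close>)
    have "smooth_on ?N (\<lambda>y. automorphy d (- l) (y + l))"
      by (rule smooth_on_translate[OF smooth_automorphy]) auto
    then have "smooth_on ?N (\<lambda>y. automorphy d (- l) (y + l) * (?h \<circ> proj) y)"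
      by (intro smooth_on_mult open_translate_cube h)
    moreover have "flat_section d \<psi> b y = automorphy d (- l) (y + l) * (?h \<circ> proj) y" if "y \<in> ?N" for y
    proof -
      have "lift a (proj y) = y + l" using lift_proj[of "y + l" a] that l(1) by (simp add: proj_add)
      moreover have "proj y \<in> chart_domain a" using that l(1) by (auto simp: proj_chart_domain)
      ultimately have "(?h \<circ> proj) y = flat_section d \<psi> b (y + l)" using chart_section[OF \<psi>] by simp
      moreover have "flat_section d \<psi> b ((y + l) + - l) = automorphy d (- l) (y + l) * flat_section d \<psi> b (y + l)"
        using q int_lattice_minus[OF l(1)] unfolding quasi_periodic_def by blast
      ultimately show ?thesis by simp
    qed
    ultimately have "smooth_on ?N (flat_section d \<psi> b)"
      using smooth_on_cong[OF open_translate_cube] by (metis (mono_tags, lifting))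
    then show "\<exists>N. open N \<and> x \<in> N \<and> smooth_on N (flat_section d \<psi> b)"
      using open_translate_cube l(2) by blast
  qed
qed

lemma dirac_flat_quasi_periodic:
  assumes "\<And>b. F b \<in> lsections d"
  shows "quasi_periodic d (dirac_flat d F b)"
proof -
  have "nabla d k (F e) (x + l) = automorphy d l x * nabla d k (F e) x" if "l \<in> int_lattice" for k e x l
    using nabla_lsections[OF assms] that unfolding lsections_iff quasi_periodic_def by blast
  then show ?thesis
    unfolding quasi_periodic_def dirac_flat_def by (simp add: sum_distrib_left mult_ac)
qed

lemma dirac_bundle:
  assumes \<psi>: "\<psi> \<in> spinor_sections int_lattice (line_bundle d)"
  shows "dirac int_lattice (line_bundle d) (conn d) \<psi>
    = (\<lambda>b. \<lambda>p\<in>torus int_lattice. bundle_point d (dirac_flat d (flat_section d \<psi>) b) p)"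
  unfolding dirac_def
proof (rule ext, rule restrict_ext, rule fibre_element_bundle)
  fix b p a
  show "quasi_periodic d (dirac_flat d (flat_section d \<psi>) b)"
    by (rule dirac_flat_quasi_periodic[OF flat_section_lsections[OF \<psi>]])
  assume a: "a \<in> chart_index" and p: "p \<in> chart_domain a"
  have "local_covariant_deriv int_lattice (line_bundle d) (conn d) (chart d a) k \<psi> e p 0
      = nabla d k (flat_section d \<psi> e) (lift a p)" for k e
    using torus_deriv_chart[where h = "\<lambda>q. snd (chart d a) (\<psi> e q) 0" and f = "flat_section d \<psi> e",
        OF chart_section[OF \<psi>] p] chart_section[OF \<psi> p]
    by (simp add: local_covariant_deriv_def nabla_def conn_chart[OF a])
  then show "(\<Sum>k = 1..8. \<Sum>e\<in>UNIV. gamma k $ b $ e *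
      local_covariant_deriv int_lattice (line_bundle d) (conn d) (chart d a) k \<psi> e p 0)
      = dirac_flat d (flat_section d \<psi>) b (lift a p)"
    by (simp add: dirac_flat_def)
qed

section \<open>The kernel of the Dirac operator of the bundle\<close>

lemma dirac_kernel_iff:
  assumes \<psi>: "\<psi> \<in> spinor_sections int_lattice (line_bundle d)"
  shows "\<psi> \<in> dirac_kernel int_lattice (line_bundle d) (conn d) \<longleftrightarrow> (\<forall>b x. dirac_flat d (flat_section d \<psi>) b x = 0)"
proof -
  let ?D = "dirac_flat d (flat_section d \<psi>)"
  have q: "quasi_periodic d (?D b)" for b
    by (rule dirac_flat_quasi_periodic[OF flat_section_lsections[OF \<psi>]])
  have "bundle_point d (?D b) (proj x) = bundle_point d (\<lambda>x. 0) (proj x) \<longleftrightarrow> ?D b x = 0" for b x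
    using bundle_point_proj[OF q[of b], of x]
      bundle_point_proj[OF quasi_periodic_zero, of d x] gauge_nonzero[of d x]
    by (auto simp: fun_eq_iff dest: spec[of _ 0])
  then have "dirac int_lattice (line_bundle d) (conn d) \<psi> = zero_spinor_field int_lattice (line_bundle d)
      \<longleftrightarrow> (\<forall>b x. ?D b x = 0)"
    unfolding dirac_bundle[OF \<psi>] zero_spinor_field_bundle torus_def
    by (auto simp: fun_eq_iff restrict_def split: if_splits)
  then show ?thesis using \<psi> by (simp add: dirac_kernel_def)
qed

text \<open>A general \<open>W\<close> lets the same argument serve both chiralities.\<close>

lemma dirac_kernel_chirality:
  assumes nz: "\<And>j. j < 4 \<Longrightarrow> d j \<noteq> 0"
    and W: "\<And>\<eta>. (\<And>b. chirality b \<noteq> (\<Prod>j<4. sgn (d j)) \<Longrightarrow> \<eta> $ b = 0) \<Longrightarrow> \<eta> \<in> W"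
  shows "dirac_kernel int_lattice (line_bundle d) (conn d) \<subseteq> spinor_sections_in W int_lattice (line_bundle d)"
proof
  fix \<psi> assume k: "\<psi> \<in> dirac_kernel int_lattice (line_bundle d) (conn d)"
  then have \<psi>: "\<psi> \<in> spinor_sections int_lattice (line_bundle d)" by (simp add: dirac_kernel_def)
  have z: "dirac_flat d (flat_section d \<psi>) b x = 0" for b x using k dirac_kernel_iff[OF \<psi>] by blast
  have "flat_section d \<psi> b = (\<lambda>x. 0)" if "chirality b \<noteq> (\<Prod>j<4. sgn (d j))" for b
    by (rule dirac_flat_kernel_chirality[OF nz flat_section_lsections[OF \<psi>] z that])
  then have "(\<chi> b. snd (chart d a) (\<psi> b p) 0) \<in> W" if "p \<in> chart_domain a" for a p
    by (intro W) (simp add: chart_section[OF \<psi> that])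
  then show "\<psi> \<in> spinor_sections_in W int_lattice (line_bundle d)"
    unfolding spinor_sections_in_def using \<psi> by auto
qed

text \<open>The theta section is put into the lowest spin component, and its value at the origin
  distinguishes it from the zero field.\<close>

lemma dirac_kernel_nontrivial:
  assumes nz: "\<And>j. j < 4 \<Longrightarrow> d j \<noteq> 0"
  shows "\<exists>\<psi>\<in>dirac_kernel int_lattice (line_bundle d) (conn d). \<psi> \<noteq> zero_spinor_field int_lattice (line_bundle d)"
proof
  define F where "F = (\<lambda>b x. if b = lowest_spin_index d then theta_section d x else 0)"
  define \<psi> where "\<psi> = (\<lambda>b. \<lambda>p\<in>torus int_lattice. bundle_point d (F b) p)"
  have F: "F b \<in> lsections d" for b
    using theta_section_lsections[OF nz] quasi_periodic_zero
    by (cases "b = lowest_spin_index d") (simp_all add: F_def lsections_iff smooth_on_const)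
  then have Fs: "smooth_on UNIV (F b)" and Fq: "quasi_periodic d (F b)" for b by (simp_all add: lsections_iff)
  have c: "snd (chart d a) (\<psi> b p) 0 = F b (lift a p)" if "p \<in> chart_domain a" for a b p
    using chart_bundle_point[OF Fq that] chart_domain_torus[OF that] by (simp add: \<psi>_def)
  have "\<psi> b \<in> (\<Pi>\<^sub>E p\<in>torus int_lattice. fibre (line_bundle d) p)" for b
    using bundle_point_fibre by (auto simp: \<psi>_def)
  moreover have "torus_smooth_on int_lattice (chart_domain a) (\<lambda>p. snd (chart d a) (\<psi> b p) 0)" for a b
    by (rule torus_smooth_on_chart[OF c Fs])
  ultimately have \<psi>: "\<psi> \<in> spinor_sections int_lattice (line_bundle d)"
    unfolding spinor_sections_bundle by blast
  have s: "flat_section d \<psi> b x = F b x" for b x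
    using bundle_point_proj[OF Fq[of b], of x] gauge_nonzero[of d x]
    by (simp add: flat_section_def \<psi>_def proj_torus)
  then have "flat_section d \<psi> = F" by blast
  then show "\<psi> \<in> dirac_kernel int_lattice (line_bundle d) (conn d)"
    unfolding dirac_kernel_iff[OF \<psi>] using dirac_flat_theta_section[OF nz] by (simp add: F_def)
  have "flat_section d (zero_spinor_field int_lattice (line_bundle d)) b 0 = 0" for b
    unfolding zero_spinor_field_bundle flat_section_def
    by (simp add: proj_torus bundle_point_proj[OF quasi_periodic_zero])
  moreover have "flat_section d \<psi> (lowest_spin_index d) 0 \<noteq> 0"
    unfolding s F_def using theta_section_0[OF nz] by simp
  ultimately show "\<psi> \<noteq> zero_spinor_field int_lattice (line_bundle d)" by metis
qed

theorem theorem1: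
  shows "\<exists>(L :: (real ^ 8) set)
            (E\<^sub>1 :: total_point vbundle) (A\<^sub>1 :: total_point connection)
            (E\<^sub>2 :: total_point vbundle) (A\<^sub>2 :: total_point connection).
     full_lattice L \<and>
     spin7_instanton L E\<^sub>1 A\<^sub>1 \<and>
     spin7_instanton L E\<^sub>2 A\<^sub>2 \<and>
     (\<exists>\<psi>\<in>dirac_kernel L E\<^sub>1 A\<^sub>1. \<psi> \<noteq> zero_spinor_field L E\<^sub>1) \<and>
     dirac_kernel L E\<^sub>1 A\<^sub>1 \<subseteq> spinor_sections_in S_plus L E\<^sub>1 \<and>
     (\<exists>\<psi>\<in>dirac_kernel L E\<^sub>2 A\<^sub>2. \<psi> \<noteq> zero_spinor_field L E\<^sub>2) \<and>
     dirac_kernel L E\<^sub>2 A\<^sub>2 \<subseteq> spinor_sections_in S_minus L E\<^sub>2"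
proof -
  define d\<^sub>1 :: "nat \<Rightarrow> int" where "d\<^sub>1 = (\<lambda>j. 1)"
  \<comment> \<open>An odd number of negative entries gives one of the pairs \<open>d 0, d 3\<close>
    and \<open>d 1, d 2\<close> equal signs and the other opposite signs. The first sum has modulus
    at least 2, which opposite signs reach only with an entry of modulus at least 3.\<close>
  define d\<^sub>2 :: "nat \<Rightarrow> int" where "d\<^sub>2 = (\<lambda>j. if j = 0 then 3 else if j = 3 then - 1 else 1)"
  have nz: "d\<^sub>1 j \<noteq> 0" "d\<^sub>2 j \<noteq> 0" for j by (simp_all add: d\<^sub>1_def d\<^sub>2_def)
  have p: "(\<Prod>j<4. sgn (d\<^sub>1 j)) = 1" "(\<Prod>j<4. sgn (d\<^sub>2 j)) = - 1"
    by (simp_all add: d\<^sub>1_def d\<^sub>2_def eval_nat_numeral)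
  have "dirac_kernel int_lattice (line_bundle d\<^sub>1) (conn d\<^sub>1) \<subseteq> spinor_sections_in S_plus int_lattice (line_bundle d\<^sub>1)"
    by (rule dirac_kernel_chirality[OF nz(1)]) (simp add: S_plus_iff p)
  moreover have "dirac_kernel int_lattice (line_bundle d\<^sub>2) (conn d\<^sub>2) \<subseteq> spinor_sections_in S_minus int_lattice (line_bundle d\<^sub>2)"
    by (rule dirac_kernel_chirality[OF nz(2)]) (simp add: S_minus_iff p)
  moreover have "spin7_instanton int_lattice (line_bundle d\<^sub>1) (conn d\<^sub>1)" "spin7_instanton int_lattice (line_bundle d\<^sub>2) (conn d\<^sub>2)"
    by (rule spin7_instanton_bundle; simp add: d\<^sub>1_def d\<^sub>2_def)+
  ultimately show ?thesis
    using full_lattice_int_lattice dirac_kernel_nontrivial[of d\<^sub>1, OF nz(1)]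
      dirac_kernel_nontrivial[of d\<^sub>2, OF nz(2)]
    by (intro exI[of _ int_lattice] exI[of _ "line_bundle d\<^sub>1"] exI[of _ "conn d\<^sub>1"]
        exI[of _ "line_bundle d\<^sub>2"] exI[of _ "conn d\<^sub>2"] conjI)
qed

end
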